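(* For every ordinal $\alpha>2$ (infinite included), every finite $k\ge1$ and every $r\in\omega$, there is an algebra $\mathfrak A^r\in\mathfrak{Nr}_\alpha\mathsf{CA}_{\alpha+k}\setminus S\mathfrak{Nr}_\alpha\mathsf{CA}_{\alpha+k+1}$ such that $\prod_{r\in\omega}\mathfrak A^r/F\in\mathsf{RCA}_\alpha$ for any non-principal ultrafilter $F$ on $\omega$. In particular, the variety $S\mathfrak{Nr}_\alpha\mathsf{CA}_{\alpha+k+1}$ is not axiomatizable by a finite schema over $S\mathfrak{Nr}_\alpha\mathsf{CA}_{\alpha+k}$.
   Context: For an ordinal $\alpha$, $\mathsf{CA}_\alpha$ is the class of cylindric algebras of dimension $\alpha$. For $\alpha\le\beta$ and $\mathfrak B\in\mathsf{CA}_\beta$, the neat reduct $\mathfrak{Nr}_\alpha\mathfrak B\in\mathsf{CA}_\alpha$ has universe $\{b\in B:c_ib=b\text{ for all }\alpha\le i<\beta\}$ and the operations of $\mathfrak B$ with indices $<\alpha$; $\mathfrak{Nr}_\alpha\mathsf{CA}_\beta$ is the class of (isomorphic copies of) all such algebras, and $S$ is closure under subalgebras. $\mathsf{RCA}_\alpha$ is the class of representable algebras, i.e. those isomorphic to subalgebras of direct products of cylindric set algebras of dimension $\alpha$. "Axiomatizable by a finite schema over" means, for finite $\alpha$, by finitely many equations added; for infinite $\alpha$, by all instances of finitely many equation schemes added, an instance of a scheme (an equation in the signature of $\mathsf{CA}_\omega$) being obtained by replacing the finitely many indices occurring in it by indices $<\alpha$ via an injective map. *)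

theory Defs
  imports Complex_Main "HOL-Library.FuncSet"
begin

section \<open>Ordinals\<close>

text \<open>
  An ordinal is an element \<open>\<alpha>\<close> of a well-ordered type without a largest element; it is identified
  with its set of predecessors \<open>{..<\<alpha>}\<close>. Every ordinal \<open>\<alpha>\<close> occurs in this form, for instance
  in the well-order \<open>\<alpha> + \<omega>\<close>.
\<close>

definition ord_suc :: "'i::{wellorder,no_top} \<Rightarrow> 'i" where
  "ord_suc \<alpha> = (LEAST \<beta>. \<alpha> < \<beta>)"

definition ord_plus :: "'i::{wellorder,no_top} \<Rightarrow> nat \<Rightarrow> 'i" where
  "ord_plus \<alpha> n = (ord_suc ^^ n) \<alpha>"

definition ord_nat :: "nat \<Rightarrow> 'i::{wellorder,no_top}" where
  "ord_nat n = ord_plus (LEAST \<alpha>. True) n"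


section \<open>Cylindric algebras\<close>

record ('i, 'a) cyl_alg =
  carrier :: "'a set"
  join :: "'a \<Rightarrow> 'a \<Rightarrow> 'a"
  meet :: "'a \<Rightarrow> 'a \<Rightarrow> 'a"
  compl :: "'a \<Rightarrow> 'a"
  zer :: 'a
  one :: 'a
  cyl :: "'i \<Rightarrow> 'a \<Rightarrow> 'a"
  diag :: "'i \<Rightarrow> 'i \<Rightarrow> 'a"

text \<open>
  Algebras of the similarity type of \<open>CA\<^sub>\<alpha>\<close>. The values of the operations outside the carrier or
  at indices not below \<open>\<alpha>\<close> are irrelevant.
\<close>

definition cyl_type :: "'i::wellorder \<Rightarrow> ('i, 'a) cyl_alg \<Rightarrow> bool" where
  "cyl_type \<alpha> A \<longleftrightarrow>
     (\<forall>x\<in>carrier A. \<forall>y\<in>carrier A. join A x y \<in> carrier A \<and> meet A x y \<in> carrier A) \<and>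
     (\<forall>x\<in>carrier A. compl A x \<in> carrier A) \<and>
     zer A \<in> carrier A \<and> one A \<in> carrier A \<and>
     (\<forall>i<\<alpha>. \<forall>x\<in>carrier A. cyl A i x \<in> carrier A) \<and>
     (\<forall>i<\<alpha>. \<forall>j<\<alpha>. diag A i j \<in> carrier A)"

definition boolean_axioms :: "('i, 'a) cyl_alg \<Rightarrow> bool" where
  "boolean_axioms A \<longleftrightarrow>
     (\<forall>x\<in>carrier A. \<forall>y\<in>carrier A. join A x y = join A y x \<and> meet A x y = meet A y x) \<and>
     (\<forall>x\<in>carrier A. \<forall>y\<in>carrier A. \<forall>z\<in>carrier A.
        join A x (meet A y z) = meet A (join A x y) (join A x z) \<and>
        meet A x (join A y z) = join A (meet A x y) (meet A x z)) \<and>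
     (\<forall>x\<in>carrier A. join A x (zer A) = x \<and> meet A x (one A) = x \<and>
        join A x (compl A x) = one A \<and> meet A x (compl A x) = zer A)"

definition CA :: "'i::wellorder \<Rightarrow> ('i, 'a) cyl_alg set" where
  "CA \<alpha> = {A. cyl_type \<alpha> A \<and> boolean_axioms A \<and>
     (\<forall>i<\<alpha>. cyl A i (zer A) = zer A) \<and>
     (\<forall>i<\<alpha>. \<forall>x\<in>carrier A. join A x (cyl A i x) = cyl A i x) \<and>
     (\<forall>i<\<alpha>. \<forall>x\<in>carrier A. \<forall>y\<in>carrier A.
        cyl A i (meet A x (cyl A i y)) = meet A (cyl A i x) (cyl A i y)) \<and>
     (\<forall>i<\<alpha>. \<forall>j<\<alpha>. \<forall>x\<in>carrier A. cyl A i (cyl A j x) = cyl A j (cyl A i x)) \<and>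
     (\<forall>i<\<alpha>. diag A i i = one A) \<and>
     (\<forall>i<\<alpha>. \<forall>j<\<alpha>. \<forall>k<\<alpha>. k \<noteq> i \<longrightarrow> k \<noteq> j \<longrightarrow>
        diag A i j = cyl A k (meet A (diag A i k) (diag A k j))) \<and>
     (\<forall>i<\<alpha>. \<forall>j<\<alpha>. \<forall>x\<in>carrier A. i \<noteq> j \<longrightarrow>
        meet A (cyl A i (meet A (diag A i j) x)) (cyl A i (meet A (diag A i j) (compl A x))) = zer A)}"

definition cyl_hom :: "'i::wellorder \<Rightarrow> ('i, 'a) cyl_alg \<Rightarrow> ('i, 'b) cyl_alg \<Rightarrow> ('a \<Rightarrow> 'b) \<Rightarrow> bool" where
  "cyl_hom \<alpha> A B f \<longleftrightarrow> cyl_type \<alpha> A \<and> cyl_type \<alpha> B \<and>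
     (\<forall>x\<in>carrier A. f x \<in> carrier B) \<and>
     (\<forall>x\<in>carrier A. \<forall>y\<in>carrier A. f (join A x y) = join B (f x) (f y)) \<and>
     (\<forall>x\<in>carrier A. \<forall>y\<in>carrier A. f (meet A x y) = meet B (f x) (f y)) \<and>
     (\<forall>x\<in>carrier A. f (compl A x) = compl B (f x)) \<and>
     f (zer A) = zer B \<and> f (one A) = one B \<and>
     (\<forall>i<\<alpha>. \<forall>x\<in>carrier A. f (cyl A i x) = cyl B i (f x)) \<and>
     (\<forall>i<\<alpha>. \<forall>j<\<alpha>. f (diag A i j) = diag B i j)"

definition isomorphic :: "'i::wellorder \<Rightarrow> ('i, 'a) cyl_alg \<Rightarrow> ('i, 'b) cyl_alg \<Rightarrow> bool" where
  "isomorphic \<alpha> A B \<longleftrightarrow> (\<exists>f. cyl_hom \<alpha> A B f \<and> bij_betw f (carrier A) (carrier B))"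

text \<open>\<open>C\<close> is a subalgebra of \<open>D\<close>: the inclusion map is defined and is a homomorphism.\<close>

definition subalgebra :: "'i::wellorder \<Rightarrow> ('i, 'a) cyl_alg \<Rightarrow> ('i, 'a) cyl_alg \<Rightarrow> bool" where
  "subalgebra \<alpha> C D \<longleftrightarrow> cyl_hom \<alpha> C D (\<lambda>x. x)"


section \<open>Terms and equations\<close>

datatype (inds: 'i, vars: 'v) cterm =
    Var 'v
  | Join "('i, 'v) cterm" "('i, 'v) cterm"
  | Meet "('i, 'v) cterm" "('i, 'v) cterm"
  | Compl "('i, 'v) cterm"
  | Zer
  | One
  | Cyl 'i "('i, 'v) cterm"
  | Diag 'i 'i

primrec eval_term :: "('i, 'a) cyl_alg \<Rightarrow> ('v \<Rightarrow> 'a) \<Rightarrow> ('i, 'v) cterm \<Rightarrow> 'a" where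
  "eval_term A \<rho> (Var v) = \<rho> v"
| "eval_term A \<rho> (Join s t) = join A (eval_term A \<rho> s) (eval_term A \<rho> t)"
| "eval_term A \<rho> (Meet s t) = meet A (eval_term A \<rho> s) (eval_term A \<rho> t)"
| "eval_term A \<rho> (Compl t) = compl A (eval_term A \<rho> t)"
| "eval_term A \<rho> Zer = zer A"
| "eval_term A \<rho> One = one A"
| "eval_term A \<rho> (Cyl i t) = cyl A i (eval_term A \<rho> t)"
| "eval_term A \<rho> (Diag i j) = diag A i j"

type_synonym 'i equation = "('i, nat) cterm \<times> ('i, nat) cterm"

definition eq_inds :: "'i equation \<Rightarrow> 'i set" where
  "eq_inds e = inds (fst e) \<union> inds (snd e)"

definition satisfies :: "('i, 'a) cyl_alg \<Rightarrow> 'i equation \<Rightarrow> bool" where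
  "satisfies A e \<longleftrightarrow>
     (\<forall>\<rho>. range \<rho> \<subseteq> carrier A \<longrightarrow> eval_term A \<rho> (fst e) = eval_term A \<rho> (snd e))"

text \<open>Equation schemes are equations in the signature of \<open>CA\<^sub>\<omega>\<close>, with \<open>nat\<close> as index set.\<close>

definition scheme_instances :: "'i::wellorder \<Rightarrow> nat equation \<Rightarrow> 'i equation set" where
  "scheme_instances \<alpha> e =
     {map_prod (map_cterm \<sigma> id) (map_cterm \<sigma> id) e | \<sigma>.
        inj_on \<sigma> (eq_inds e) \<and> \<sigma> ` eq_inds e \<subseteq> {..<\<alpha>}}"

definition finite_schema_axiomatizable_over ::
    "'i::wellorder \<Rightarrow> ('i, 'a) cyl_alg set \<Rightarrow> ('i, 'a) cyl_alg set \<Rightarrow> bool" where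
  "finite_schema_axiomatizable_over \<alpha> V W \<longleftrightarrow>
     (if finite {..<\<alpha>}
      then \<exists>E :: 'i equation set. finite E \<and> (\<forall>e\<in>E. eq_inds e \<subseteq> {..<\<alpha>}) \<and>
             V = {A \<in> W. \<forall>e\<in>E. satisfies A e}
      else \<exists>E :: nat equation set. finite E \<and>
             V = {A \<in> W. \<forall>e\<in>E. \<forall>e'\<in>scheme_instances \<alpha> e. satisfies A e'})"


section \<open>Neat reducts\<close>

definition neat_reduct :: "'i::wellorder \<Rightarrow> 'i \<Rightarrow> ('i, 'a) cyl_alg \<Rightarrow> ('i, 'a) cyl_alg" where
  "neat_reduct \<alpha> \<beta> B = B\<lparr>carrier := {b \<in> carrier B. \<forall>i. \<alpha> \<le> i \<and> i < \<beta> \<longrightarrow> cyl B i b = b}\<rparr>"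

text \<open>
  HOL has no quantification over all carrier types, so the algebra \<open>B\<close> in the next two definitions
  ranges over algebras whose elements are terms over \<open>A\<close>. Nothing is lost: replacing \<open>B\<close> by the
  subalgebra generated by the image of \<open>A\<close>, one may always choose such a \<open>B\<close>. This is proved
  in \<open>Nr_CA_any_type\<close> and \<open>SNr_CA_any_type\<close> below, where the carrier type of \<open>B\<close> is arbitrary.
\<close>

definition Nr_CA :: "'i::wellorder \<Rightarrow> 'i \<Rightarrow> ('i, 'a) cyl_alg set" where
  "Nr_CA \<alpha> \<beta> = {A. \<exists>B :: ('i, ('i, 'a) cterm) cyl_alg.
     B \<in> CA \<beta> \<and> isomorphic \<alpha> A (neat_reduct \<alpha> \<beta> B)}"

definition SNr_CA :: "'i::wellorder \<Rightarrow> 'i \<Rightarrow> ('i, 'a) cyl_alg set" where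
  "SNr_CA \<alpha> \<beta> = {A. \<exists>(B :: ('i, ('i, 'a) cterm) cyl_alg) C.
     B \<in> CA \<beta> \<and> subalgebra \<alpha> C (neat_reduct \<alpha> \<beta> B) \<and> isomorphic \<alpha> A C}"


section \<open>Representable algebras\<close>

text \<open>The algebra of all subsets of \<open>\<^sup>\<alpha>U\<close>; a cylindric set algebra is a subalgebra of such an algebra.\<close>

definition full_set_alg :: "'i::wellorder \<Rightarrow> 'u set \<Rightarrow> ('i, ('i \<Rightarrow> 'u) set) cyl_alg" where
  "full_set_alg \<alpha> U = \<lparr>
     carrier = Pow ({..<\<alpha>} \<rightarrow>\<^sub>E U),
     join = (\<union>),
     meet = (\<inter>),
     compl = (\<lambda>X. ({..<\<alpha>} \<rightarrow>\<^sub>E U) - X),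
     zer = {},
     one = {..<\<alpha>} \<rightarrow>\<^sub>E U,
     cyl = (\<lambda>i X. {s \<in> {..<\<alpha>} \<rightarrow>\<^sub>E U. \<exists>u\<in>U. s(i := u) \<in> X}),
     diag = (\<lambda>i j. {s \<in> {..<\<alpha>} \<rightarrow>\<^sub>E U. s i = s j})\<rparr>"

definition Cs :: "'i::wellorder \<Rightarrow> ('i, ('i \<Rightarrow> 'u) set) cyl_alg set" where
  "Cs \<alpha> = {C. \<exists>U. subalgebra \<alpha> C (full_set_alg \<alpha> U)}"

definition direct_product :: "'j set \<Rightarrow> ('j \<Rightarrow> ('i, 'b) cyl_alg) \<Rightarrow> ('i, 'j \<Rightarrow> 'b) cyl_alg" where
  "direct_product J C = \<lparr>
     carrier = (\<Pi>\<^sub>E j\<in>J. carrier (C j)),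
     join = (\<lambda>x y. \<lambda>j\<in>J. join (C j) (x j) (y j)),
     meet = (\<lambda>x y. \<lambda>j\<in>J. meet (C j) (x j) (y j)),
     compl = (\<lambda>x. \<lambda>j\<in>J. compl (C j) (x j)),
     zer = (\<lambda>j\<in>J. zer (C j)),
     one = (\<lambda>j\<in>J. one (C j)),
     cyl = (\<lambda>i x. \<lambda>j\<in>J. cyl (C j) i (x j)),
     diag = (\<lambda>i k. \<lambda>j\<in>J. diag (C j) i k)\<rparr>"

text \<open>
  As for neat reducts, the index set of the product and the bases of the set algebras must be taken
  from fixed types. One factor for each pair of elements of \<open>A\<close> suffices, and a base can be shrunk
  to the closure of a single sequence under choosing witnesses: \<open>Wit i a s\<close> stands for some \<open>u\<close> such
  that \<open>s(i := u)\<close> belongs to the set representing \<open>a\<close>. The lemma \<open>RCA_any_type\<close> below proves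
  that index sets and bases in arbitrary types give nothing more.
\<close>

datatype ('i, 'a) wit = Pt 'i | Wit 'i 'a "'i \<Rightarrow> ('i, 'a) wit"

definition RCA :: "'i::wellorder \<Rightarrow> ('i, 'a) cyl_alg set" where
  "RCA \<alpha> = {A. \<exists>(J :: ('a \<times> 'a) set) (C :: 'a \<times> 'a \<Rightarrow> ('i, ('i \<Rightarrow> ('i, 'a) wit) set) cyl_alg) D.
     (\<forall>j\<in>J. C j \<in> Cs \<alpha>) \<and> subalgebra \<alpha> D (direct_product J C) \<and> isomorphic \<alpha> A D}"


section \<open>Ultraproducts\<close>

definition nonprincipal_ultrafilter :: "'r filter \<Rightarrow> bool" where
  "nonprincipal_ultrafilter F \<longleftrightarrow> F \<noteq> bot \<and>
     (\<forall>P. eventually P F \<or> eventually (\<lambda>x. \<not> P x) F) \<and>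
     (\<forall>r. \<not> eventually (\<lambda>x. x = r) F)"

text \<open>
  The elements are the classes of choice functions that are equal \<open>F\<close>-almost everywhere. An
  operation is applied to representatives; the result is given as the class of all choice functions
  that agree with it almost everywhere.
\<close>

definition ultraproduct ::
    "'r filter \<Rightarrow> ('r \<Rightarrow> ('i, 'a) cyl_alg) \<Rightarrow> ('i, ('r \<Rightarrow> 'a) set) cyl_alg" where
  "ultraproduct F A = (let P = (\<Pi> r\<in>UNIV. carrier (A r)) in \<lparr>
     carrier = {{g \<in> P. \<forall>\<^sub>F r in F. g r = f r} | f. f \<in> P},
     join = (\<lambda>X Y. {h \<in> P. \<exists>f\<in>X. \<exists>g\<in>Y. \<forall>\<^sub>F r in F. h r = join (A r) (f r) (g r)}),
     meet = (\<lambda>X Y. {h \<in> P. \<exists>f\<in>X. \<exists>g\<in>Y. \<forall>\<^sub>F r in F. h r = meet (A r) (f r) (g r)}),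
     compl = (\<lambda>X. {h \<in> P. \<exists>f\<in>X. \<forall>\<^sub>F r in F. h r = compl (A r) (f r)}),
     zer = {h \<in> P. \<forall>\<^sub>F r in F. h r = zer (A r)},
     one = {h \<in> P. \<forall>\<^sub>F r in F. h r = one (A r)},
     cyl = (\<lambda>i X. {h \<in> P. \<exists>f\<in>X. \<forall>\<^sub>F r in F. h r = cyl (A r) i (f r)}),
     diag = (\<lambda>i j. {h \<in> P. \<forall>\<^sub>F r in F. h r = diag (A r) i j})\<rparr>)"


section \<open>Independence of the carrier types\<close>

lemma embedding_imp_iso_subalgebra:
  assumes f: "cyl_hom \<alpha> A P f" and inj: "inj_on f (carrier A)"
  shows "\<exists>D. subalgebra \<alpha> D P \<and> isomorphic \<alpha> A D"
proof -
  let ?D = "P\<lparr>carrier := f ` carrier A\<rparr>"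
  have A: "cyl_type \<alpha> A" and P: "cyl_type \<alpha> P" using f by (auto simp: cyl_hom_def)
  have D: "cyl_type \<alpha> ?D"
    using f A unfolding cyl_hom_def cyl_type_def
    by simp (metis imageI)
  have "subalgebra \<alpha> ?D P"
    using f D P unfolding subalgebra_def cyl_hom_def by auto
  moreover have "cyl_hom \<alpha> A ?D f"
    using f D unfolding cyl_hom_def by auto
  ultimately show ?thesis
    unfolding isomorphic_def using inj by (intro exI[of _ ?D]) (auto simp: bij_betw_def)
qed

lemma iso_subalgebra_imp_embedding:
  assumes "subalgebra \<alpha> D P" "isomorphic \<alpha> A D"
  shows "\<exists>f. cyl_hom \<alpha> A P f \<and> inj_on f (carrier A)"
proof -
  obtain f where f: "cyl_hom \<alpha> A D f" "bij_betw f (carrier A) (carrier D)"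
    using assms(2) by (auto simp: isomorphic_def)
  then have "cyl_hom \<alpha> A P f"
    using assms(1) by (simp add: subalgebra_def cyl_hom_def)
  then show ?thesis using f(2) by (auto simp: bij_betw_def)
qed

text \<open>The isomorphic copy, along \<open>e\<close>, of the part of \<open>B\<close> on the set \<open>G\<close>.\<close>

definition transport :: "('b \<Rightarrow> 'c) \<Rightarrow> 'b set \<Rightarrow> ('i, 'b) cyl_alg \<Rightarrow> ('i, 'c) cyl_alg" where
  "transport e G B = \<lparr>
     carrier = e ` G,
     join = (\<lambda>x y. e (join B (the_inv_into G e x) (the_inv_into G e y))),
     meet = (\<lambda>x y. e (meet B (the_inv_into G e x) (the_inv_into G e y))),
     compl = (\<lambda>x. e (compl B (the_inv_into G e x))),
     zer = e (zer B),
     one = e (one B),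
     cyl = (\<lambda>i x. e (cyl B i (the_inv_into G e x))),
     diag = (\<lambda>i j. e (diag B i j))\<rparr>"

lemma transport_CA:
  assumes B: "B \<in> CA \<beta>" and G: "cyl_type \<beta> (B\<lparr>carrier := G\<rparr>)" "G \<subseteq> carrier B" and e: "inj_on e G"
  shows "transport e G B \<in> CA \<beta>"
proof -
  have d: "the_inv_into G e (e x) = x" if "x \<in> G" for x
    using e that by (rule the_inv_into_f_f)
  have GB: "x \<in> carrier B" if "x \<in> G" for x using G(2) that by auto
  have cl: "x \<in> G \<Longrightarrow> y \<in> G \<Longrightarrow> join B x y \<in> G" "x \<in> G \<Longrightarrow> y \<in> G \<Longrightarrow> meet B x y \<in> G"
    "x \<in> G \<Longrightarrow> compl B x \<in> G" "zer B \<in> G" "one B \<in> G" "i < \<beta> \<Longrightarrow> x \<in> G \<Longrightarrow> cyl B i x \<in> G"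
    "i < \<beta> \<Longrightarrow> j < \<beta> \<Longrightarrow> diag B i j \<in> G" for x y i j
    using G(1) by (simp_all add: cyl_type_def)
  have sel: "carrier (transport e G B) = e ` G"
    "x \<in> G \<Longrightarrow> y \<in> G \<Longrightarrow> join (transport e G B) (e x) (e y) = e (join B x y)"
    "x \<in> G \<Longrightarrow> y \<in> G \<Longrightarrow> meet (transport e G B) (e x) (e y) = e (meet B x y)"
    "x \<in> G \<Longrightarrow> compl (transport e G B) (e x) = e (compl B x)"
    "zer (transport e G B) = e (zer B)" "one (transport e G B) = e (one B)"
    "x \<in> G \<Longrightarrow> cyl (transport e G B) i (e x) = e (cyl B i x)"
    "diag (transport e G B) i j = e (diag B i j)" for x y i j
    by (simp_all add: transport_def d)
  have 1: "cyl_type \<beta> (transport e G B)"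
    unfolding cyl_type_def by (simp add: sel cl)
  have ba: "boolean_axioms B" using B unfolding CA_def by blast
  have b1: "join B x y = join B y x" "meet B x y = meet B y x" if "x \<in> G" "y \<in> G" for x y
    using ba GB[OF that(1)] GB[OF that(2)] unfolding boolean_axioms_def by blast+
  have b2: "join B x (meet B y z) = meet B (join B x y) (join B x z)"
    "meet B x (join B y z) = join B (meet B x y) (meet B x z)" if "x \<in> G" "y \<in> G" "z \<in> G" for x y z
    using ba GB[OF that(1)] GB[OF that(2)] GB[OF that(3)] unfolding boolean_axioms_def by blast+
  have b3: "join B x (zer B) = x" "meet B x (one B) = x"
    "join B x (compl B x) = one B" "meet B x (compl B x) = zer B" if "x \<in> G" for x
    using ba GB[OF that] unfolding boolean_axioms_def by blast+
  have 2: "boolean_axioms (transport e G B)"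
    unfolding boolean_axioms_def sel(1) ball_simps
    apply (intro conjI ballI)
    subgoal for x y using b1(1)[of x y] by (simp only: sel)
    subgoal for x y using b1(2)[of x y] by (simp only: sel)
    subgoal for x y z using b2(1)[of x y z] by (simp only: sel cl)
    subgoal for x y z using b2(2)[of x y z] by (simp only: sel cl)
    subgoal for x using b3(1)[of x] by (simp only: sel cl)
    subgoal for x using b3(2)[of x] by (simp only: sel cl)
    subgoal for x using b3(3)[of x] by (simp only: sel cl)
    subgoal for x using b3(4)[of x] by (simp only: sel cl)
    done
  have c0: "cyl B i (zer B) = zer B" "diag B i i = one B" if "i < \<beta>" for i
    using B that unfolding CA_def by blast+
  have c2: "join B x (cyl B i x) = cyl B i x" if "i < \<beta>" "x \<in> G" for i x
    using B that(1) GB[OF that(2)] unfolding CA_def by blast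
  have c3: "cyl B i (meet B x (cyl B i y)) = meet B (cyl B i x) (cyl B i y)"
    if "i < \<beta>" "x \<in> G" "y \<in> G" for i x y
    using B that(1) GB[OF that(2)] GB[OF that(3)] unfolding CA_def by blast
  have c4: "cyl B i (cyl B j x) = cyl B j (cyl B i x)" if "i < \<beta>" "j < \<beta>" "x \<in> G" for i j x
    using B that(1,2) GB[OF that(3)] unfolding CA_def by blast
  have c6: "diag B i j = cyl B k (meet B (diag B i k) (diag B k j))"
    if "i < \<beta>" "j < \<beta>" "k < \<beta>" "k \<noteq> i" "k \<noteq> j" for i j k
    using B that unfolding CA_def by blast
  have c7: "meet B (cyl B i (meet B (diag B i j) x)) (cyl B i (meet B (diag B i j) (compl B x))) = zer B"
    if "i < \<beta>" "j < \<beta>" "i \<noteq> j" "x \<in> G" for i j x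
    using B that(1-3) GB[OF that(4)] unfolding CA_def by blast
  show ?thesis
    unfolding CA_def mem_Collect_eq sel(1) ball_simps
    apply (intro conjI 1 2 allI impI ballI)
    subgoal for i using c0(1)[of i] by (simp only: sel cl)
    subgoal for i x using c2[of i x] by (simp only: sel cl)
    subgoal for i x y using c3[of i x y] by (simp only: sel cl)
    subgoal for i j x using c4[of i j x] by (simp only: sel cl)
    subgoal for i using c0(2)[of i] by (simp only: sel cl)
    subgoal for i j k using c6[of i j k] by (simp only: sel cl simp_thms)
    subgoal for i j x using c7[of i j x] by (simp only: sel cl simp_thms)
    done
qed

lemma generated_part:
  fixes B :: "('i::wellorder, 'b) cyl_alg" and h :: "'a \<Rightarrow> 'b"
  assumes B: "B \<in> CA \<beta>" and h: "\<forall>a\<in>carrier A. h a \<in> carrier B"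
  shows "\<exists>G (e :: 'b \<Rightarrow> ('i, 'a) cterm). h ` carrier A \<subseteq> G \<and> G \<subseteq> carrier B \<and>
           cyl_type \<beta> (B\<lparr>carrier := G\<rparr>) \<and> inj_on e G"
proof -
  define T where "T = {t :: ('i, 'a) cterm. inds t \<subseteq> {..<\<beta>} \<and> vars t \<subseteq> carrier A}"
  define G where "G = eval_term B h ` T"
  define e where "e = inv_into T (eval_term B h)"
  have ct: "cyl_type \<beta> B" using B by (simp add: CA_def)
  have "eval_term B h t \<in> carrier B" if "inds t \<subseteq> {..<\<beta>}" "vars t \<subseteq> carrier A" for t
    using that ct h by (induction t) (auto simp: cyl_type_def)
  then have GB: "G \<subseteq> carrier B" by (auto simp: G_def T_def)
  have hG: "h a \<in> G" if "a \<in> carrier A" for a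
    unfolding G_def T_def by (rule image_eqI[of _ _ "Var a"]) (use that in auto)
  have "join B x y \<in> G" if xy: "x \<in> G" "y \<in> G" for x y
  proof -
    obtain s t where "s \<in> T" "t \<in> T" "x = eval_term B h s" "y = eval_term B h t"
      using xy by (auto simp: G_def)
    then show ?thesis
      unfolding G_def by (intro image_eqI[of _ _ "Join s t"]) (auto simp: T_def)
  qed
  moreover have "meet B x y \<in> G" if xy: "x \<in> G" "y \<in> G" for x y
  proof -
    obtain s t where "s \<in> T" "t \<in> T" "x = eval_term B h s" "y = eval_term B h t"
      using xy by (auto simp: G_def)
    then show ?thesis
      unfolding G_def by (intro image_eqI[of _ _ "Meet s t"]) (auto simp: T_def)
  qed
  moreover have "compl B x \<in> G" if x: "x \<in> G" for x
  proof -
    obtain s where "s \<in> T" "x = eval_term B h s" using x by (auto simp: G_def)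
    then show ?thesis
      unfolding G_def by (intro image_eqI[of _ _ "Compl s"]) (auto simp: T_def)
  qed
  moreover have "cyl B i x \<in> G" if x: "x \<in> G" "i < \<beta>" for x i
  proof -
    obtain s where "s \<in> T" "x = eval_term B h s" using x by (auto simp: G_def)
    then show ?thesis
      unfolding G_def using x(2) by (intro image_eqI[of _ _ "Cyl i s"]) (auto simp: T_def)
  qed
  moreover have "zer B \<in> G"
    unfolding G_def by (intro image_eqI[of _ _ Zer]) (auto simp: T_def)
  moreover have "one B \<in> G"
    unfolding G_def by (intro image_eqI[of _ _ One]) (auto simp: T_def)
  moreover have "diag B i j \<in> G" if "i < \<beta>" "j < \<beta>" for i j
    unfolding G_def using that by (intro image_eqI[of _ _ "Diag i j"]) (auto simp: T_def)
  ultimately have "cyl_type \<beta> (B\<lparr>carrier := G\<rparr>)" by (simp add: cyl_type_def)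
  moreover have "inj_on e G"
    unfolding e_def G_def by (rule inj_on_inv_into) auto
  ultimately show ?thesis using hG GB by blast
qed

lemma cyl_type_mono: "cyl_type \<beta> A \<Longrightarrow> \<alpha> \<le> \<beta> \<Longrightarrow> cyl_type \<alpha> A"
  unfolding cyl_type_def by (meson less_le_trans)

lemma neat_hom_transport:
  assumes ab: "\<alpha> \<le> \<beta>" and h: "cyl_hom \<alpha> A (neat_reduct \<alpha> \<beta> B) h"
    and G: "h ` carrier A \<subseteq> G" "G \<subseteq> carrier B" "cyl_type \<beta> (B\<lparr>carrier := G\<rparr>)" and e: "inj_on e G"
  shows "cyl_hom \<alpha> A (neat_reduct \<alpha> \<beta> (transport e G B)) (\<lambda>a. e (h a))"
proof -
  have d: "the_inv_into G e (e x) = x" if "x \<in> G" for x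
    using e that by (rule the_inv_into_f_f)
  have hG: "h a \<in> G" if "a \<in> carrier A" for a using G(1) that by auto
  have cl: "x \<in> G \<Longrightarrow> y \<in> G \<Longrightarrow> join B x y \<in> G" "x \<in> G \<Longrightarrow> y \<in> G \<Longrightarrow> meet B x y \<in> G"
    "x \<in> G \<Longrightarrow> compl B x \<in> G" "zer B \<in> G" "one B \<in> G" "i < \<beta> \<Longrightarrow> x \<in> G \<Longrightarrow> cyl B i x \<in> G"
    "i < \<beta> \<Longrightarrow> j < \<beta> \<Longrightarrow> diag B i j \<in> G" for x y i j
    using G(3) by (simp_all add: cyl_type_def)
  have lt: "i < \<alpha> \<Longrightarrow> i < \<beta>" for i using ab by auto
  define N where "N = {b \<in> carrier B. \<forall>i. \<alpha> \<le> i \<and> i < \<beta> \<longrightarrow> cyl B i b = b}"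
  have ctN: "cyl_type \<alpha> (neat_reduct \<alpha> \<beta> B)" using h by (simp add: cyl_hom_def)
  have car: "carrier (neat_reduct \<alpha> \<beta> (transport e G B)) = e ` (G \<inter> N)"
  proof -
    have "e x \<in> carrier (neat_reduct \<alpha> \<beta> (transport e G B)) \<longleftrightarrow> x \<in> N" if "x \<in> G" for x
      using that G(2) cl e by (auto simp: N_def neat_reduct_def transport_def d inj_on_eq_iff)
    moreover have "carrier (neat_reduct \<alpha> \<beta> (transport e G B)) \<subseteq> e ` G"
      by (auto simp: neat_reduct_def transport_def)
    ultimately show ?thesis by blast
  qed
  have Ncl: "x \<in> N \<Longrightarrow> y \<in> N \<Longrightarrow> join B x y \<in> N" "x \<in> N \<Longrightarrow> y \<in> N \<Longrightarrow> meet B x y \<in> N"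
    "x \<in> N \<Longrightarrow> compl B x \<in> N" "zer B \<in> N" "one B \<in> N" "i < \<alpha> \<Longrightarrow> x \<in> N \<Longrightarrow> cyl B i x \<in> N"
    "i < \<alpha> \<Longrightarrow> j < \<alpha> \<Longrightarrow> diag B i j \<in> N" for x y i j
    using ctN unfolding cyl_type_def neat_reduct_def N_def[symmetric] by simp_all
  have ops: "x \<in> G \<Longrightarrow> y \<in> G \<Longrightarrow> join (neat_reduct \<alpha> \<beta> (transport e G B)) (e x) (e y) = e (join B x y)"
    "x \<in> G \<Longrightarrow> y \<in> G \<Longrightarrow> meet (neat_reduct \<alpha> \<beta> (transport e G B)) (e x) (e y) = e (meet B x y)"
    "x \<in> G \<Longrightarrow> compl (neat_reduct \<alpha> \<beta> (transport e G B)) (e x) = e (compl B x)"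
    "zer (neat_reduct \<alpha> \<beta> (transport e G B)) = e (zer B)"
    "one (neat_reduct \<alpha> \<beta> (transport e G B)) = e (one B)"
    "x \<in> G \<Longrightarrow> cyl (neat_reduct \<alpha> \<beta> (transport e G B)) i (e x) = e (cyl B i x)"
    "diag (neat_reduct \<alpha> \<beta> (transport e G B)) i j = e (diag B i j)" for x y i j
    by (simp_all add: neat_reduct_def transport_def d)
  have 1: "cyl_type \<alpha> (neat_reduct \<alpha> \<beta> (transport e G B))"
    unfolding cyl_type_def car
    using cl Ncl lt by (auto simp: ops)
  have hN: "h a \<in> N" if "a \<in> carrier A" for a
    using h that unfolding cyl_hom_def neat_reduct_def N_def[symmetric] by simp
  have hom: "cyl_type \<alpha> A"
    "x \<in> carrier A \<Longrightarrow> y \<in> carrier A \<Longrightarrow> h (join A x y) = join B (h x) (h y)"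
    "x \<in> carrier A \<Longrightarrow> y \<in> carrier A \<Longrightarrow> h (meet A x y) = meet B (h x) (h y)"
    "x \<in> carrier A \<Longrightarrow> h (compl A x) = compl B (h x)"
    "h (zer A) = zer B" "h (one A) = one B"
    "i < \<alpha> \<Longrightarrow> x \<in> carrier A \<Longrightarrow> h (cyl A i x) = cyl B i (h x)"
    "i < \<alpha> \<Longrightarrow> j < \<alpha> \<Longrightarrow> h (diag A i j) = diag B i j" for x y i j
    using h unfolding cyl_hom_def neat_reduct_def by simp_all
  show ?thesis
    unfolding cyl_hom_def car using 1 hom hG hN
    by (auto simp: ops)
qed

lemma Nr_CA_any_type:
  fixes A :: "('i::wellorder, 'a) cyl_alg" and B :: "('i, 'b) cyl_alg"
  assumes ab: "\<alpha> \<le> \<beta>" and B: "B \<in> CA \<beta>" and iso: "isomorphic \<alpha> A (neat_reduct \<alpha> \<beta> B)"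
  shows "A \<in> Nr_CA \<alpha> \<beta>"
proof -
  obtain h where h: "cyl_hom \<alpha> A (neat_reduct \<alpha> \<beta> B) h"
      and bij: "bij_betw h (carrier A) (carrier (neat_reduct \<alpha> \<beta> B))"
    using iso by (auto simp: isomorphic_def)
  have "\<forall>a\<in>carrier A. h a \<in> carrier B"
    using h by (auto simp: cyl_hom_def neat_reduct_def)
  from generated_part[OF B this] obtain G and e :: "'b \<Rightarrow> ('i, 'a) cterm"
    where G: "h ` carrier A \<subseteq> G" "G \<subseteq> carrier B" "cyl_type \<beta> (B\<lparr>carrier := G\<rparr>)" and e: "inj_on e G"
    by blast
  have "transport e G B \<in> CA \<beta>" by (rule transport_CA[OF B G(3,2) e])
  moreover have hom: "cyl_hom \<alpha> A (neat_reduct \<alpha> \<beta> (transport e G B)) (\<lambda>a. e (h a))"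
    by (rule neat_hom_transport[OF ab h G e])
  moreover have "inj_on (\<lambda>a. e (h a)) (carrier A)"
    using comp_inj_on[of h "carrier A" e] bij inj_on_subset[OF e G(1)] by (simp add: bij_betw_def comp_def)
  moreover have "x \<in> (\<lambda>a. e (h a)) ` carrier A"
    if x: "x \<in> carrier (neat_reduct \<alpha> \<beta> (transport e G B))" for x
  proof -
    obtain y where y: "y \<in> G" "x = e y" using x by (auto simp: neat_reduct_def transport_def)
    have d: "the_inv_into G e (e y) = y" using e y(1) by (rule the_inv_into_f_f)
    have "cyl B i y = y" if "\<alpha> \<le> i" "i < \<beta>" for i
    proof -
      have "e (cyl B i y) = e y" using x y d that by (simp add: neat_reduct_def transport_def)
      moreover have "cyl B i y \<in> G" using G(3) y(1) that by (simp add: cyl_type_def)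
      ultimately show ?thesis using e y(1) by (auto dest: inj_onD)
    qed
    then have "y \<in> carrier (neat_reduct \<alpha> \<beta> B)" using y(1) G(2) by (auto simp: neat_reduct_def)
    then have "y \<in> h ` carrier A" using bij by (simp add: bij_betw_def)
    then show ?thesis using y(2) by auto
  qed
  ultimately have "isomorphic \<alpha> A (neat_reduct \<alpha> \<beta> (transport e G B))"
    unfolding isomorphic_def bij_betw_def
    by (intro exI[of _ "\<lambda>a. e (h a)"]) (auto simp: cyl_hom_def)
  then show ?thesis using \<open>transport e G B \<in> CA \<beta>\<close> by (auto simp: Nr_CA_def)
qed

lemma SNr_CA_any_type:
  fixes A :: "('i::wellorder, 'a) cyl_alg" and B :: "('i, 'b) cyl_alg"
  assumes ab: "\<alpha> \<le> \<beta>" and B: "B \<in> CA \<beta>"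
    and C: "subalgebra \<alpha> C (neat_reduct \<alpha> \<beta> B)" "isomorphic \<alpha> A C"
  shows "A \<in> SNr_CA \<alpha> \<beta>"
proof -
  obtain h where h: "cyl_hom \<alpha> A (neat_reduct \<alpha> \<beta> B) h" and inj: "inj_on h (carrier A)"
    using iso_subalgebra_imp_embedding[OF C] by blast
  have "\<forall>a\<in>carrier A. h a \<in> carrier B"
    using h by (auto simp: cyl_hom_def neat_reduct_def)
  from generated_part[OF B this] obtain G and e :: "'b \<Rightarrow> ('i, 'a) cterm"
    where G: "h ` carrier A \<subseteq> G" "G \<subseteq> carrier B" "cyl_type \<beta> (B\<lparr>carrier := G\<rparr>)" and e: "inj_on e G"
    by blast
  have "transport e G B \<in> CA \<beta>" by (rule transport_CA[OF B G(3,2) e])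
  moreover have "cyl_hom \<alpha> A (neat_reduct \<alpha> \<beta> (transport e G B)) (\<lambda>a. e (h a))"
    by (rule neat_hom_transport[OF ab h G e])
  moreover have "inj_on (\<lambda>a. e (h a)) (carrier A)"
    using comp_inj_on[of h "carrier A" e] inj inj_on_subset[OF e G(1)] by (simp add: comp_def)
  ultimately show ?thesis
    using embedding_imp_iso_subalgebra unfolding SNr_CA_def by blast
qed

lemma cyl_type_full_set_alg: "cyl_type \<alpha> (full_set_alg \<alpha> U)"
  by (auto simp: cyl_type_def full_set_alg_def)

lemma shrink_base:
  fixes A :: "('i::wellorder, 'a) cyl_alg" and U :: "'u set"
  assumes h: "cyl_hom \<alpha> A (full_set_alg \<alpha> U) h" and ab: "h a \<noteq> h b"
    "a \<in> carrier A" "b \<in> carrier A"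
  shows "\<exists>(V :: ('i, 'a) wit set) g. cyl_hom \<alpha> A (full_set_alg \<alpha> V) g \<and> g a \<noteq> g b"
proof -
  let ?S = "{..<\<alpha>} \<rightarrow>\<^sub>E U"
  have hS: "h x \<subseteq> ?S" if "x \<in> carrier A" for x
    using h that by (auto simp: cyl_hom_def full_set_alg_def)
  obtain s0 where s0: "s0 \<in> ?S" "s0 \<in> h a \<longleftrightarrow> s0 \<notin> h b"
    using ab hS[of a] hS[of b] by blast
  define val :: "('i, 'a) wit \<Rightarrow> 'u" where
    "val = rec_wit s0 (\<lambda>i x v. SOME u. u \<in> U \<and> (restrict (\<lambda>j. snd (v j)) {..<\<alpha>})(i := u) \<in> h x)"
  have val_Pt: "val (Pt i) = s0 i" for i by (simp add: val_def)
  have val_Wit: "val (Wit i x s) = (SOME u. u \<in> U \<and> (restrict (\<lambda>j. val (s j)) {..<\<alpha>})(i := u) \<in> h x)" for i x s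
    by (simp add: val_def comp_def)
  define rp where "rp w = (SOME w'. val w' = val w)" for w
  have rp: "val (rp w) = val w" for w unfolding rp_def by (rule someI[of _ w]) simp
  have rp2: "rp w = rp w'" if "val w = val w'" for w w' using that by (simp add: rp_def)
  define V where "V = rp ` {w. val w \<in> U}"
  have VU: "val w \<in> U" if "w \<in> V" for w using that by (auto simp: V_def rp)
  have Vinj: "val w = val w' \<longleftrightarrow> w = w'" if "w \<in> V" "w' \<in> V" for w w'
  proof -
    obtain v v' where v: "w = rp v" "w' = rp v'" using \<open>w \<in> V\<close> \<open>w' \<in> V\<close> unfolding V_def by blast
    show ?thesis unfolding v using rp[of v] rp[of v'] rp2[of v v'] by metis
  qed
  define m where "m s = restrict (\<lambda>j. val (s j)) {..<\<alpha>}" for s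
  let ?V = "{..<\<alpha>} \<rightarrow>\<^sub>E V"
  have mS: "m s \<in> ?S" if "s \<in> ?V" for s
    using that VU by (auto simp: m_def PiE_iff)
  define g where "g x = {s \<in> ?V. m s \<in> h x}" for x
  have g_cyl: "g (cyl A i x) = {s \<in> ?V. \<exists>w\<in>V. s(i := w) \<in> g x}" if ix: "i < \<alpha>" "x \<in> carrier A" for i x
  proof -
    have hc: "h (cyl A i x) = {s \<in> ?S. \<exists>u\<in>U. s(i := u) \<in> h x}"
      using h ix by (simp add: cyl_hom_def full_set_alg_def)
    have upd: "m (s(i := w)) = (m s)(i := val w)" for s w
      using ix(1) by (auto simp: m_def fun_eq_iff)
    have updV: "s(i := w) \<in> ?V" if "s \<in> ?V" "w \<in> V" for s w
      using that ix(1) by (auto simp: PiE_iff extensional_def)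
    have "(\<exists>u\<in>U. (m s)(i := u) \<in> h x) \<longleftrightarrow> (\<exists>w\<in>V. (m s)(i := val w) \<in> h x)" for s
    proof
      assume "\<exists>u\<in>U. (m s)(i := u) \<in> h x"
      then have "\<exists>u. u \<in> U \<and> (m s)(i := u) \<in> h x" by blast
      from someI_ex[OF this] have "val (Wit i x s) \<in> U \<and> (m s)(i := val (Wit i x s)) \<in> h x"
        unfolding val_Wit m_def by simp
      then show "\<exists>w\<in>V. (m s)(i := val w) \<in> h x"
        by (intro bexI[of _ "rp (Wit i x s)"]) (auto simp: rp V_def)
    qed (use VU in blast)
    then show ?thesis
      unfolding g_def hc using mS updV by (simp add: upd cong: conj_cong)
  qed
  have "cyl_hom \<alpha> A (full_set_alg \<alpha> V) g"
  proof -
    have D: "g (diag A i j) = {s \<in> ?V. s i = s j}" if "i < \<alpha>" "j < \<alpha>" for i j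
    proof -
      have "h (diag A i j) = {s \<in> ?S. s i = s j}"
        using h that by (simp add: cyl_hom_def full_set_alg_def)
      moreover have "m s i = m s j \<longleftrightarrow> s i = s j" if "s \<in> ?V" for s
        using that \<open>i < \<alpha>\<close> \<open>j < \<alpha>\<close> Vinj[of "s i" "s j"] by (auto simp: m_def PiE_iff)
      ultimately show ?thesis using mS by (auto simp: g_def)
    qed
    have hf: "x \<in> carrier A \<Longrightarrow> y \<in> carrier A \<Longrightarrow> h (join A x y) = h x \<union> h y"
      "x \<in> carrier A \<Longrightarrow> y \<in> carrier A \<Longrightarrow> h (meet A x y) = h x \<inter> h y"
      "x \<in> carrier A \<Longrightarrow> h (compl A x) = ?S - h x"
      "h (zer A) = {}" "h (one A) = ?S" for x y
      using h by (simp_all add: cyl_hom_def full_set_alg_def)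
    have gV: "g x \<subseteq> ?V" for x by (auto simp: g_def)
    have J: "g (join A x y) = g x \<union> g y" "g (meet A x y) = g x \<inter> g y"
      if "x \<in> carrier A" "y \<in> carrier A" for x y
      using that hf(1,2)[of x y] unfolding g_def by auto
    have K: "g (compl A x) = ?V - g x" if "x \<in> carrier A" for x
      using that hf(3)[of x] mS unfolding g_def by auto
    have Z: "g (zer A) = {}" "g (one A) = ?V"
      using hf(4,5) mS unfolding g_def by auto
    have A: "cyl_type \<alpha> A" using h by (simp add: cyl_hom_def)
    have sel: "carrier (full_set_alg \<alpha> V) = Pow ?V"
      "join (full_set_alg \<alpha> V) x y = x \<union> y" "meet (full_set_alg \<alpha> V) x y = x \<inter> y"
      "compl (full_set_alg \<alpha> V) x = ?V - x" "zer (full_set_alg \<alpha> V) = {}"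
      "one (full_set_alg \<alpha> V) = ?V"
      "cyl (full_set_alg \<alpha> V) i x = {s \<in> ?V. \<exists>u\<in>V. s(i := u) \<in> x}"
      "diag (full_set_alg \<alpha> V) i j = {s \<in> ?V. s i = s j}" for x y i j
      by (simp_all add: full_set_alg_def)
    show ?thesis
      unfolding cyl_hom_def sel
      by (intro conjI ballI allI impI A cyl_type_full_set_alg PowI gV J K Z D g_cyl)
  qed
  moreover have "g a \<noteq> g b"
  proof -
    define s where "s = restrict (\<lambda>j. rp (Pt j)) {..<\<alpha>}"
    have "s \<in> ?V" using s0(1) by (auto simp: s_def V_def val_Pt PiE_iff)
    moreover have "m s = s0"
      using s0(1) by (auto simp: m_def s_def rp val_Pt fun_eq_iff PiE_iff extensional_def)
    ultimately show ?thesis using s0(2) by (auto simp: g_def)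
  qed
  ultimately show ?thesis by blast
qed

lemma cyl_type_direct_product:
  assumes "\<And>j. j \<in> J \<Longrightarrow> cyl_type \<alpha> (C j)"
  shows "cyl_type \<alpha> (direct_product J C)"
  using assms unfolding cyl_type_def direct_product_def by (auto simp: PiE_iff)

lemma RCA_any_type:
  fixes A :: "('i::wellorder, 'a) cyl_alg" and J :: "'j set"
    and C :: "'j \<Rightarrow> ('i, ('i \<Rightarrow> 'u) set) cyl_alg"
  assumes C: "\<forall>j\<in>J. C j \<in> Cs \<alpha>" and D: "subalgebra \<alpha> D (direct_product J C)" "isomorphic \<alpha> A D"
  shows "A \<in> RCA \<alpha>"
proof -
  obtain f where f: "cyl_hom \<alpha> A (direct_product J C) f" and inj: "inj_on f (carrier A)"
    using iso_subalgebra_imp_embedding[OF D] by blast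
  have A: "cyl_type \<alpha> A" using f by (simp add: cyl_hom_def)
  define K where "K = {(a, b). a \<in> carrier A \<and> b \<in> carrier A \<and> a \<noteq> b}"
  have "\<exists>(V :: ('i, 'a) wit set) g. cyl_hom \<alpha> A (full_set_alg \<alpha> V) g \<and> g (fst p) \<noteq> g (snd p)"
    if p: "p \<in> K" for p
  proof -
    obtain a b where ab: "p = (a, b)" "a \<in> carrier A" "b \<in> carrier A" "a \<noteq> b"
      using p by (auto simp: K_def)
    have "f a \<noteq> f b" using inj ab by (auto dest: inj_onD)
    moreover have "f a \<in> carrier (direct_product J C)" "f b \<in> carrier (direct_product J C)"
      using f ab by (auto simp: cyl_hom_def)
    ultimately obtain j where j: "j \<in> J" "f a j \<noteq> f b j"
      unfolding direct_product_def by simp (metis PiE_ext)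
    obtain U where U: "subalgebra \<alpha> (C j) (full_set_alg \<alpha> U)" using C j by (auto simp: Cs_def)
    have hC: "cyl_hom \<alpha> A (C j) (\<lambda>x. f x j)"
      using f U j(1) unfolding cyl_hom_def subalgebra_def direct_product_def by (auto simp: PiE_iff)
    have "cyl_hom \<alpha> A (full_set_alg \<alpha> U) (\<lambda>x. f x j)"
      using hC U by (simp add: cyl_hom_def subalgebra_def)
    from shrink_base[OF this j(2) ab(2,3)] show ?thesis by (simp add: ab(1))
  qed
  then obtain V :: "'a \<times> 'a \<Rightarrow> ('i, 'a) wit set" and g
    where g: "\<And>p. p \<in> K \<Longrightarrow> cyl_hom \<alpha> A (full_set_alg \<alpha> (V p)) (g p)"
      "\<And>p. p \<in> K \<Longrightarrow> g p (fst p) \<noteq> g p (snd p)"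
    by metis
  let ?C = "\<lambda>p. full_set_alg \<alpha> (V p)"
  have Cs: "\<forall>p\<in>K. ?C p \<in> Cs \<alpha>"
    using cyl_type_full_set_alg by (auto simp: Cs_def subalgebra_def cyl_hom_def)
  have ct: "cyl_type \<alpha> (direct_product K ?C)"
    by (rule cyl_type_direct_product) (rule cyl_type_full_set_alg)
  have hom: "cyl_hom \<alpha> A (direct_product K ?C) (\<lambda>x. \<lambda>p\<in>K. g p x)"
    using g(1) A ct unfolding cyl_hom_def
    by (auto simp: direct_product_def fun_eq_iff)
  have "inj_on (\<lambda>x. \<lambda>p\<in>K. g p x) (carrier A)"
  proof (rule inj_onI)
    fix a b assume *: "a \<in> carrier A" "b \<in> carrier A" "(\<lambda>p\<in>K. g p a) = (\<lambda>p\<in>K. g p b)"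
    show "a = b"
    proof (rule ccontr)
      assume "a \<noteq> b"
      then have "(a, b) \<in> K" using * by (auto simp: K_def)
      then show False using g(2)[of "(a, b)"] fun_cong[OF *(3), of "(a, b)"] by auto
    qed
  qed
  from embedding_imp_iso_subalgebra[OF hom this] obtain D' where
    "subalgebra \<alpha> D' (direct_product K ?C)" "isomorphic \<alpha> A D'" by blast
  then show ?thesis
    unfolding RCA_def mem_Collect_eq using Cs by (intro exI[of _ K] exI[of _ ?C] exI[of _ D'] conjI)
qed

end

theory Submission
  imports Defs
begin

text \<open>
  A network is a colouring of the pairs of coordinates by equality, black, grey and by \<open>k + 1\<close> colours
  with \<open>r + 1\<close> shades each. Two restrictions are imposed: no triangle of one colour has two sides of the
  same shade, and two points that are not equal, and together with the same \<open>\<alpha> - 2\<close> points form black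
  cliques, are joined by a colour. The algebra \<open>A r\<close> is the complex algebra of the \<open>\<alpha>\<close>-dimensional
  networks.

  In dimension \<open>\<alpha> + m\<close> with \<open>m \<le> k\<close> networks amalgamate: only one edge has to be chosen, it can be grey
  unless a black clique blocks it, and then only \<open>m\<close> coordinates remain that can exclude one of the
  \<open>k + 1\<close> colours each. So \<open>A r\<close> is the neat reduct of the algebra of \<open>\<alpha> + k\<close>-dimensional networks.
  With one more dimension, fix the \<open>\<alpha> - 2\<close> points of a black clique. There are infinitely many kinds of
  points completing it (told apart by the index of a black edge), and \<open>k + 3\<close> free coordinates. As in the proof of
  Ramsey's theorem, pin \<open>k + 1\<close> such points in turn, each joined to infinitely many of the remaining kinds
  by a fixed colour and shade; the triangle restriction makes these colours distinct, and no colour is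
  left for the edge between two further points. Finally, for any finite number of steps of a
  representation game, new points can be added by choosing fresh shades if \<open>r\<close> is large; so the
  ultraproduct is representable by compactness.

  For infinite \<open>\<alpha>\<close>, \<open>A r\<close> is invariant under finite permutations of the indices, so each scheme that fails
  in \<open>A r\<close> fails at an instance that does not depend on \<open>r\<close>, and hence fails in the ultraproduct.
\<close>

section \<open>Ordinals and finite variations\<close>

text \<open>For infinite \<alpha> the obstacle is counting. An injective self-map of \<alpha> need
  not be onto, but one that moves finitely many points is, and such an injection into \<alpha> + n
  misses exactly n points. Badness is therefore tested along finite variations of the identity only,
  and this gives a meaning to the number of remaining coordinates. The Ramsey argument uses one
  coordinate for each of the k + 1 pins and two for a last pair of points: 0, 1 and the k + 1 added
  ones are just enough. It runs on ultrafilters of the dilation instead of equations, since a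
  substitution turns an ultrafilter into another one and so moves a point to a chosen coordinate. A
  sequence of the representation may change infinitely many coordinates, while networks are
  controlled along finite variations only. Points of the representation are therefore functions of a
  finite set of coordinates, and truth is a limit along three nested ultrafilters: over coordinates,
  demands and r. The classes in the theorem live on one fixed type. An equation that fails in the
  ultraproduct is brought back to it through a countably generated subalgebra of a set
  algebra.\<close>

lemma lessThan_ord_suc: "{..<ord_suc a} = insert a {..<a :: 'i::{wellorder,no_top}}"
proof -
  have 1: "a < ord_suc a" unfolding ord_suc_def using gt_ex by (rule LeastI_ex)
  have 2: "\<not> a < x" if "x < ord_suc a" for x
    using not_less_Least that unfolding ord_suc_def by blast
  have "x < ord_suc a \<longleftrightarrow> x \<le> a" for x
    using 1 2 by (meson le_less_trans not_less)
  then show ?thesis by (intro set_eqI) (simp only: lessThan_iff insert_iff le_less disj_commute)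
qed

lemma ord_plus_0 [simp]: "ord_plus a 0 = a"
  and ord_plus_Suc: "ord_plus a (Suc n) = ord_suc (ord_plus a n)"
  by (simp_all add: ord_plus_def)

lemma lessThan_ord_plus_Suc:
  "{..<ord_plus a (Suc n)} = insert (ord_plus a n) {..<ord_plus a n :: 'i::{wellorder,no_top}}"
  by (simp add: ord_plus_Suc lessThan_ord_suc)

lemma less_ord_plus_Suc:
  "x < ord_plus a (Suc n) \<longleftrightarrow> x = ord_plus a n \<or> x < (ord_plus a n :: 'i::{wellorder,no_top})"
  using lessThan_ord_plus_Suc[of a n] by auto

lemma strict_mono_ord_plus: "strict_mono (ord_plus (a :: 'i::{wellorder,no_top}))"
  by (rule strict_mono_Suc_iff[THEN iffD2]) (simp add: less_ord_plus_Suc)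

lemma ord_plus_less_iff [simp]: "ord_plus (a :: 'i::{wellorder,no_top}) m < ord_plus a n \<longleftrightarrow> m < n"
  and ord_plus_le_iff [simp]: "ord_plus a m \<le> ord_plus a n \<longleftrightarrow> m \<le> n"
  and ord_plus_eq_iff [simp]: "ord_plus a m = ord_plus a n \<longleftrightarrow> m = n"
  using strict_mono_ord_plus[of a]
  by (auto simp: strict_mono_less strict_mono_less_eq strict_mono_eq)

lemma ord_plus_ge [simp]: "(a :: 'i::{wellorder,no_top}) \<le> ord_plus a n"
  and ord_plus_not_less [simp]: "\<not> ord_plus a n < a"
  using ord_plus_le_iff[of a 0 n] by (auto simp del: ord_plus_le_iff)

lemma less_ord_plus: "x < a \<Longrightarrow> x < ord_plus (a :: 'i::{wellorder,no_top}) n"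
  using less_le_trans ord_plus_ge by blast

lemma lessThan_ord_plus:
  "{..<ord_plus a n} = {..<a :: 'i::{wellorder,no_top}} \<union> ord_plus a ` {..<n}"
  by (induction n) (auto simp: less_ord_plus_Suc lessThan_Suc)

lemma infinite_ordinals: "infinite (UNIV :: 'i::{wellorder,no_top} set)"
  using strict_mono_imp_inj_on[OF strict_mono_ord_plus]
  by (subst infinite_iff_countable_subset) blast

lemma ord_nat_eq_iff [simp]: "(ord_nat m :: 'i::{wellorder,no_top}) = ord_nat n \<longleftrightarrow> m = n"
  and ord_nat_less_iff [simp]: "(ord_nat m :: 'i::{wellorder,no_top}) < ord_nat n \<longleftrightarrow> m < n"
  by (simp_all add: ord_nat_def)

text \<open>Maps from \<open>a\<close> to \<open>b\<close> with only finitely many values different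
  from the identity. For infinite \<open>a\<close> this is what makes the range of an injection
  countable in the sense of \<open>card_co_image_fv\<close>. Values of \<open>t\<close> outside
  \<open>a\<close> are left free.\<close>

definition fv :: "'i::{wellorder,no_top} \<Rightarrow> 'i \<Rightarrow> ('i \<Rightarrow> 'i) \<Rightarrow> bool" where
  "fv a b t \<longleftrightarrow> finite {i. i < a \<and> t i \<noteq> i} \<and> (\<forall>i<a. t i < b)"

lemma fv_comp:
  assumes "fv a b u" "fv b c t"
  shows "fv a c (t \<circ> u)"
proof -
  have "{i. i < a \<and> (t \<circ> u) i \<noteq> i} \<subseteq> {i. i < a \<and> u i \<noteq> i} \<union> {i. i < b \<and> t i \<noteq> i}"
    using assms(1) by (fastforce simp: fv_def)
  from finite_subset[OF this] assms show ?thesis by (simp add: fv_def)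
qed

lemma fv_id: "a \<le> b \<Longrightarrow> fv a b (\<lambda>i. i)"
  by (auto simp: fv_def)

lemma fv_mono: "fv a b t \<Longrightarrow> b \<le> c \<Longrightarrow> fv a c t"
  by (auto simp: fv_def dest: less_le_trans)

lemma fv_upd:
  assumes "fv a b t" "j < b"
  shows "fv a b (t(i := j))"
proof -
  have "{l. l < a \<and> (t(i := j)) l \<noteq> l} \<subseteq> insert i {l. l < a \<and> t l \<noteq> l}" by auto
  from finite_subset[OF this] assms show ?thesis by (simp add: fv_def)
qed

lemma fv_finite_change:
  assumes "fv a b t" "finite J" "\<And>i. i < a \<Longrightarrow> i \<notin> J \<Longrightarrow> u i = t i" "\<And>i. i < a \<Longrightarrow> u i < b"
  shows "fv a b u"
proof -
  have "{i. i < a \<and> u i \<noteq> i} \<subseteq> J \<union> {i. i < a \<and> t i \<noteq> i}" using assms(3) by auto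
  from finite_subset[OF this] assms(1,2,4) show ?thesis by (simp add: fv_def)
qed

lemma fv_collapse:
  assumes "i < ord_plus a n"
  shows "fv (ord_plus a (Suc n)) (ord_plus a n) (\<lambda>x. if x = ord_plus a n then i else x)"
proof -
  have "{x. x < ord_plus a (Suc n) \<and> (if x = ord_plus a n then i else x) \<noteq> x} \<subseteq> {ord_plus a n}" by auto
  from finite_subset[OF this] assms show ?thesis by (auto simp: fv_def less_ord_plus_Suc)
qed

text \<open>Off the finite set \<open>?D\<close> of moved points \<open>t\<close> is the identity,
  and by injectivity a moved point cannot land on an unmoved one. So the complement of the range is
  \<open>?D \<union> ?E\<close> minus the image of \<open>?D\<close>, which has the size of
  \<open>?D\<close>.\<close>

lemma card_co_image_fv:
  fixes a :: "'i::{wellorder,no_top}"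
  assumes t: "fv a (ord_plus a n) t" and inj: "inj_on t {..<a}"
  shows "finite ({..<ord_plus a n} - t ` {..<a})" "card ({..<ord_plus a n} - t ` {..<a}) = n"
proof -
  let ?D = "{i. i < a \<and> t i \<noteq> i}" and ?E = "ord_plus a ` {..<n}"
  have fin: "finite ?D" and lt: "\<And>i. i < a \<Longrightarrow> t i < ord_plus a n" using t by (auto simp: fv_def)
  have E: "finite ?E" "card ?E = n" "?D \<inter> ?E = {}"
    by (auto simp: card_image inj_on_def)
  have tD: "t ` ?D \<subseteq> ?D \<union> ?E"
  proof
    fix y assume "y \<in> t ` ?D"
    then obtain d where d: "d < a" "t d \<noteq> d" "y = t d" by blast
    have "y \<in> {..<a} \<union> ?E" using lt[OF d(1)] d(3) lessThan_ord_plus[of a n] by auto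
    moreover have "t y \<noteq> y" if "y < a"
      using inj_onD[OF inj, of y d] d that by auto
    ultimately show "y \<in> ?D \<union> ?E" by auto
  qed
  have "t ` {..<a} = ({..<a} - ?D) \<union> t ` ?D" by force
  then have eq: "{..<ord_plus a n} - t ` {..<a} = (?D \<union> ?E) - t ` ?D"
    unfolding lessThan_ord_plus using tD by auto
  show "finite ({..<ord_plus a n} - t ` {..<a})" unfolding eq using fin E by blast
  have "card (t ` ?D) = card ?D" by (rule card_image) (rule inj_on_subset[OF inj], auto)
  then show "card ({..<ord_plus a n} - t ` {..<a}) = n"
    unfolding eq using fin E tD by (simp add: card_Diff_subset card_Un_disjoint)
qed

text \<open>The count for n = 0; for infinite \<open>a\<close> it takes the place of the pigeonhole
  principle.\<close>

lemma surj_fv: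
  fixes a :: "'i::{wellorder,no_top}"
  assumes "fv a a t" "inj_on t {..<a}" "i < a"
  shows "i \<in> t ` {..<a}"
  using card_co_image_fv[of a 0 t] assms by auto

section \<open>Networks\<close>

datatype label = Same | Black nat | Grey | Colour nat nat

type_synonym 'i network = "'i \<Rightarrow> 'i \<Rightarrow> label"

definition agree :: "'i \<Rightarrow> 'i network \<Rightarrow> 'i network \<Rightarrow> bool" where
  "agree i N M \<longleftrightarrow> (\<forall>a b. a \<noteq> i \<longrightarrow> b \<noteq> i \<longrightarrow> N a b = M a b)"

text \<open>The default \<open>Same\<close> outside \<beta> matches the first clause of
  \<open>graph\<close>, so that networks of dimension \<beta> are equal as functions once they agree
  below \<beta>.\<close>

definition pull :: "'i::{wellorder,no_top} \<Rightarrow> ('i \<Rightarrow> 'i) \<Rightarrow> 'i network \<Rightarrow> 'i network" where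
  "pull \<beta> t N = (\<lambda>i j. if i < \<beta> \<and> j < \<beta> then N (t i) (t j) else Same)"

abbreviation (input) is_black :: "label \<Rightarrow> bool" where
  "is_black x \<equiv> \<exists>m. x = Black m"

text \<open>The forbidden pattern: coordinates 0 and 1 are two points over one black clique, formed
  by the other \<alpha> - 2 coordinates. Forbidding it leaves only \<open>Same\<close> and the
  colours for the edge between 0 and 1.\<close>

definition bad :: "'i::{wellorder,no_top} \<Rightarrow> 'i network \<Rightarrow> bool" where
  "bad \<alpha> N \<longleftrightarrow>
     (\<forall>i<\<alpha>. \<forall>j<\<alpha>. i \<noteq> j \<longrightarrow> {i, j} \<noteq> {ord_nat 0, ord_nat 1} \<longrightarrow> is_black (N i j)) \<and>
     (N (ord_nat 0) (ord_nat 1) = Grey \<or> is_black (N (ord_nat 0) (ord_nat 1)))"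

text \<open>The congruence clause, with symmetry and reflexivity, makes \<open>Same\<close> an
  equivalence; it speaks of i, j < \<beta> only, since \<open>Same\<close> is also the label
  outside. By symmetry the last clause says that a triangle in one colour has three distinct
  shades.\<close>

definition graph :: "'i::{wellorder,no_top} \<Rightarrow> nat \<Rightarrow> nat \<Rightarrow> 'i network \<Rightarrow> bool" where
  "graph \<beta> k r N \<longleftrightarrow>
     (\<forall>i j. \<not> (i < \<beta> \<and> j < \<beta>) \<longrightarrow> N i j = Same) \<and>
     (\<forall>i j. N i j = N j i) \<and> (\<forall>i. N i i = Same) \<and>
     (\<forall>i<\<beta>. \<forall>j<\<beta>. \<forall>l. N i j = Same \<longrightarrow> N i l = N j l) \<and>
     (\<forall>i j c s. N i j = Colour c s \<longrightarrow> c \<le> k \<and> s \<le> r) \<and>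
     (\<forall>i j l c s s'. N i j = Colour c s \<longrightarrow> N i l = Colour c s \<longrightarrow> N j l \<noteq> Colour c s')"

definition nets :: "'i::{wellorder,no_top} \<Rightarrow> nat \<Rightarrow> nat \<Rightarrow> nat \<Rightarrow> 'i network set" where
  "nets \<alpha> k r n = {N. graph (ord_plus \<alpha> n) k r N \<and>
     (\<forall>t. fv \<alpha> (ord_plus \<alpha> n) t \<longrightarrow> \<not> bad \<alpha> (pull \<alpha> t N))}"

lemma graphD:
  assumes "graph \<beta> k r N"
  shows "\<not> (i < \<beta> \<and> j < \<beta>) \<Longrightarrow> N i j = Same" "N i j = N j i" "N i i = Same"
    "i < \<beta> \<Longrightarrow> j < \<beta> \<Longrightarrow> N i j = Same \<Longrightarrow> N i l = N j l"
    "N i j = Colour c s \<Longrightarrow> c \<le> k" "N i j = Colour c s \<Longrightarrow> s \<le> r"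
    "N i j = Colour c s \<Longrightarrow> N i l = Colour c s \<Longrightarrow> N j l \<noteq> Colour c s'"
  using assms unfolding graph_def by blast+

lemma netsD:
  assumes "N \<in> nets \<alpha> k r n"
  shows "graph (ord_plus \<alpha> n) k r N" "fv \<alpha> (ord_plus \<alpha> n) t \<Longrightarrow> \<not> bad \<alpha> (pull \<alpha> t N)"
  using assms by (auto simp: nets_def)

lemma same_cong:
  assumes "graph \<beta> k r N" "N a a' = Same" "N b b' = Same" "a < \<beta>" "a' < \<beta>" "b < \<beta>" "b' < \<beta>"
  shows "N a b = N a' b'"
  using assms graphD(2,4)[OF assms(1)] by metis

lemma pull_pull: "(\<And>i. i < \<alpha> \<Longrightarrow> u i < \<beta>) \<Longrightarrow> pull \<alpha> u (pull \<beta> t N) = pull \<alpha> (t \<circ> u) N"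
  by (auto simp: pull_def fun_eq_iff)

lemma pull_id: "graph \<beta> k r N \<Longrightarrow> pull \<beta> (\<lambda>i. i) N = N"
  using graphD(1) by (fastforce simp: pull_def fun_eq_iff)

lemma graph_pull:
  assumes N: "graph \<beta> k r N" and t: "\<And>i. i < \<gamma> \<Longrightarrow> t i < \<beta>"
  shows "graph \<gamma> k r (pull \<gamma> t N)"
proof -
  note D = graphD[OF N]
  have sym: "pull \<gamma> t N i j = pull \<gamma> t N j i" for i j using D(2) by (simp add: pull_def)
  moreover have "pull \<gamma> t N i l = pull \<gamma> t N j l"
    if "i < \<gamma>" "j < \<gamma>" "pull \<gamma> t N i j = Same" for i j l
    using that D(4)[OF t[OF that(1)] t[OF that(2)], of "t l"] unfolding pull_def by simp
  moreover have "c \<le> k \<and> s \<le> r" if "pull \<gamma> t N i j = Colour c s" for i j c s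
    using that D(5,6)[of "t i" "t j" c s] unfolding pull_def by (simp split: if_splits)
  moreover have "pull \<gamma> t N j l \<noteq> Colour c s'"
    if "pull \<gamma> t N i j = Colour c s" "pull \<gamma> t N i l = Colour c s" for i j l c s s'
    using that D(7)[of "t i" "t j" c s "t l" s'] unfolding pull_def by (simp split: if_splits)
  moreover have "pull \<gamma> t N i i = Same" "\<not> (i < \<gamma> \<and> j < \<gamma>) \<Longrightarrow> pull \<gamma> t N i j = Same" for i j
    using D(3) by (auto simp: pull_def)
  ultimately show ?thesis unfolding graph_def by blast
qed

text \<open>A bad sequence of the pulled network, composed with \<open>t\<close>, is a bad sequence
  of \<open>N\<close>, and finite variations are closed under composition. All substitution
  instances of networks are obtained in this way.\<close>

lemma nets_pull:
  assumes N: "N \<in> nets \<alpha> k r n" and t: "fv (ord_plus \<alpha> m) (ord_plus \<alpha> n) t"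
  shows "pull (ord_plus \<alpha> m) t N \<in> nets \<alpha> k r m"
proof -
  have "\<not> bad \<alpha> (pull \<alpha> u (pull (ord_plus \<alpha> m) t N))" if u: "fv \<alpha> (ord_plus \<alpha> m) u" for u
  proof -
    have "pull \<alpha> u (pull (ord_plus \<alpha> m) t N) = pull \<alpha> (t \<circ> u) N"
      by (rule pull_pull) (use u in \<open>auto simp: fv_def\<close>)
    then show ?thesis using netsD(2)[OF N fv_comp[OF u t]] by simp
  qed
  moreover have "graph (ord_plus \<alpha> m) k r (pull (ord_plus \<alpha> m) t N)"
    by (rule graph_pull[OF netsD(1)[OF N]]) (use t in \<open>auto simp: fv_def\<close>)
  ultimately show ?thesis by (simp add: nets_def)
qed

lemma agree_refl: "agree i N N"
  and agree_sym: "agree i N M \<Longrightarrow> agree i M N"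
  and agree_trans: "agree i N M \<Longrightarrow> agree i M L \<Longrightarrow> agree i N L"
  by (simp_all add: agree_def)

text \<open>No edge of a bad pattern is \<open>Same\<close>, so a bad sequence repeats no point.
  This puts bad sequences within reach of \<open>card_co_image_fv\<close> and
  \<open>surj_fv\<close>.\<close>

lemma bad_distinct:
  assumes "ord_nat 2 < \<alpha>" "graph \<beta> k r N" "bad \<alpha> (pull \<alpha> t N)"
  shows "inj_on t {..<\<alpha>}" "i < \<alpha> \<Longrightarrow> j < \<alpha> \<Longrightarrow> i \<noteq> j \<Longrightarrow> N (t i) (t j) = Grey \<or> is_black (N (t i) (t j))"
proof -
  have 01: "ord_nat 0 < \<alpha>" "ord_nat 1 < \<alpha>" using assms(1) by (auto intro: less_trans[of _ "ord_nat 2"])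
  show *: "N (t i) (t j) = Grey \<or> is_black (N (t i) (t j))" if "i < \<alpha>" "j < \<alpha>" "i \<noteq> j" for i j
  proof (cases "{i, j} = {ord_nat 0, ord_nat 1}")
    case True
    then have "(i = ord_nat 0 \<and> j = ord_nat 1) \<or> (i = ord_nat 1 \<and> j = ord_nat 0)"
      by (auto simp: doubleton_eq_iff)
    with 01 assms(3) show ?thesis
      using graphD(2)[OF assms(2), of "t (ord_nat 0)" "t (ord_nat 1)"] by (auto simp: bad_def pull_def)
  qed (use assms(3) that in \<open>auto simp: bad_def pull_def\<close>)
  show "inj_on t {..<\<alpha>}"
  proof (rule inj_onI, rule ccontr)
    fix i j assume "i \<in> {..<\<alpha>}" "j \<in> {..<\<alpha>}" "t i = t j" "i \<noteq> j"
    then show False using *[of i j] graphD(3)[OF assms(2)] by simp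
  qed
qed

subsection \<open>Amalgamation\<close>

lemma badD:
  assumes "bad \<alpha> N"
  shows "i < \<alpha> \<Longrightarrow> j < \<alpha> \<Longrightarrow> i \<noteq> j \<Longrightarrow> {i, j} \<noteq> {ord_nat 0, ord_nat 1} \<Longrightarrow> is_black (N i j)"
    "N (ord_nat 0) (ord_nat 1) = Grey \<or> is_black (N (ord_nat 0) (ord_nat 1))"
  using assms unfolding bad_def by blast+

text \<open>\<open>N\<close> is to be kept off \<open>j\<close> and \<open>M\<close> off
  \<open>i\<close>, which leaves just the edge between \<open>i\<close> and \<open>j\<close> open;
  \<open>x\<close> fills it.\<close>

definition glue :: "'i \<Rightarrow> 'i \<Rightarrow> label \<Rightarrow> 'i network \<Rightarrow> 'i network \<Rightarrow> 'i network" where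
  "glue i j x N M = (\<lambda>a b. if {a, b} = {i, j} then x else if a = j \<or> b = j then M a b else N a b)"

context
  fixes \<beta> :: "'i::{wellorder,no_top}" and k r :: nat and N M :: "'i network" and i j :: 'i and x :: label
  assumes N: "graph \<beta> k r N" and M: "graph \<beta> k r M"
    and ij: "i < \<beta>" "j < \<beta>" "i \<noteq> j"
    and NM: "\<And>a b. a \<noteq> i \<Longrightarrow> a \<noteq> j \<Longrightarrow> b \<noteq> i \<Longrightarrow> b \<noteq> j \<Longrightarrow> N a b = M a b"
begin

lemma glue_sym: "glue i j x N M a b = glue i j x N M b a"
  unfolding glue_def using graphD(2)[OF N, of a b] graphD(2)[OF M, of a b] by (simp add: insert_commute disj_commute)

lemma glue_left: "a \<noteq> j \<Longrightarrow> b \<noteq> j \<Longrightarrow> glue i j x N M a b = N a b"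
  and glue_right: "a \<noteq> i \<Longrightarrow> b \<noteq> i \<Longrightarrow> glue i j x N M a b = M a b"
  and glue_edge: "glue i j x N M i j = x" "glue i j x N M j i = x"
  using NM by (auto simp: glue_def doubleton_eq_iff)

lemma glue_not_same:
  assumes x: "x \<noteq> Same"
    and sep: "\<And>l. l < \<beta> \<Longrightarrow> l \<noteq> i \<Longrightarrow> l \<noteq> j \<Longrightarrow> N i l \<noteq> Same" "\<And>l. l < \<beta> \<Longrightarrow> l \<noteq> i \<Longrightarrow> l \<noteq> j \<Longrightarrow> M j l \<noteq> Same"
    and ab: "a < \<beta>" "b < \<beta>" "a \<noteq> b" "glue i j x N M a b = Same"
  shows "a \<noteq> i \<and> a \<noteq> j \<and> b \<noteq> i \<and> b \<noteq> j"
proof -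
  have *: "glue i j x N M i l \<noteq> Same" if "l < \<beta>" "l \<noteq> i" for l
    using that sep(1)[of l] x ij by (cases "l = j") (simp_all add: glue_left glue_edge)
  have **: "glue i j x N M j l \<noteq> Same" if "l < \<beta>" "l \<noteq> j" for l
    using that sep(2)[of l] x ij by (cases "l = i") (simp_all add: glue_right glue_edge)
  show ?thesis
    using *[of a] *[of b] **[of a] **[of b] ab glue_sym by metis
qed

text \<open>A triangle that misses \<open>i\<close> or \<open>j\<close> lies in \<open>M\<close> or
  in \<open>N\<close>. The new triangles have corners \<open>i\<close>, \<open>j\<close>,
  \<open>y\<close>, and the condition on \<open>x\<close> keeps them from being monochromatic. Since
  neither \<open>i\<close> nor \<open>j\<close> is equal to another point, \<open>Same\<close>
  remains a congruence.\<close>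

lemma graph_glue:
  assumes x: "x = Grey \<or> (\<exists>c s. x = Colour c s \<and> c \<le> k \<and> s \<le> r \<and>
      (\<forall>y s1 s2. y \<noteq> i \<longrightarrow> y \<noteq> j \<longrightarrow> N i y = Colour c s1 \<longrightarrow> M j y \<noteq> Colour c s2))"
    and sep: "\<And>l. l < \<beta> \<Longrightarrow> l \<noteq> i \<Longrightarrow> l \<noteq> j \<Longrightarrow> N i l \<noteq> Same" "\<And>l. l < \<beta> \<Longrightarrow> l \<noteq> i \<Longrightarrow> l \<noteq> j \<Longrightarrow> M j l \<noteq> Same"
  shows "graph \<beta> k r (glue i j x N M)"
proof -
  let ?L = "glue i j x N M"
  have xS: "x \<noteq> Same" using x by auto
  have diag: "?L a a = Same" for a
    using graphD(3)[OF N] graphD(3)[OF M] ij(3) by (auto simp: glue_def)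
  have out: "?L a b = Same" if "\<not> (a < \<beta> \<and> b < \<beta>)" for a b
    using that graphD(1)[OF N, of a b] graphD(1)[OF M, of a b] ij by (auto simp: glue_def doubleton_eq_iff)
  have cong: "?L a l = ?L b l" if ab: "a < \<beta>" "b < \<beta>" "?L a b = Same" for a b l
  proof (cases "a = b")
    case False
    have n: "a \<noteq> i \<and> a \<noteq> j \<and> b \<noteq> i \<and> b \<noteq> j" by (rule glue_not_same[OF xS sep ab(1,2) False ab(3)])
    then have "N a b = Same" "M a b = Same" using ab(3) glue_left[of a b] glue_right[of a b] by auto
    then have "N a l = N b l" "M a l = M b l" using graphD(4)[OF N ab(1,2)] graphD(4)[OF M ab(1,2)] by auto
    then show ?thesis using n by (cases "l = j") (simp_all add: glue_left glue_right ij(3)[symmetric])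
  qed simp
  have valid: "c \<le> k \<and> s \<le> r" if "?L a b = Colour c s" for a b c s
    using that x graphD(5,6)[OF N, of a b c s] graphD(5,6)[OF M, of a b c s]
    by (auto simp: glue_def split: if_splits)
  have tri: False if t: "?L a b = Colour c s" "?L a d = Colour c s" "?L b d = Colour c s'" for a b d c s s'
  proof (cases "i \<in> {a, b, d} \<and> j \<in> {a, b, d}")
    case False
    then consider "a \<noteq> i" "b \<noteq> i" "d \<noteq> i" | "a \<noteq> j" "b \<noteq> j" "d \<noteq> j" by auto
    then show ?thesis
    proof cases
      case 1 then show ?thesis using t graphD(7)[OF M, of a b c s d s'] by (simp add: glue_right)
    next
      case 2 then show ?thesis using t graphD(7)[OF N, of a b c s d s'] by (simp add: glue_left)
    qed
  next
    case True
    have ne: "a \<noteq> b" "a \<noteq> d" "b \<noteq> d" using t diag by auto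
    obtain y where y: "{a, b, d} = {i, j, y}" "y \<noteq> i" "y \<noteq> j"
      using True ne ij(3) by blast
    have all: "\<exists>s. ?L p q = Colour c s" if "p \<in> {a, b, d}" "q \<in> {a, b, d}" "p \<noteq> q" for p q
      using that t glue_sym[of a b] glue_sym[of a d] glue_sym[of b d] by auto
    have mem: "i \<in> {a, b, d}" "j \<in> {a, b, d}" "y \<in> {a, b, d}" unfolding y(1) by simp_all
    obtain s0 s1 s2 where "?L i j = Colour c s0" "?L i y = Colour c s1" "?L j y = Colour c s2"
      using all[OF mem(1,2) ij(3)] all[OF mem(1,3) y(2)[symmetric]] all[OF mem(2,3) y(3)[symmetric]] by auto
    then have "x = Colour c s0" "N i y = Colour c s1" "M j y = Colour c s2"
      using y(2,3) ij(3) glue_edge(1) glue_left[of i y] glue_right[of j y] by metis+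
    then show ?thesis using x y(2,3) by auto
  qed
  show ?thesis unfolding graph_def using diag out cong valid tri glue_sym by blast
qed

text \<open>A bad sequence that avoids \<open>i\<close> or \<open>j\<close> would already be bad in
  \<open>M\<close> or \<open>N\<close>. One that passes through both meets the edge
  \<open>x\<close>, which is not black; so this edge sits at the exceptional pair 0, 1 and is
  grey.\<close>

lemma bad_glue:
  assumes \<alpha>: "ord_nat 2 < \<alpha>" and x: "x = Grey \<or> (\<exists>c s. x = Colour c s)"
    and bad: "bad \<alpha> (pull \<alpha> t (glue i j x N M))"
    and nb: "\<not> bad \<alpha> (pull \<alpha> t N)" "\<not> bad \<alpha> (pull \<alpha> t M)"
  shows "x = Grey \<and> {t (ord_nat 0), t (ord_nat 1)} = {i, j}"
proof -
  let ?L = "glue i j x N M"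
  have "i \<in> t ` {..<\<alpha>}"
  proof (rule ccontr)
    assume "i \<notin> t ` {..<\<alpha>}"
    then have "t a \<noteq> i" if "a < \<alpha>" for a using that by auto
    then have "pull \<alpha> t ?L = pull \<alpha> t M" by (simp add: pull_def fun_eq_iff glue_right)
    with bad nb show False by simp
  qed
  moreover have "j \<in> t ` {..<\<alpha>}"
  proof (rule ccontr)
    assume "j \<notin> t ` {..<\<alpha>}"
    then have "t a \<noteq> j" if "a < \<alpha>" for a using that by auto
    then have "pull \<alpha> t ?L = pull \<alpha> t N" by (simp add: pull_def fun_eq_iff glue_left)
    with bad nb show False by simp
  qed
  ultimately obtain a b where ab: "a < \<alpha>" "b < \<alpha>" "t a = i" "t b = j" by auto
  have L: "pull \<alpha> t ?L a b = x" using ab by (simp add: pull_def glue_edge)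
  have L': "pull \<alpha> t ?L b a = x" using ab by (simp add: pull_def glue_edge)
  have "{a, b} = {ord_nat 0, ord_nat 1}"
    using badD(1)[OF bad ab(1,2)] ab(3,4) x L ij(3) by fastforce
  then have "(a = ord_nat 0 \<and> b = ord_nat 1) \<or> (a = ord_nat 1 \<and> b = ord_nat 0)"
    by (auto simp: doubleton_eq_iff)
  then show ?thesis using badD(2)[OF bad] x ab(3,4) L L' by auto
qed

end

text \<open>In terms of networks this is the commutation of two cylindrifications. \<open>Q\<close>
  may be any labelling, so an intermediate stage can also be assembled by hand.\<close>

lemma nets_amalgam:
  assumes \<alpha>: "ord_nat 2 < \<alpha>" and mk: "m \<le> k" and NM: "N \<in> nets \<alpha> k r m" "M \<in> nets \<alpha> k r m"
    and ij: "i < ord_plus \<alpha> m" "j < ord_plus \<alpha> m"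
    and K: "agree i N Q" "agree j Q M"
  shows "\<exists>L\<in>nets \<alpha> k r m. agree j N L \<and> agree i L M"
proof -
  let ?\<beta> = "ord_plus \<alpha> m"
  have ag: "N a b = M a b" if "a \<noteq> i" "a \<noteq> j" "b \<noteq> i" "b \<noteq> j" for a b
    using K that by (simp add: agree_def)
  note gN = netsD(1)[OF NM(1)] and gM = netsD(1)[OF NM(2)]
  consider (eq) "i = j" | (left) l where "i \<noteq> j" "l < ?\<beta>" "l \<noteq> i" "l \<noteq> j" "N i l = Same"
    | (right) l where "i \<noteq> j" "l < ?\<beta>" "l \<noteq> i" "l \<noteq> j" "M j l = Same"
    | (sep) "i \<noteq> j" "\<And>l. l < ?\<beta> \<Longrightarrow> l \<noteq> i \<Longrightarrow> l \<noteq> j \<Longrightarrow> N i l \<noteq> Same"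
       "\<And>l. l < ?\<beta> \<Longrightarrow> l \<noteq> i \<Longrightarrow> l \<noteq> j \<Longrightarrow> M j l \<noteq> Same" by blast
  then show ?thesis
  proof cases
    case eq
    then show ?thesis using K NM agree_refl agree_trans by metis
  next
    \<comment> \<open>In \<open>N\<close> the point \<open>i\<close> is a copy of \<open>l\<close>,
      so in the amalgam it is made a copy of \<open>l\<close> in \<open>M\<close>.\<close>
    case left
    let ?L = "pull ?\<beta> ((\<lambda>a. a)(i := l)) M"
    have "?L \<in> nets \<alpha> k r m" by (rule nets_pull[OF NM(2)]) (intro fv_upd fv_id order_refl left)
    moreover have "agree i ?L M" using graphD(1)[OF gM] by (auto simp: agree_def pull_def)
    moreover have "agree j N ?L"
      unfolding agree_def
    proof (intro allI impI)
      fix a b assume ab: "a \<noteq> j" "b \<noteq> j"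
      have Ni: "N i b = N l b" for b using graphD(4)[OF gN ij(1) left(2,5)] .
      show "N a b = ?L a b"
        using ab ag[of a b] ag[of l b] ag[of a l] Ni graphD(2)[OF gN, of a b] graphD(2)[OF gN, of a l]
          graphD(1)[OF gN, of a b] graphD(3)[OF gN] graphD(3)[OF gM] left(3,4)
        by (auto simp: pull_def)
    qed
    ultimately show ?thesis by blast
  next
    case right
    let ?L = "pull ?\<beta> ((\<lambda>a. a)(j := l)) N"
    have "?L \<in> nets \<alpha> k r m" by (rule nets_pull[OF NM(1)]) (intro fv_upd fv_id order_refl right)
    moreover have "agree j N ?L" using graphD(1)[OF gN] by (auto simp: agree_def pull_def)
    moreover have "agree i ?L M"
      unfolding agree_def
    proof (intro allI impI)
      fix a b assume ab: "a \<noteq> i" "b \<noteq> i"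
      have Mj: "M j b = M l b" for b using graphD(4)[OF gM ij(2) right(2,5)] .
      show "?L a b = M a b"
        using ab ag[of a b] ag[of l b] ag[of a l] Mj graphD(2)[OF gM, of a b] graphD(2)[OF gM, of a l]
          graphD(1)[OF gM, of a b] graphD(3)[OF gN] graphD(3)[OF gM] right(3,4)
        by (auto simp: pull_def)
    qed
    ultimately show ?thesis by blast
  next
    case sep
    have agr: "agree j N (glue i j x N M)" "agree i (glue i j x N M) M" for x
      using ag by (auto simp: glue_def agree_def doubleton_eq_iff)
    show ?thesis
    proof (cases "\<exists>t. fv \<alpha> ?\<beta> t \<and> bad \<alpha> (pull \<alpha> t (glue i j Grey N M))")
      case False
      then have "glue i j Grey N M \<in> nets \<alpha> k r m"
        unfolding nets_def using graph_glue[OF gN gM ij sep(1) ag _ sep(2,3), of Grey] by simp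
      with agr show ?thesis by blast
    next
      case True
      then obtain t where t: "fv \<alpha> ?\<beta> t" "bad \<alpha> (pull \<alpha> t (glue i j Grey N M))" by blast
      have t01: "{t (ord_nat 0), t (ord_nat 1)} = {i, j}"
        using bad_glue[OF gN gM ij sep(1) ag \<alpha> _ t(2)] netsD(2)[OF NM(1) t(1)] netsD(2)[OF NM(2) t(1)] by simp
      have gG: "graph ?\<beta> k r (glue i j Grey N M)"
        by (rule graph_glue[OF gN gM ij sep(1) ag _ sep(2,3)]) auto
      let ?Y = "{..<?\<beta>} - t ` {..<\<alpha>}"
      have Y: "finite ?Y" "card ?Y = m"
        using card_co_image_fv[OF t(1) bad_distinct(1)[OF \<alpha> gG t(2)]] by auto
      \<comment> \<open>The points of the clique witnessing badness see \<open>i\<close> through black edges, so only the \<open>m\<close>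
        remaining coordinates can exclude a colour, and each of them excludes at most one.\<close>
      have black: "is_black (N i y)" if y: "y \<in> t ` {..<\<alpha>}" "y \<noteq> i" "y \<noteq> j" for y
      proof -
        have 01: "ord_nat 0 < \<alpha>" "ord_nat 1 < \<alpha>" using \<alpha> by (auto intro: less_trans[of _ "ord_nat 2"])
        obtain a where a: "a < \<alpha>" "y = t a" using y by auto
        obtain b where b: "b \<in> {ord_nat 0, ord_nat 1}" "t b = i" using t01 by (auto simp: doubleton_eq_iff)
        have "a \<notin> {ord_nat 0, ord_nat 1}" using t01 y a by auto
        then have "{b, a} \<noteq> {ord_nat 0, ord_nat 1}" "b \<noteq> a" "b < \<alpha>" using b(1) 01 by auto
        then have "is_black (pull \<alpha> t (glue i j Grey N M) b a)" using t(2) a(1) unfolding bad_def by blast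
        then show ?thesis using a b y sep(1) \<open>b < \<alpha>\<close> by (simp add: pull_def glue_def doubleton_eq_iff split: if_splits)
      qed
      \<comment> \<open>The description is meaningful only for a coloured edge; any other
        \<open>y\<close> contributes a junk value, which at worst wastes a colour.\<close>
      define col where "col y = (THE c. \<exists>s. N i y = Colour c s)" for y
      have "card (col ` ?Y) < card {..k}"
        using card_image_le[OF Y(1), of col] Y(2) mk by simp
      then obtain c where c: "c \<le> k" "c \<notin> col ` ?Y"
        using card_mono[of "col ` ?Y" "{..k}"] Y(1) by (metis atMost_iff finite_imageI leD subsetI)
      have free: "M j y \<noteq> Colour c s2" if y: "y \<noteq> i" "y \<noteq> j" "N i y = Colour c s1" for y s1 s2
      proof -
        have "y < ?\<beta>" using graphD(1)[OF gN, of i y] y(3) by auto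
        moreover have "y \<notin> t ` {..<\<alpha>}" using black[OF _ y(1,2)] y(3) by auto
        moreover have "col y = c" unfolding col_def using y(3) by auto
        ultimately show ?thesis using c(2) by blast
      qed
      \<comment> \<open>Shade 0 is as good as any, since in \<open>N\<close> the colour
        \<open>c\<close> does not occur between \<open>i\<close> and a third point.\<close>
      have "graph ?\<beta> k r (glue i j (Colour c 0) N M)"
        by (rule graph_glue[OF gN gM ij sep(1) ag _ sep(2,3)]) (use c(1) free in auto)
      moreover have "\<not> bad \<alpha> (pull \<alpha> u (glue i j (Colour c 0) N M))" if "fv \<alpha> ?\<beta> u" for u
        using bad_glue[OF gN gM ij sep(1) ag \<alpha>, of "Colour c 0" u] netsD(2)[OF NM(1) that] netsD(2)[OF NM(2) that]
        by auto
      ultimately have "glue i j (Colour c 0) N M \<in> nets \<alpha> k r m" by (simp add: nets_def)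
      with agr show ?thesis by blast
    qed
  qed
qed

section \<open>Algebras of networks and their neat reducts\<close>

lemma ord_nats_less:
  assumes "ord_nat 2 < \<alpha>"
  shows "ord_nat 0 < \<alpha>" "ord_nat 1 < \<alpha>" "ord_nat (Suc 0) < \<alpha>"
  using assms by (auto intro: less_trans[of _ "ord_nat 2"])

text \<open>The complex algebra of \<open>W\<close>, with its atoms renamed by \<open>e\<close>. The
  algebras of the theorem must live on a prescribed type, whereas for the dilations \<open>e\<close>
  is the identity.\<close>

definition net_alg :: "('i network \<Rightarrow> 'w) \<Rightarrow> 'i network set \<Rightarrow> ('i, 'w set) cyl_alg" where
  "net_alg e W = \<lparr>
     carrier = Pow (e ` W),
     join = (\<union>),
     meet = (\<inter>),
     compl = (\<lambda>X. e ` W - X),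
     zer = {},
     one = e ` W,
     cyl = (\<lambda>i X. {e N | N. N \<in> W \<and> (\<exists>M\<in>W. e M \<in> X \<and> agree i N M)}),
     diag = (\<lambda>i j. {e N | N. N \<in> W \<and> N i j = Same})\<rparr>"

lemma net_alg_sel [simp]:
  "carrier (net_alg e W) = Pow (e ` W)" "join (net_alg e W) = (\<union>)" "meet (net_alg e W) = (\<inter>)"
  "compl (net_alg e W) X = e ` W - X" "zer (net_alg e W) = {}" "one (net_alg e W) = e ` W"
  by (simp_all add: net_alg_def)

lemma in_cyl_net_alg:
  assumes "inj_on e W" "N \<in> W"
  shows "e N \<in> cyl (net_alg e W) i X \<longleftrightarrow> (\<exists>M\<in>W. e M \<in> X \<and> agree i N M)"
  using assms by (auto simp: net_alg_def dest: inj_onD)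

lemma in_diag_net_alg:
  assumes "inj_on e W" "N \<in> W"
  shows "e N \<in> diag (net_alg e W) i j \<longleftrightarrow> N i j = Same"
  using assms by (auto simp: net_alg_def dest: inj_onD)

lemma cyl_net_alg_subset: "cyl (net_alg e W) i X \<subseteq> e ` W" "diag (net_alg e W) i j \<subseteq> e ` W"
  by (auto simp: net_alg_def)

lemma net_alg_eqI:
  assumes "X \<subseteq> e ` W" "Y \<subseteq> e ` W" "\<And>N. N \<in> W \<Longrightarrow> e N \<in> X \<longleftrightarrow> e N \<in> Y"
  shows "X = Y"
  using assms by blast

lemma cyl_type_net_alg: "cyl_type \<beta> (net_alg e W)"
  using cyl_net_alg_subset[of e W] by (simp add: cyl_type_def Un_least inf.coboundedI1)

text \<open>The bound m \<le> k enters only through the commutation of cylindrifications, which is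
  amalgamation. The diagonal axioms rest on pulling: identifying \<open>i\<close> with
  \<open>j\<close> in this way gives the one and only i-variant with that equality.\<close>

lemma net_alg_nets_CA:
  assumes \<alpha>: "ord_nat 2 < \<alpha>" and mk: "m \<le> k"
  shows "net_alg (\<lambda>N. N) (nets \<alpha> k r m) \<in> CA (ord_plus \<alpha> m)"
proof -
  let ?W = "nets \<alpha> k r m" and ?\<beta> = "ord_plus \<alpha> m"
  let ?B = "net_alg (\<lambda>N. N) ?W"
  note eqI = net_alg_eqI[of _ "\<lambda>N. N" ?W]
  have cyl: "N \<in> cyl ?B i X \<longleftrightarrow> (\<exists>M\<in>?W. M \<in> X \<and> agree i N M)" if "N \<in> ?W" for N i X
    using in_cyl_net_alg[of "\<lambda>N. N" ?W N i X] that by simp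
  have dg: "N \<in> diag ?B i j \<longleftrightarrow> N i j = Same" if "N \<in> ?W" for N i j
    using in_diag_net_alg[of "\<lambda>N. N" ?W N i j] that by simp
  note sub = cyl_net_alg_subset[of "\<lambda>N. N" ?W, simplified]
  have subst: "pull ?\<beta> ((\<lambda>a. a)(i := j)) N \<in> ?W \<and> agree i N (pull ?\<beta> ((\<lambda>a. a)(i := j)) N)"
    if "N \<in> ?W" "j < ?\<beta>" for N i j
    using nets_pull[OF that(1) fv_upd[OF fv_id[OF order_refl] that(2)]] graphD(1)[OF netsD(1)[OF that(1)]]
    by (auto simp: agree_def pull_def)
  have comm: "cyl ?B i (cyl ?B j X) \<subseteq> cyl ?B j (cyl ?B i X)" if ij: "i < ?\<beta>" "j < ?\<beta>" and X: "X \<subseteq> ?W" for i j X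
  proof
    fix N assume N: "N \<in> cyl ?B i (cyl ?B j X)"
    then have NW: "N \<in> ?W" using sub by blast
    obtain Q where Q: "Q \<in> ?W" "Q \<in> cyl ?B j X" "agree i N Q" using N cyl[OF NW] by blast
    obtain M where M: "M \<in> ?W" "M \<in> X" "agree j Q M" using Q(2) cyl[OF Q(1)] by blast
    obtain L where L: "L \<in> ?W" "agree j N L" "agree i L M"
      using nets_amalgam[OF \<alpha> mk NW M(1) ij Q(3) M(3)] by blast
    then show "N \<in> cyl ?B j (cyl ?B i X)" using cyl[OF NW] cyl[OF L(1)] M by blast
  qed
  have "boolean_axioms ?B" by (auto simp: boolean_axioms_def)
  moreover have "cyl ?B i {} = {}" for i by (auto simp: net_alg_def)
  moreover have "X \<union> cyl ?B i X = cyl ?B i X" if "X \<subseteq> ?W" for i X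
  proof -
    have "N \<in> cyl ?B i X" if "N \<in> X" for N
    proof -
      have "N \<in> ?W" using that \<open>X \<subseteq> ?W\<close> by blast
      then show ?thesis using cyl[of N i X] agree_refl[of i N] that by blast
    qed
    then show ?thesis by blast
  qed
  moreover have "cyl ?B i (X \<inter> cyl ?B i Y) = cyl ?B i X \<inter> cyl ?B i Y" if "X \<subseteq> ?W" "Y \<subseteq> ?W" for i X Y
  proof (rule eqI)
    fix N assume N: "N \<in> ?W"
    have "(\<exists>M\<in>?W. M \<in> X \<inter> cyl ?B i Y \<and> agree i N M) \<longleftrightarrow>
        (\<exists>M\<in>?W. M \<in> X \<and> agree i N M) \<and> (\<exists>M\<in>?W. M \<in> Y \<and> agree i N M)"
      using cyl agree_sym agree_trans by (smt (verit) IntE IntI)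
    then show "N \<in> cyl ?B i (X \<inter> cyl ?B i Y) \<longleftrightarrow> N \<in> cyl ?B i X \<inter> cyl ?B i Y"
      using cyl[OF N] by simp
  qed (use sub in auto)
  moreover have "cyl ?B i (cyl ?B j X) = cyl ?B j (cyl ?B i X)" if "i < ?\<beta>" "j < ?\<beta>" "X \<subseteq> ?W" for i j X
    using comm that by blast
  moreover have "diag ?B i i = ?W" for i
    using dg graphD(3)[OF netsD(1)] sub by blast
  moreover have "diag ?B i j = cyl ?B l (diag ?B i l \<inter> diag ?B l j)"
    if l: "l < ?\<beta>" "i < ?\<beta>" "j < ?\<beta>" "l \<noteq> i" "l \<noteq> j" for i j l
  proof (rule eqI)
    fix N assume N: "N \<in> ?W"
    have "N i j = Same" if "M \<in> ?W" "M i l = Same" "M l j = Same" "agree l N M" for M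
      using that graphD(4)[OF netsD(1)[OF that(1)] l(2,1), of j] l by (simp add: agree_def)
    moreover have "\<exists>M\<in>?W. M \<in> diag ?B i l \<inter> diag ?B l j \<and> agree l N M" if ij: "N i j = Same"
    proof (rule bexI)
      let ?M = "pull ?\<beta> ((\<lambda>a. a)(l := i)) N"
      show M: "?M \<in> ?W" using subst[OF N l(2)] by blast
      show "?M \<in> diag ?B i l \<inter> diag ?B l j \<and> agree l N ?M"
        using subst[OF N l(2)] dg[OF M] ij l graphD(3)[OF netsD(1)[OF N]] by (simp add: pull_def)
    qed
    moreover have "M \<in> diag ?B i l \<inter> diag ?B l j \<longleftrightarrow> M i l = Same \<and> M l j = Same" if "M \<in> ?W" for M
      using dg[OF that] by simp
    ultimately show "N \<in> diag ?B i j \<longleftrightarrow> N \<in> cyl ?B l (diag ?B i l \<inter> diag ?B l j)"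
      unfolding cyl[OF N] dg[OF N] by blast
  qed (use sub in auto)
  moreover have "cyl ?B i (diag ?B i j \<inter> X) \<inter> cyl ?B i (diag ?B i j \<inter> (?W - X)) = {}"
    if ij: "i < ?\<beta>" "j < ?\<beta>" "i \<noteq> j" for i j X
  proof -
    have eq: "M = pull ?\<beta> ((\<lambda>a. a)(i := j)) N" if "N \<in> ?W" "M \<in> ?W" "agree i N M" "M i j = Same" for N M
    proof (intro ext)
      fix a b
      note g = netsD(1)[OF that(2)] and gN = netsD(1)[OF that(1)]
      have "M i b = M j b" for b using graphD(4)[OF g ij(1,2) that(4)] .
      then show "M a b = pull ?\<beta> ((\<lambda>a. a)(i := j)) N a b"
        using that(3) ij graphD(1)[OF g, of a b] graphD(2)[OF g, of a b] graphD(2)[OF g, of a j]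
          graphD(3)[OF g] graphD(3)[OF gN] by (auto simp: pull_def agree_def)
    qed
    show ?thesis
    proof (rule equals0I)
      fix N assume N: "N \<in> cyl ?B i (diag ?B i j \<inter> X) \<inter> cyl ?B i (diag ?B i j \<inter> (?W - X))"
      then have NW: "N \<in> ?W" using sub by blast
      have "\<exists>M\<in>?W. M \<in> diag ?B i j \<inter> X \<and> agree i N M" using N unfolding Int_iff[of N] cyl[OF NW] by simp
      then obtain M where M: "M \<in> ?W" "M \<in> diag ?B i j" "M \<in> X" "agree i N M" by blast
      have "\<exists>M\<in>?W. M \<in> diag ?B i j \<inter> (?W - X) \<and> agree i N M" using N unfolding Int_iff[of N] cyl[OF NW] by simp
      then obtain M' where M': "M' \<in> ?W" "M' \<in> diag ?B i j" "M' \<notin> X" "agree i N M'" by blast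
      have "M i j = Same" "M' i j = Same" using M(2) M'(2) dg[OF M(1)] dg[OF M'(1)] by auto
      then have "M = M'" using eq[OF NW M(1,4)] eq[OF NW M'(1,4)] by simp
      then show False using M(3) M'(3) by simp
    qed
  qed
  ultimately show ?thesis
    unfolding CA_def by (simp add: cyl_type_net_alg Pow_def)
qed

subsection \<open>The neat reduct\<close>

lemma nets_restrict: "N \<in> nets \<alpha> k r n \<Longrightarrow> m \<le> n \<Longrightarrow> pull (ord_plus \<alpha> m) (\<lambda>i. i) N \<in> nets \<alpha> k r m"
  by (rule nets_pull) (auto intro: fv_id)

lemma nets_restrict0: "N \<in> nets \<alpha> k r n \<Longrightarrow> pull \<alpha> (\<lambda>i. i) N \<in> nets \<alpha> k r 0"
  using nets_restrict[of N \<alpha> k r n 0] by simp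

text \<open>A change at \<open>i\<close> of the restricted network can be carried out in the large
  one. This is what makes restriction compatible with cylindrifications; the extra coordinates are
  restored one at a time.\<close>

lemma nets_lift:
  assumes \<alpha>: "ord_nat 2 < \<alpha>" and i: "i < \<alpha>"
  shows "n \<le> k \<Longrightarrow> N \<in> nets \<alpha> k r n \<Longrightarrow> N' \<in> nets \<alpha> k r 0 \<Longrightarrow> agree i (pull \<alpha> (\<lambda>i. i) N) N' \<Longrightarrow>
    \<exists>M\<in>nets \<alpha> k r n. agree i N M \<and> pull \<alpha> (\<lambda>i. i) M = N'"
proof (induction n arbitrary: N)
  case 0
  then have "pull \<alpha> (\<lambda>i. i) N = N" "pull \<alpha> (\<lambda>i. i) N' = N'"
    using pull_id[OF netsD(1)] by (metis ord_plus_0)+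
  with 0 show ?case by (intro bexI[of _ N']) auto
next
  case (Suc n)
  let ?e = "ord_plus \<alpha> n" and ?b = "ord_plus \<alpha> (Suc n)"
  let ?N1 = "pull ?e (\<lambda>i. i) N"
  have N1: "?N1 \<in> nets \<alpha> k r n" using nets_restrict[OF Suc.prems(2), of n] by simp
  have "pull \<alpha> (\<lambda>i. i) ?N1 = pull \<alpha> (\<lambda>i. i) N"
    using pull_pull[of \<alpha> "\<lambda>i. i" ?e "\<lambda>i. i" N] less_ord_plus[of _ \<alpha> n] by (simp add: comp_def)
  then obtain M1 where M1: "M1 \<in> nets \<alpha> k r n" "agree i ?N1 M1" "pull \<alpha> (\<lambda>i. i) M1 = N'"
    using Suc.IH[OF _ N1 Suc.prems(3)] Suc.prems(1,4) by auto
  obtain l where l: "l < \<alpha>" "l \<noteq> i"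
    using ord_nats_less[OF \<alpha>] by (metis ord_nat_eq_iff zero_neq_one)
  have le: "l < ?e" "l < ?b" "?e < ?b" using l less_ord_plus by auto
  \<comment> \<open>The top coordinate is parked on \<open>l\<close>, which the change at
    \<open>i\<close> does not touch. Amalgamating over the top coordinate and \<open>i\<close> then
    gives it back its old labels.\<close>
  let ?c = "\<lambda>x. if x = ?e then l else x"
  let ?N2 = "pull ?b ?c N" and ?M2 = "pull ?b ?c M1"
  have c: "fv ?b ?e ?c" by (rule fv_collapse[OF le(1)])
  have N2: "?N2 \<in> nets \<alpha> k r (Suc n)" by (rule nets_pull[OF Suc.prems(2)]) (rule fv_mono[OF c], simp)
  have M2: "?M2 \<in> nets \<alpha> k r (Suc n)" by (rule nets_pull[OF M1(1) c])
  have e: "agree ?e N ?N2"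
    using graphD(1)[OF netsD(1)[OF Suc.prems(2)]] by (auto simp: agree_def pull_def)
  have "agree i ?N2 ?M2"
    unfolding agree_def
  proof (intro allI impI)
    fix a b assume ab: "a \<noteq> i" "b \<noteq> i"
    have lt: "a < ?b \<Longrightarrow> ?c a < ?e" "b < ?b \<Longrightarrow> ?c b < ?e" using c by (auto simp: fv_def)
    have "?c a \<noteq> i" "?c b \<noteq> i" using ab l by auto
    then have "?N1 (?c a) (?c b) = M1 (?c a) (?c b)" using M1(2) unfolding agree_def by blast
    moreover have "?N1 (?c a) (?c b) = N (?c a) (?c b)" if "a < ?b" "b < ?b"
      unfolding pull_def using lt that by meson
    ultimately show "?N2 a b = ?M2 a b" unfolding pull_def[of ?b] by presburger
  qed
  from nets_amalgam[OF \<alpha> Suc.prems(1,2) M2 le(3) less_ord_plus[OF i] e this]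
  obtain L where L: "L \<in> nets \<alpha> k r (Suc n)" "agree i N L" "agree ?e L ?M2" by blast
  have "pull \<alpha> (\<lambda>i. i) L = N'"
  proof -
    have "L a b = M1 a b" if "a < \<alpha>" "b < \<alpha>" for a b
    proof -
      have "a < ?e" "b < ?e" "a < ?b" "b < ?b" "a \<noteq> ?e" "b \<noteq> ?e" using that less_ord_plus by blast+
      then show ?thesis using L(3) by (simp add: agree_def pull_def)
    qed
    then have "pull \<alpha> (\<lambda>i. i) L = pull \<alpha> (\<lambda>i. i) M1" by (simp add: pull_def fun_eq_iff)
    then show ?thesis using M1(3) by simp
  qed
  with L show ?case by blast
qed

text \<open>The extra coordinates are moved to coordinate 0 one by one. Each move changes a single
  coordinate from \<alpha> on and so does not affect membership in \<open>Y\<close>, and after k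
  moves the network depends on its restriction to \<alpha> alone.\<close>

lemma neat_element_determined:
  assumes \<alpha>: "ord_nat 2 < \<alpha>"
    and Y: "\<And>i N M. \<alpha> \<le> i \<Longrightarrow> i < ord_plus \<alpha> k \<Longrightarrow> N \<in> Y \<Longrightarrow> M \<in> nets \<alpha> k r k \<Longrightarrow> agree i N M \<Longrightarrow> M \<in> Y"
    and NM: "N \<in> nets \<alpha> k r k" "M \<in> nets \<alpha> k r k" "pull \<alpha> (\<lambda>i. i) N = pull \<alpha> (\<lambda>i. i) M" and NY: "N \<in> Y"
  shows "M \<in> Y"
proof -
  let ?\<beta> = "ord_plus \<alpha> k"
  define c where "c m x = (if x \<in> ord_plus \<alpha> ` {..<m} then ord_nat 0 else x)" for m x
  have 0: "ord_nat 0 < \<alpha>" "ord_nat 0 < ?\<beta>" using ord_nats_less[OF \<alpha>] less_ord_plus by blast+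
  have c: "fv ?\<beta> ?\<beta> (c m)" for m
    by (rule fv_finite_change[OF fv_id[OF order_refl], of "ord_plus \<alpha> ` {..<m}"]) (use 0 in \<open>auto simp: c_def\<close>)
  have in_nets: "pull ?\<beta> (c m) N \<in> nets \<alpha> k r k" if "N \<in> nets \<alpha> k r k" for N m
    by (rule nets_pull[OF that c])
  have step: "pull ?\<beta> (c m) N \<in> Y \<longleftrightarrow> N \<in> Y" if N: "N \<in> nets \<alpha> k r k" and "m \<le> k" for N m
    using \<open>m \<le> k\<close>
  proof (induction m)
    case 0
    have "pull ?\<beta> (c 0) N = N" using pull_id[OF netsD(1)[OF N]] by (simp add: c_def[abs_def])
    then show ?case by simp
  next
    case (Suc m)
    have "agree (ord_plus \<alpha> m) (pull ?\<beta> (c m) N) (pull ?\<beta> (c (Suc m)) N)"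
      by (auto simp: agree_def pull_def c_def lessThan_Suc)
    then have "pull ?\<beta> (c (Suc m)) N \<in> Y \<longleftrightarrow> pull ?\<beta> (c m) N \<in> Y"
      using Y[of "ord_plus \<alpha> m"] Suc.prems in_nets[OF N] agree_sym by (metis Suc_le_lessD ord_plus_ge ord_plus_less_iff)
    then show ?case using Suc by simp
  qed
  have "c k x < \<alpha>" if "x < ?\<beta>" for x
    using that 0 lessThan_ord_plus[of \<alpha> k] by (auto simp: c_def)
  then have "pull ?\<beta> (c k) N = pull ?\<beta> (c k) (pull \<alpha> (\<lambda>i. i) N)" for N
    by (auto simp: pull_def fun_eq_iff)
  then have "pull ?\<beta> (c k) N = pull ?\<beta> (c k) M" using NM(3) by metis
  then show ?thesis using step[OF NM(1), of k] step[OF NM(2), of k] NY by simp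
qed

text \<open>A set of \<alpha>-dimensional networks is sent to the set of their extensions. Lifting
  gives preservation of cylindrifications, the existence of extensions (copies of coordinate 0)
  gives injectivity, and a neat element is the set of all extensions of its restrictions.\<close>

lemma net_alg_isomorphic_neat_reduct:
  assumes \<alpha>: "ord_nat 2 < \<alpha>" and e: "inj e"
  shows "isomorphic \<alpha> (net_alg e (nets \<alpha> k r 0))
           (neat_reduct \<alpha> (ord_plus \<alpha> k) (net_alg (\<lambda>N. N) (nets \<alpha> k r k)))"
proof -
  let ?V = "nets \<alpha> k r 0" and ?W = "nets \<alpha> k r k" and ?\<beta> = "ord_plus \<alpha> k"
  let ?A = "net_alg e ?V" and ?B = "net_alg (\<lambda>N. N) ?W"
  let ?R = "neat_reduct \<alpha> ?\<beta> ?B"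
  define p where "p N = pull \<alpha> (\<lambda>i. i) N" for N :: "'a network"
  define f where "f X = {N \<in> ?W. e (p N) \<in> X}" for X
  have pV: "p N \<in> ?V" if "N \<in> ?W" for N unfolding p_def by (rule nets_restrict0[OF that])
  have cylA: "e N \<in> cyl ?A i X \<longleftrightarrow> (\<exists>M\<in>?V. e M \<in> X \<and> agree i N M)" if "N \<in> ?V" for N i X
    by (rule in_cyl_net_alg) (use e that in \<open>auto intro: inj_on_subset\<close>)
  have cylB: "N \<in> cyl ?B i X \<longleftrightarrow> (\<exists>M\<in>?W. M \<in> X \<and> agree i N M)" if "N \<in> ?W" for N i X
    using in_cyl_net_alg[of "\<lambda>N. N" ?W N i X] that by simp
  note sub = cyl_net_alg_subset[of "\<lambda>N. N" ?W, simplified]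
  have carR: "X \<in> carrier ?R \<longleftrightarrow> X \<subseteq> ?W \<and> (\<forall>i. \<alpha> \<le> i \<and> i < ?\<beta> \<longrightarrow> cyl ?B i X = X)" for X
    by (simp add: neat_reduct_def)
  have p_agree: "agree i (p N) (p M)" if "agree i N M" for i N M
    using that by (simp add: agree_def p_def pull_def)
  have p_agree': "p N = p M" if "agree i N M" "\<alpha> \<le> i" for i N M
    using that by (auto simp: agree_def p_def pull_def fun_eq_iff)
  have fR: "f X \<in> carrier ?R" for X
    unfolding carR
  proof (intro conjI allI impI)
    fix i assume i: "\<alpha> \<le> i \<and> i < ?\<beta>"
    show "cyl ?B i (f X) = f X"
    proof (rule net_alg_eqI[of _ "\<lambda>N. N" ?W])
      fix N assume "N \<in> ?W"
      then have "(\<exists>M\<in>?W. M \<in> f X \<and> agree i N M) \<longleftrightarrow> N \<in> f X"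
        using p_agree'[of i N] agree_refl[of i N] i \<open>N \<in> ?W\<close> unfolding f_def mem_Collect_eq by metis
      then show "N \<in> cyl ?B i (f X) \<longleftrightarrow> N \<in> f X" by (simp only: cylB[OF \<open>N \<in> ?W\<close>])
    qed (use sub in \<open>auto simp: f_def\<close>)
  qed (auto simp: f_def)
  have surj: "X \<in> f ` carrier ?A" if X: "X \<in> carrier ?R" for X
  proof -
    have closed: "M \<in> X" if "\<alpha> \<le> i" "i < ?\<beta>" "N \<in> X" "M \<in> ?W" "agree i N M" for i N M
    proof -
      have "N \<in> ?W" using that(3) X unfolding carR by blast
      then have "M \<in> cyl ?B i X" unfolding cylB[OF \<open>M \<in> ?W\<close>] using that(3) agree_sym[OF that(5)] by blast
      then show ?thesis using X that(1,2) unfolding carR by auto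
    qed
    have det: "M \<in> X" if "N \<in> ?W" "M \<in> ?W" "p N = p M" "N \<in> X" for N M
      by (rule neat_element_determined[OF \<alpha> _ that(1,2) that(3)[unfolded p_def] that(4)]) (rule closed)
    have "X = f ((\<lambda>N. e (p N)) ` X)"
    proof
      show "X \<subseteq> f ((\<lambda>N. e (p N)) ` X)" using X unfolding carR f_def by blast
      show "f ((\<lambda>N. e (p N)) ` X) \<subseteq> X"
      proof
        fix M assume "M \<in> f ((\<lambda>N. e (p N)) ` X)"
        then obtain N where N: "M \<in> ?W" "N \<in> X" "p N = p M" using e by (auto simp: f_def inj_eq)
        then have "N \<in> ?W" using X unfolding carR by blast
        from det[OF this N(1,3,2)] show "M \<in> X" .
      qed
    qed
    moreover have "(\<lambda>N. e (p N)) ` X \<in> carrier ?A" using pV X by (auto simp: carR)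
    ultimately show ?thesis by blast
  qed
  have lift0: "\<exists>M\<in>?W. p M = N" if N: "N \<in> ?V" for N
  proof -
    have "fv ?\<beta> \<alpha> (\<lambda>x. if x < \<alpha> then x else ord_nat 0)"
    proof -
      have "{i. i < ?\<beta> \<and> (if i < \<alpha> then i else ord_nat 0) \<noteq> i} \<subseteq> ord_plus \<alpha> ` {..<k}"
        using lessThan_ord_plus[of \<alpha> k] by auto
      from finite_subset[OF this] show ?thesis using ord_nats_less[OF \<alpha>] by (simp add: fv_def)
    qed
    then have "pull ?\<beta> (\<lambda>x. if x < \<alpha> then x else ord_nat 0) N \<in> ?W"
      using nets_pull[OF N, of k] by simp
    moreover have "p (pull ?\<beta> (\<lambda>x. if x < \<alpha> then x else ord_nat 0) N) = N"
      using graphD(1)[OF netsD(1)[OF N]] less_ord_plus[of _ \<alpha> k] by (auto simp: p_def pull_def fun_eq_iff)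
    ultimately show ?thesis by blast
  qed
  have inj: "inj_on f (carrier ?A)"
  proof (rule inj_onI)
    fix X Y assume XY: "X \<in> carrier ?A" "Y \<in> carrier ?A" "f X = f Y"
    have "e N \<in> X \<longleftrightarrow> e N \<in> Y" if N: "N \<in> ?V" for N
    proof -
      obtain M where "M \<in> ?W" "p M = N" using lift0[OF N] by blast
      then show ?thesis using XY(3) unfolding f_def set_eq_iff by blast
    qed
    then show "X = Y" using XY(1,2) by (intro net_alg_eqI[of _ e ?V]) auto
  qed
  have cyl: "f (cyl ?A i X) = cyl ?B i (f X)" if i: "i < \<alpha>" for i X
  proof (rule net_alg_eqI[of _ "\<lambda>N. N" ?W])
    fix N assume N: "N \<in> ?W"
    have "(\<exists>M\<in>?V. e M \<in> X \<and> agree i (p N) M) \<longleftrightarrow> (\<exists>M\<in>?W. M \<in> f X \<and> agree i N M)"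
    proof
      assume "\<exists>M\<in>?V. e M \<in> X \<and> agree i (p N) M"
      then obtain M where M: "M \<in> ?V" "e M \<in> X" "agree i (p N) M" by blast
      then show "\<exists>M\<in>?W. M \<in> f X \<and> agree i N M"
        using nets_lift[OF \<alpha> i order_refl N M(1)] unfolding p_def f_def by auto
    qed (use p_agree pV in \<open>auto simp: f_def\<close>)
    then show "N \<in> f (cyl ?A i X) \<longleftrightarrow> N \<in> cyl ?B i (f X)"
      using N cylB[OF N] cylA[OF pV[OF N]] by (simp add: f_def)
  qed (use sub in \<open>auto simp: f_def\<close>)
  have diag: "f (diag ?A i j) = diag ?B i j" if "i < \<alpha>" "j < \<alpha>" for i j
  proof (rule net_alg_eqI[of _ "\<lambda>N. N" ?W])
    fix N assume N: "N \<in> ?W"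
    have "e (p N) \<in> diag ?A i j \<longleftrightarrow> p N i j = Same"
      by (rule in_diag_net_alg) (use e pV[OF N] in \<open>auto intro: inj_on_subset\<close>)
    moreover have "N \<in> diag ?B i j \<longleftrightarrow> N i j = Same" using in_diag_net_alg[of "\<lambda>N. N" ?W N i j] N by simp
    ultimately show "N \<in> f (diag ?A i j) \<longleftrightarrow> N \<in> diag ?B i j"
      using N that by (simp add: f_def p_def pull_def)
  qed (use sub in \<open>auto simp: f_def\<close>)
  have R: "join ?R = (\<union>)" "meet ?R = (\<inter>)" "compl ?R X = ?W - X" "zer ?R = {}" "one ?R = ?W"
    "cyl ?R = cyl ?B" "diag ?R = diag ?B" for X
    by (simp_all add: neat_reduct_def net_alg_def)
  have f_bool: "f (X \<union> Y) = f X \<union> f Y" "f (X \<inter> Y) = f X \<inter> f Y" "f (e ` ?V - X) = ?W - f X"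
    "f {} = {}" "f (e ` ?V) = ?W" for X Y
    using pV by (auto simp: f_def)
  \<comment> \<open>Every element of \<open>?R\<close> has the form \<open>f X\<close> and
    \<open>f\<close> respects the operations, so closure is inherited from
    \<open>?A\<close>.\<close>
  have "cyl_type \<alpha> ?R"
  proof -
    have 1: "\<exists>X. x = f X" if "x \<in> carrier ?R" for x using surj[OF that] by blast
    have fU: "f X \<union> f Y \<in> carrier ?R" "f X \<inter> f Y \<in> carrier ?R" "?W - f X \<in> carrier ?R"
      "{} \<in> carrier ?R" "?W \<in> carrier ?R" for X Y
      using fR[of "X \<union> Y"] fR[of "X \<inter> Y"] fR[of "e ` ?V - X"] fR[of "{}"] fR[of "e ` ?V"]
      unfolding f_bool by simp_all
    have J: "x \<union> y \<in> carrier ?R" "x \<inter> y \<in> carrier ?R" if "x \<in> carrier ?R" "y \<in> carrier ?R" for x y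
      using 1[OF that(1)] 1[OF that(2)] fU(1,2) by auto
    have C: "?W - x \<in> carrier ?R" if "x \<in> carrier ?R" for x
      using 1[OF that] fU(3) by auto
    have Y: "cyl ?B i x \<in> carrier ?R" if "i < \<alpha>" "x \<in> carrier ?R" for i x
      using 1[OF that(2)] fR[of "cyl ?A i _"] cyl[OF that(1)] by auto
    have D: "diag ?B i j \<in> carrier ?R" if "i < \<alpha>" "j < \<alpha>" for i j
      using fR[of "diag ?A i j"] diag[OF that] by simp
    show ?thesis unfolding cyl_type_def R
      by (intro conjI ballI allI impI J C Y D fU(4,5))
  qed
  then have "cyl_hom \<alpha> ?A ?R f"
    unfolding cyl_hom_def R using fR f_bool cyl diag by (simp add: cyl_type_net_alg)
  moreover have "bij_betw f (carrier ?A) (carrier ?R)"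
    unfolding bij_betw_def using inj surj fR by blast
  ultimately show ?thesis unfolding isomorphic_def by blast
qed

lemma net_alg_in_Nr_CA:
  assumes "ord_nat 2 < \<alpha>" "inj e"
  shows "net_alg e (nets \<alpha> k r 0) \<in> Nr_CA \<alpha> (ord_plus \<alpha> k)"
  by (rule Nr_CA_any_type[OF _ net_alg_nets_CA[OF assms(1) order_refl] net_alg_isomorphic_neat_reduct[OF assms]])
    simp

subsection \<open>Adding a point\<close>

definition adjoin :: "'i::{wellorder,no_top} \<Rightarrow> ('i \<Rightarrow> label) \<Rightarrow> 'i network \<Rightarrow> 'i network" where
  "adjoin e h N = (\<lambda>a b. if a = e then (if b < e then h b else Same)
     else if b = e then (if a < e then h a else Same) else N a b)"

lemma adjoin_simps:
  "a < e \<Longrightarrow> b < e \<Longrightarrow> adjoin e h N a b = N a b" "a < e \<Longrightarrow> adjoin e h N e a = h a"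
  "a < e \<Longrightarrow> adjoin e h N a e = h a" "adjoin e h N e e = Same"
  by (auto simp: adjoin_def)

lemma graph_adjoin:
  fixes \<alpha> :: "'i::{wellorder,no_top}"
  assumes N: "graph (ord_plus \<alpha> n) k r N"
    and h: "\<And>y. y < ord_plus \<alpha> n \<Longrightarrow> h y \<noteq> Same"
    and hc: "\<And>y y'. y < ord_plus \<alpha> n \<Longrightarrow> y' < ord_plus \<alpha> n \<Longrightarrow> N y y' = Same \<Longrightarrow> h y = h y'"
    and hv: "\<And>y c s. y < ord_plus \<alpha> n \<Longrightarrow> h y = Colour c s \<Longrightarrow> c \<le> k \<and> s \<le> r"
    and tri: "\<And>y y' c s s' s''. y < ord_plus \<alpha> n \<Longrightarrow> y' < ord_plus \<alpha> n \<Longrightarrow> h y = Colour c s \<Longrightarrow>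
      h y' = Colour c s' \<Longrightarrow> N y y' = Colour c s'' \<Longrightarrow> s \<noteq> s' \<and> s \<noteq> s'' \<and> s' \<noteq> s''"
  shows "graph (ord_plus \<alpha> (Suc n)) k r (adjoin (ord_plus \<alpha> n) h N)"
proof -
  let ?e = "ord_plus \<alpha> n" and ?b = "ord_plus \<alpha> (Suc n)"
  let ?M = "adjoin ?e h N"
  note g = graphD[OF N]
  have sym: "?M a b = ?M b a" for a b using g(2)[of a b] by (simp add: adjoin_def)
  have out: "?M a b = Same" if "\<not> (a < ?b \<and> b < ?b)" for a b
    using that g(1)[of a b] by (auto simp: adjoin_def less_ord_plus_Suc)
  have diag: "?M a a = Same" for a using g(3) by (simp add: adjoin_def)
  have lt: "y < ?e" if "y < ?b" "y \<noteq> ?e" for y using that by (simp add: less_ord_plus_Suc)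
  have cong: "?M a l = ?M b l" if ab: "a < ?b" "b < ?b" "?M a b = Same" for a b l
  proof (cases "a = b")
    case False
    have ne: "a \<noteq> ?e" "b \<noteq> ?e"
      using ab False h[of a] h[of b] lt[of a] lt[of b] by (auto simp: adjoin_simps)
    with ab lt have "a < ?e" "b < ?e" by auto
    moreover from this ab(3) have "N a b = Same" by (simp add: adjoin_simps)
    ultimately show ?thesis using g(4)[of a b l] hc[of a b] ne by (simp add: adjoin_def)
  qed simp
  have valid: "c \<le> k \<and> s \<le> r" if "?M a b = Colour c s" for a b c s
    using that g(5,6)[of a b c s] hv[of a c s] hv[of b c s] by (simp add: adjoin_def split: if_splits)
  have hlt: "y < ?e" if "?M ?e y = Colour c s" for y c s
    using that by (simp add: adjoin_def split: if_splits)
  have tri': "?M b d \<noteq> Colour c s'" if t: "?M a b = Colour c s" "?M a d = Colour c s" for a b d c s s'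
  proof
    assume t3: "?M b d = Colour c s'"
    have ne: "a \<noteq> b" "a \<noteq> d" "b \<noteq> d" using t t3 diag by auto
    consider "a = ?e" | "b = ?e" | "d = ?e" | "a \<noteq> ?e" "b \<noteq> ?e" "d \<noteq> ?e" by blast
    then show False
    proof cases
      case 1
      then have "b < ?e" "d < ?e" using t hlt by auto
      then show False using tri[of b d c s s s'] t t3 1 by (simp add: adjoin_simps)
    next
      case 2
      then have "a < ?e" "d < ?e" using t(1) t3 hlt sym by metis+
      then show False using tri[of a d c s s' s] t t3 2 by (simp add: adjoin_simps)
    next
      case 3
      then have "a < ?e" "b < ?e" using t(2) t3 hlt sym by metis+
      then show False using tri[of a b c s s' s] t t3 3 by (simp add: adjoin_simps)
    next
      case 4
      then show False using g(7)[of a b c s d s'] t t3 by (simp add: adjoin_def)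
    qed
  qed
  show ?thesis unfolding graph_def using sym out diag cong valid tri' by blast
qed

text \<open>One move of a representation game: a new point \<open>e\<close> is to replace
  \<open>s i\<close>, so that the sequence becomes a copy of \<open>N'\<close>. By
  \<open>sep\<close> no old point of the sequence can play this role.\<close>

locale extension =
  fixes \<alpha> :: "'i::{wellorder,no_top}" and k r n :: nat and N N' :: "'i network" and s :: "'i \<Rightarrow> 'i" and i :: 'i
  assumes \<alpha>: "ord_nat 2 < \<alpha>" and N: "N \<in> nets \<alpha> k r n" and N': "N' \<in> nets \<alpha> k r 0"
    and s: "fv \<alpha> (ord_plus \<alpha> n) s" and i: "i < \<alpha>" and NN': "agree i (pull \<alpha> s N) N'"
    and sep: "\<And>l. l < \<alpha> \<Longrightarrow> l \<noteq> i \<Longrightarrow> N' i l \<noteq> Same"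
begin

abbreviation "e \<equiv> ord_plus \<alpha> n"

text \<open>The edge from the new point to such a \<open>y\<close> is dictated by \<open>N'\<close>;
  all other edges may be chosen, through the function \<open>g\<close> below.\<close>

definition det :: "'i \<Rightarrow> bool" where
  "det y \<longleftrightarrow> (\<exists>l<\<alpha>. l \<noteq> i \<and> N y (s l) = Same)"

definition src :: "'i \<Rightarrow> 'i" where
  "src y = (SOME l. l < \<alpha> \<and> l \<noteq> i \<and> N y (s l) = Same)"

definition h :: "('i \<Rightarrow> label) \<Rightarrow> 'i \<Rightarrow> label" where
  "h g y = (if det y then N' i (src y) else g y)"

lemma graphs: "graph e k r N" "graph \<alpha> k r N'"
  using netsD(1)[OF N] netsD(1)[OF N'] by simp_all

lemma s_less: "l < \<alpha> \<Longrightarrow> s l < e"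
  using s by (simp add: fv_def)

lemma src:
  assumes "det y"
  shows "src y < \<alpha>" "src y \<noteq> i" "N y (s (src y)) = Same"
  using someI_ex[OF assms[unfolded det_def]] by (auto simp: src_def)

lemma N'_eq: "a < \<alpha> \<Longrightarrow> b < \<alpha> \<Longrightarrow> a \<noteq> i \<Longrightarrow> b \<noteq> i \<Longrightarrow> N' a b = N (s a) (s b)"
  using NN'[unfolded agree_def pull_def, rule_format, of a b] by simp

text \<open>The dictated label does not depend on the index: two indices that lead to the same point
  of \<open>N\<close> are also identified in \<open>N'\<close>.\<close>

lemma h_det:
  assumes "y < e" "l < \<alpha>" "l \<noteq> i" "N y (s l) = Same"
  shows "h g y = N' i l"
proof -
  have d: "det y" using assms by (auto simp: det_def)
  note S = src[OF d]
  have "N (s l) (s (src y)) = Same"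
    using graphD(4)[OF graphs(1) assms(1) s_less[OF assms(2)] assms(4), of "s (src y)"] S by simp
  then have "N' l (src y) = Same" using N'_eq assms S by simp
  then have "N' (src y) i = N' l i"
    using graphD(4)[OF graphs(2) assms(2) S(1)] by simp
  then show ?thesis using d graphD(2)[OF graphs(2)] unfolding h_def by metis
qed

lemma det_cong:
  assumes "y < e" "y' < e" "N y y' = Same" "det y"
  shows "det y'" "h g y = h g y'"
proof -
  note S = src[OF assms(4)]
  have *: "N y' (s (src y)) = Same"
    using graphD(4)[OF graphs(1) assms(1-3), of "s (src y)"] S by simp
  then show "det y'" using S by (auto simp: det_def)
  show "h g y = h g y'" using h_det[OF assms(1) S] h_det[OF assms(2) S(1,2) *] by simp
qed

lemma N_det:
  assumes "det y" "det y'" "y < e" "y' < e"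
  shows "N y y' = N' (src y) (src y')"
  using same_cong[OF graphs(1) src(3)[OF assms(1)] src(3)[OF assms(2)]] src[OF assms(1)] src[OF assms(2)]
    assms s_less N'_eq by simp

lemma adjoin_restrict: "pull e (\<lambda>a. a) (adjoin e (h g) N) = N"
  using graphD(1)[OF graphs(1)] by (auto simp: pull_def adjoin_def fun_eq_iff)

lemma adjoin_pull: "pull \<alpha> (s(i := e)) (adjoin e (h g) N) = N'"
proof (intro ext)
  fix a b
  have h: "h g (s l) = N' i l" if "l < \<alpha>" "l \<noteq> i" for l
    using h_det[OF s_less[OF that(1)] that] graphD(3)[OF graphs(1)] by simp
  show "pull \<alpha> (s(i := e)) (adjoin e (h g) N) a b = N' a b"
  proof (cases "a < \<alpha> \<and> b < \<alpha>")
    case True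
    then show ?thesis
      using h s_less N'_eq[of a b] graphD(2)[OF graphs(2), of a i] graphD(3)[OF graphs(2), of i]
      by (auto simp: pull_def adjoin_simps)
  next
    case False
    then show ?thesis using graphD(1)[OF graphs(2), of a b] by (auto simp: pull_def)
  qed
qed

text \<open>A new triangle over two determined points is a triangle of \<open>N'\<close>. Mixed
  triangles are excluded by \<open>tri1\<close>, and \<open>tri2\<close> takes care of those over
  two free points.\<close>

lemma graph_extension:
  assumes g: "\<And>y. y < e \<Longrightarrow> \<not> det y \<Longrightarrow> g y = Grey \<or> (\<exists>c s. g y = Colour c s \<and> c \<le> k \<and> s \<le> r)"
    and gc: "\<And>y y'. y < e \<Longrightarrow> y' < e \<Longrightarrow> \<not> det y \<Longrightarrow> \<not> det y' \<Longrightarrow> N y y' = Same \<Longrightarrow> g y = g y'"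
    and tri1: "\<And>y c s s' l. y < e \<Longrightarrow> \<not> det y \<Longrightarrow> g y = Colour c s \<Longrightarrow> l < \<alpha> \<Longrightarrow> l \<noteq> i \<Longrightarrow> N' i l \<noteq> Colour c s'"
    and tri2: "\<And>y y' c s s' s''. y < e \<Longrightarrow> y' < e \<Longrightarrow> \<not> det y \<Longrightarrow> \<not> det y' \<Longrightarrow> g y = Colour c s \<Longrightarrow>
      g y' = Colour c s' \<Longrightarrow> N y y' = Colour c s'' \<Longrightarrow> s \<noteq> s' \<and> s \<noteq> s'' \<and> s' \<noteq> s''"
  shows "graph (ord_plus \<alpha> (Suc n)) k r (adjoin e (h g) N)"
proof (rule graph_adjoin[OF graphs(1)])
  fix y assume y: "y < e"
  show "h g y \<noteq> Same" using g[OF y] sep[of "src y"] src[of y] by (auto simp: h_def)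
  fix c s assume "h g y = Colour c s"
  then show "c \<le> k \<and> s \<le> r" using g[OF y] graphD(5,6)[OF graphs(2), of i "src y"] by (auto simp: h_def split: if_splits)
next
  fix y y' assume yy: "y < e" "y' < e" "N y y' = Same"
  have "N y' y = Same" using yy(3) graphD(2)[OF graphs(1)] by simp
  then show "h g y = h g y'"
    using det_cong[OF yy] det_cong[OF yy(2,1)] gc[OF yy(1,2) _ _ yy(3)] by (metis h_def)
next
  fix y y' c s s' s''
  assume *: "y < e" "y' < e" "h g y = Colour c s" "h g y' = Colour c s'" "N y y' = Colour c s''"
  show "s \<noteq> s' \<and> s \<noteq> s'' \<and> s' \<noteq> s''"
  proof (cases "det y"; cases "det y'")
    assume d: "det y" "det y'"
    note D = graphD(7)[OF graphs(2)]
    have "N' i (src y) = Colour c s" "N' i (src y') = Colour c s'" "N' (src y) (src y') = Colour c s''"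
      using * d N_det[OF d] by (auto simp: h_def)
    moreover from this have "N' (src y) i = Colour c s" "N' (src y') i = Colour c s'" "N' (src y') (src y) = Colour c s''"
      using graphD(2)[OF graphs(2)] by metis+
    ultimately show ?thesis using D by metis
  next
    assume d: "det y" "\<not> det y'"
    then show ?thesis using tri1[OF *(2) d(2), of c s' "src y" s] src[OF d(1)] *(3,4) by (auto simp: h_def)
  next
    assume d: "\<not> det y" "det y'"
    then show ?thesis using tri1[OF *(1) d(1), of c s "src y'" s'] src[OF d(2)] *(3,4) by (auto simp: h_def)
  next
    assume d: "\<not> det y" "\<not> det y'"
    then show ?thesis using tri2[OF *(1,2) d _ _ *(5), of s s'] *(3,4) by (auto simp: h_def)
  qed
qed

text \<open>A bad sequence has to pass through \<open>e\<close>, and also through a free point,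
  because otherwise it could be copied into \<open>N'\<close>. The edge between the two is not
  black, so it is the exceptional one and grey.\<close>

lemma bad_extension:
  assumes t: "fv \<alpha> (ord_plus \<alpha> (Suc n)) t" "bad \<alpha> (pull \<alpha> t (adjoin e (h g) N))"
    and G: "graph (ord_plus \<alpha> (Suc n)) k r (adjoin e (h g) N)"
    and g: "\<And>y. y < e \<Longrightarrow> \<not> det y \<Longrightarrow> \<not> is_black (g y)"
  shows "\<exists>y<e. \<not> det y \<and> g y = Grey \<and> {t (ord_nat 0), t (ord_nat 1)} = {e, y}"
proof -
  let ?M = "adjoin e (h g) N"
  have t_lt: "t a < e" if "a < \<alpha>" "t a \<noteq> e" for a
    using t(1) that by (auto simp: fv_def less_ord_plus_Suc)
  have "e \<in> t ` {..<\<alpha>}"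
  proof (rule ccontr)
    assume ne: "e \<notin> t ` {..<\<alpha>}"
    then have lt: "t a < e" if "a < \<alpha>" for a using t_lt[OF that] that by (metis imageI lessThan_iff)
    then have "pull \<alpha> t ?M = pull \<alpha> t N" by (simp add: pull_def fun_eq_iff adjoin_simps)
    moreover have "fv \<alpha> e t" using t(1) lt by (simp add: fv_def)
    ultimately show False using netsD(2)[OF N, of t] t(2) by simp
  qed
  then obtain a0 where a0: "a0 < \<alpha>" "t a0 = e" by auto
  have inj: "inj_on t {..<\<alpha>}" by (rule bad_distinct(1)[OF \<alpha> G t(2)])
  have t_lt: "t a < e" if "a < \<alpha>" "a \<noteq> a0" for a
    using t_lt[OF that(1)] inj_onD[OF inj, of a a0] a0 that by auto
  have "\<exists>a<\<alpha>. a \<noteq> a0 \<and> \<not> det (t a)"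
  proof (rule ccontr)
    assume "\<not> ?thesis"
    then have d: "det (t a)" if "a < \<alpha>" "a \<noteq> a0" for a using that by blast
    \<comment> \<open>Using \<open>src\<close> throughout might change infinitely many indices.
      Keeping \<open>a\<close> wherever \<open>t a = s a\<close> confines the changes to
      \<open>i\<close>, \<open>a0\<close> and the indices moved by \<open>t\<close> or
      \<open>s\<close>, so \<open>u\<close> is a finite variation.\<close>
    define u where "u a = (if a = a0 then i else if t a = s a \<and> a \<noteq> i then a else src (t a))" for a
    have u: "u a < \<alpha>" "u a \<noteq> i" "N (t a) (s (u a)) = Same" if "a < \<alpha>" "a \<noteq> a0" for a
      using src[OF d[OF that]] that graphD(3)[OF graphs(1)] by (auto simp: u_def)
    have "fv \<alpha> \<alpha> u"
    proof -
      have "{a. a < \<alpha> \<and> u a \<noteq> a} \<subseteq> {a. a < \<alpha> \<and> t a \<noteq> a} \<union> {a. a < \<alpha> \<and> s a \<noteq> a} \<union> {i, a0}"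
        by (auto simp: u_def split: if_splits)
      then have "finite {a. a < \<alpha> \<and> u a \<noteq> a}"
        using t(1) s by (elim finite_subset) (simp add: fv_def)
      moreover have "u a < \<alpha>" if "a < \<alpha>" for a
        using u(1)[OF that] i by (cases "a = a0") (auto simp: u_def)
      ultimately show ?thesis by (simp add: fv_def)
    qed
    moreover have "pull \<alpha> u N' = pull \<alpha> t ?M"
    proof -
      have h: "?M e (t a) = N' i (u a)" if "a < \<alpha>" "a \<noteq> a0" for a
        using h_det[OF t_lt[OF that] u[OF that]] t_lt[OF that] by (simp add: adjoin_simps)
      have "N' (u a) (u b) = ?M (t a) (t b)" if ab: "a < \<alpha>" "b < \<alpha>" for a b
      proof (cases "a = a0"; cases "b = a0")
        assume "a = a0" "b = a0"
        then show ?thesis using graphD(3)[OF graphs(2)] a0 by (simp add: adjoin_simps)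
      next
        assume "a = a0" "b \<noteq> a0"
        then show ?thesis using h[of b] ab a0 by (simp add: u_def)
      next
        assume *: "a \<noteq> a0" "b = a0"
        then show ?thesis using h[of a] ab a0 graphD(2)[OF graphs(2), of i] graphD(2)[OF G, of e] by (simp add: u_def)
      next
        assume *: "a \<noteq> a0" "b \<noteq> a0"
        have "N (t a) (t b) = N (s (u a)) (s (u b))"
          using same_cong[OF graphs(1) u(3)[of a] u(3)[of b]] * ab t_lt s_less u(1) by simp
        then show ?thesis using u[of a] u[of b] ab * N'_eq t_lt by (simp add: adjoin_simps)
      qed
      then show ?thesis by (simp add: pull_def fun_eq_iff)
    qed
    ultimately show False using netsD(2)[OF N', of u] t(2) by simp
  qed
  then obtain a where a: "a < \<alpha>" "a \<noteq> a0" "\<not> det (t a)" by blast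
  have lab: "?M e (t a) = g (t a)" using t_lt[OF a(1,2)] a(3) by (simp add: adjoin_simps h_def)
  have nb: "\<not> is_black (?M e (t a))" unfolding lab by (rule g[OF t_lt[OF a(1,2)] a(3)])
  have "{a0, a} = {ord_nat 0, ord_nat 1}"
  proof (rule ccontr)
    assume "{a0, a} \<noteq> {ord_nat 0, ord_nat 1}"
    from badD(1)[OF t(2) a0(1) a(1) _ this] a(1,2) a0 nb show False by (simp add: pull_def)
  qed
  then have "(a0 = ord_nat 0 \<and> a = ord_nat 1) \<or> (a0 = ord_nat 1 \<and> a = ord_nat 0)"
    by (auto simp: doubleton_eq_iff)
  moreover have "?M e (t a) = Grey"
    using bad_distinct(2)[OF \<alpha> G t(2) a0(1) a(1)] a(2) a0(2) nb by auto
  ultimately show ?thesis using lab t_lt[OF a(1,2)] a(3) a0(2) by auto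
qed

lemma ext_in_nets_or_blocked:
  assumes G: "graph (ord_plus \<alpha> (Suc n)) k r (adjoin e (h g) N)"
    and g: "\<And>y. y < e \<Longrightarrow> \<not> det y \<Longrightarrow> \<not> is_black (g y)"
    and nets: "adjoin e (h g) N \<notin> nets \<alpha> k r (Suc n)"
  shows "\<exists>t y. fv \<alpha> (ord_plus \<alpha> (Suc n)) t \<and> bad \<alpha> (pull \<alpha> t (adjoin e (h g) N)) \<and>
    y < e \<and> \<not> det y \<and> g y = Grey \<and> {t (ord_nat 0), t (ord_nat 1)} = {e, y}"
  using assms bad_extension[OF _ _ G g] by (simp add: nets_def) metis

text \<open>The edges from \<open>e\<close> into the clique are black, hence determined; so a free
  point is \<open>y0\<close> or one of the n + 1 points missed by \<open>t\<close>. If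
  \<open>l1\<close> and \<open>l2\<close> were both joined to \<open>i\<close> by non-black edges,
  then sending 0 and 1 to them and every other index to that of its point would give an injective
  finite variation of \<alpha> that misses \<open>i\<close>.\<close>

lemma blocked:
  assumes t: "fv \<alpha> (ord_plus \<alpha> (Suc n)) t" "bad \<alpha> (pull \<alpha> t (adjoin e (h (\<lambda>_. Grey)) N))"
    and G: "graph (ord_plus \<alpha> (Suc n)) k r (adjoin e (h (\<lambda>_. Grey)) N)"
    and y0: "y0 < e" "\<not> det y0" "{t (ord_nat 0), t (ord_nat 1)} = {e, y0}"
  shows "card {y. y < e \<and> \<not> det y} \<le> n + 2" "finite {y. y < e \<and> \<not> det y}"
    and "l1 < \<alpha> \<Longrightarrow> l2 < \<alpha> \<Longrightarrow> l1 \<noteq> i \<Longrightarrow> l2 \<noteq> i \<Longrightarrow> l1 \<noteq> l2 \<Longrightarrow> is_black (N' i l1) \<or> is_black (N' i l2)"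
proof -
  let ?M = "adjoin e (h (\<lambda>_. Grey)) N" and ?b = "ord_plus \<alpha> (Suc n)"
  let ?o0 = "ord_nat 0" and ?o1 = "ord_nat 1"
  have inj: "inj_on t {..<\<alpha>}" by (rule bad_distinct(1)[OF \<alpha> G t(2)])
  note o = ord_nats_less[OF \<alpha>]
  have ne: "t a \<noteq> e" if "a < \<alpha>" "a \<noteq> ?o0" "a \<noteq> ?o1" for a
  proof -
    have "e = t ?o0 \<or> e = t ?o1" using y0(3) by (auto simp: doubleton_eq_iff)
    then show ?thesis using inj_onD[OF inj, of a ?o0] inj_onD[OF inj, of a ?o1] that o by auto
  qed
  have t_lt: "t a < e" if "a < \<alpha>" "a \<noteq> ?o0" "a \<noteq> ?o1" for a
    using ne[OF that] t(1) that(1) by (auto simp: fv_def less_ord_plus_Suc)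
  have black: "is_black (?M e (t a))" if a: "a < \<alpha>" "a \<noteq> ?o0" "a \<noteq> ?o1" for a
  proof -
    obtain b where b: "b = ?o0 \<or> b = ?o1" "t b = e" using y0(3) by (auto simp: doubleton_eq_iff)
    have "is_black (pull \<alpha> t ?M b a)"
      by (rule badD(1)[OF t(2)]) (use b a o in \<open>auto simp: doubleton_eq_iff\<close>)
    moreover have "b < \<alpha>" using b(1) o by auto
    ultimately show ?thesis using a(1) b(2) by (simp add: pull_def)
  qed
  have d: "det (t a)" and hb: "is_black (h (\<lambda>_. Grey) (t a))" if "a < \<alpha>" "a \<noteq> ?o0" "a \<noteq> ?o1" for a
  proof -
    show "is_black (h (\<lambda>_. Grey) (t a))" using black[OF that] t_lt[OF that] by (simp add: adjoin_simps)
    then show "det (t a)" by (auto simp: h_def split: if_splits)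
  qed
  have sub: "{y. y < e \<and> \<not> det y} \<subseteq> insert y0 ({..<?b} - t ` {..<\<alpha>})"
  proof
    fix y assume y: "y \<in> {y. y < e \<and> \<not> det y}"
    have "y = y0" if "y = t a" "a < \<alpha>" for a
    proof -
      have "a = ?o0 \<or> a = ?o1" using d[of a] y that by auto
      then have "y \<in> {t ?o0, t ?o1}" using that by auto
      then have "y \<in> {e, y0}" unfolding y0(3) .
      then show ?thesis using y by auto
    qed
    moreover have "y < ?b" using y by (simp add: less_ord_plus_Suc)
    ultimately show "y \<in> insert y0 ({..<?b} - t ` {..<\<alpha>})" by blast
  qed
  note C = card_co_image_fv[OF t(1) inj]
  show "finite {y. y < e \<and> \<not> det y}" using finite_subset[OF sub] C(1) by simp
  have "card {y. y < e \<and> \<not> det y} \<le> card (insert y0 ({..<?b} - t ` {..<\<alpha>}))"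
    by (rule card_mono[OF _ sub]) (use C(1) in simp)
  also have "\<dots> \<le> Suc (card ({..<?b} - t ` {..<\<alpha>}))" using C(1) by (simp add: card_insert_if)
  finally show "card {y. y < e \<and> \<not> det y} \<le> n + 2" unfolding C(2) by simp
  show "is_black (N' i l1) \<or> is_black (N' i l2)"
    if l: "l1 < \<alpha>" "l2 < \<alpha>" "l1 \<noteq> i" "l2 \<noteq> i" "l1 \<noteq> l2"
  proof (rule ccontr)
    assume nb: "\<not> ?thesis"
    define u where "u a = (if a = ?o0 then l1 else if a = ?o1 then l2
      else if t a = s a \<and> a \<noteq> i then a else src (t a))" for a
    have 01: "?o0 \<noteq> ?o1" by simp
    have u: "u a < \<alpha>" "u a \<noteq> i" "N (t a) (s (u a)) = Same" if "a < \<alpha>" "a \<noteq> ?o0" "a \<noteq> ?o1" for a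
      using src[OF d[OF that]] that graphD(3)[OF graphs(1)] by (auto simp: u_def)
    have ub: "is_black (N' i (u a))" if "a < \<alpha>" "a \<noteq> ?o0" "a \<noteq> ?o1" for a
      using hb[OF that] h_det[OF t_lt[OF that] u[OF that]] by simp
    have "fv \<alpha> \<alpha> u"
    proof -
      have "{a. a < \<alpha> \<and> u a \<noteq> a} \<subseteq> {a. a < \<alpha> \<and> t a \<noteq> a} \<union> {a. a < \<alpha> \<and> s a \<noteq> a} \<union> {i, ?o0, ?o1}"
        by (auto simp: u_def split: if_splits)
      then have "finite {a. a < \<alpha> \<and> u a \<noteq> a}"
        using t(1) s by (elim finite_subset) (simp add: fv_def)
      moreover have "u a < \<alpha>" if "a < \<alpha>" for a
        using u(1)[OF that] l by (cases "a = ?o0 \<or> a = ?o1") (auto simp: u_def)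
      ultimately show ?thesis by (simp add: fv_def)
    qed
    moreover have "inj_on u {..<\<alpha>}"
    proof (rule inj_onI, rule ccontr)
      fix a b assume ab: "a \<in> {..<\<alpha>}" "b \<in> {..<\<alpha>}" "u a = u b" "a \<noteq> b"
      have u01: "u ?o0 = l1" "u ?o1 = l2" by (simp_all add: u_def)
      have other: False if "c < \<alpha>" "c \<noteq> ?o0" "c \<noteq> ?o1" "u c = l1 \<or> u c = l2" for c
        using ub[OF that(1-3)] that(4) nb by auto
      consider "a = ?o0 \<or> a = ?o1" "b = ?o0 \<or> b = ?o1" | "a \<noteq> ?o0" "a \<noteq> ?o1" "b = ?o0 \<or> b = ?o1"
        | "a = ?o0 \<or> a = ?o1" "b \<noteq> ?o0" "b \<noteq> ?o1" | "a \<noteq> ?o0" "a \<noteq> ?o1" "b \<noteq> ?o0" "b \<noteq> ?o1" by blast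
      then show False
      proof cases
        case 1
        then show False using ab u01 l(5) by auto
      next
        case 2
        then show False using other[of a] ab u01 by auto
      next
        case 3
        then show False using other[of b] ab u01 by auto
      next
        case 4
        then have *: "N (t a) (s (u a)) = Same" "N (t b) (s (u a)) = Same" "t a < e" "t b < e" "u a < \<alpha>"
          using u[of a] u[of b] ab t_lt by auto
        then have "N (s (u a)) (t b) = Same" using graphD(2)[OF graphs(1)] by metis
        then have "N (t a) (t b) = Same"
          using graphD(4)[OF graphs(1) *(3) s_less[OF *(5)] *(1), of "t b"] by simp
        then have "?M (t a) (t b) = Same" using * by (simp add: adjoin_simps)
        then show False using bad_distinct(2)[OF \<alpha> G t(2), of a b] ab by auto
      qed
    qed
    ultimately obtain a where a: "a < \<alpha>" "i = u a" using surj_fv[OF _ _ i] by blast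
    have "u a \<noteq> i"
      using u(2)[OF a(1)] l by (cases "a = ?o0 \<or> a = ?o1") (auto simp: u_def)
    then show False using a by simp
  qed
qed

text \<open>The bound on \<open>r\<close> comes from the blocked case: at most n + 2 points are
  free, so at most (n + 2)^2 shades occur between them, and up to n + 2 further shades are needed to
  mark the new edges. With distinct fresh shades, one colour serves all of them.\<close>

lemma extend:
  assumes k: "k \<ge> 1" and r: "(n + 2)^2 + (n + 2) \<le> r"
  shows "\<exists>M\<in>nets \<alpha> k r (Suc n). pull e (\<lambda>a. a) M = N \<and> pull \<alpha> (s(i := e)) M = N'"
proof (cases "adjoin e (h (\<lambda>_. Grey)) N \<in> nets \<alpha> k r (Suc n)")
  case True
  then show ?thesis using adjoin_restrict adjoin_pull by blast
next
  case False
  have G: "graph (ord_plus \<alpha> (Suc n)) k r (adjoin e (h (\<lambda>_. Grey)) N)"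
    by (rule graph_extension) auto
  from ext_in_nets_or_blocked[OF G _ False] obtain t y0 where
    t: "fv \<alpha> (ord_plus \<alpha> (Suc n)) t" "bad \<alpha> (pull \<alpha> t (adjoin e (h (\<lambda>_. Grey)) N))"
      "y0 < e" "\<not> det y0" "{t (ord_nat 0), t (ord_nat 1)} = {e, y0}" by auto
  note B = blocked[OF t(1,2) G t(3,4,5)]
  let ?Y = "{y. y < e \<and> \<not> det y}"
  \<comment> \<open>At most one determined edge at the new point is not black, hence one of the colours 0 and 1 is free.\<close>
  obtain c where c: "c \<le> k" "\<And>l s. l < \<alpha> \<Longrightarrow> l \<noteq> i \<Longrightarrow> N' i l \<noteq> Colour c s"
  proof (cases "\<exists>l s. l < \<alpha> \<and> l \<noteq> i \<and> N' i l = Colour 0 s")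
    case True
    then obtain l s where l: "l < \<alpha>" "l \<noteq> i" "N' i l = Colour 0 s" by blast
    have "N' i l' \<noteq> Colour 1 s'" if "l' < \<alpha>" "l' \<noteq> i" for l' s'
      using B(3)[OF l(1) that(1) l(2) that(2)] l(3) by (cases "l = l'") auto
    then show ?thesis using that[of 1] k by blast
  qed (use that[of 0] in auto)
  \<comment> \<open>A pair without a coloured edge contributes an arbitrary shade, which is avoided
    as well and is covered by the count.\<close>
  define U where "U = (\<lambda>(y, y'). THE s. \<exists>c. N y y' = Colour c s) ` (?Y \<times> ?Y)"
  have U: "finite U" "card U \<le> (n + 2)^2"
  proof -
    show "finite U" unfolding U_def using B(2) by simp
    have "card U \<le> card (?Y \<times> ?Y)" unfolding U_def using B(2) by (intro card_image_le) simp
    also have "\<dots> \<le> (n + 2) * (n + 2)" unfolding card_cartesian_product by (intro mult_mono B(1)) auto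
    finally show "card U \<le> (n + 2)^2" by (simp add: power2_eq_square)
  qed
  have in_U: "s \<in> U" if "y \<in> ?Y" "y' \<in> ?Y" "N y y' = Colour c s" for y y' c s
  proof -
    have "(THE s. \<exists>c. N y y' = Colour c s) = s" using that(3) by auto
    then show ?thesis unfolding U_def using that(1,2) by force
  qed
  have "card {..r} - card U \<le> card ({..r} - U)" by (rule diff_card_le_card_Diff[OF U(1)])
  then have "card ?Y \<le> card ({..r} - U)" using B(1) U(2) r by simp
  then obtain F where F: "F ` ?Y \<subseteq> {..r} - U" "inj_on F ?Y"
    using card_le_inj[OF B(2), of "{..r} - U"] by auto
  \<comment> \<open>Points joined by \<open>Same\<close> must receive the same label, so the shade
    is chosen for the least member of their class.\<close>
  define rep where "rep y = (LEAST z. N y z = Same)" for y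
  have rep: "N y (rep y) = Same" "rep y \<in> ?Y" if "y \<in> ?Y" for y
  proof -
    show *: "N y (rep y) = Same" unfolding rep_def by (rule LeastI[of _ y]) (rule graphD(3)[OF graphs(1)])
    have "rep y \<le> y" unfolding rep_def by (rule Least_le) (rule graphD(3)[OF graphs(1)])
    moreover have "N (rep y) y = Same" using * graphD(2)[OF graphs(1)] by simp
    ultimately show "rep y \<in> ?Y" using that det_cong(1)[of "rep y" y] le_less_trans[of "rep y" y e] by auto
  qed
  have rep_eq: "rep y = rep y'" if "y \<in> ?Y" "y' \<in> ?Y" "N y y' = Same" for y y'
    using graphD(4)[OF graphs(1) _ _ that(3)] that by (simp add: rep_def)
  define g where "g y = Colour c (F (rep y))" for y
  have gG: "graph (ord_plus \<alpha> (Suc n)) k r (adjoin e (h g) N)"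
  proof (rule graph_extension)
    fix y assume "y < e" "\<not> det y"
    then have "F (rep y) \<in> {..r} - U" using F(1) rep(2)[of y] by blast
    then show "g y = Grey \<or> (\<exists>c s. g y = Colour c s \<and> c \<le> k \<and> s \<le> r)" using c(1) by (auto simp: g_def)
  next
    fix y y' assume "y < e" "y' < e" "\<not> det y" "\<not> det y'" "N y y' = Same"
    then show "g y = g y'" using rep_eq[of y y'] by (simp add: g_def)
  next
    fix y c' s s' l assume "g y = Colour c' s" "l < \<alpha>" "l \<noteq> i"
    then show "N' i l \<noteq> Colour c' s'" using c(2) by (simp add: g_def)
  next
    fix y y' c' s s' s''
    assume y: "y < e" "y' < e" "\<not> det y" "\<not> det y'" "g y = Colour c' s" "g y' = Colour c' s'" "N y y' = Colour c' s''"
    then have Y: "y \<in> ?Y" "y' \<in> ?Y" by auto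
    have "s'' \<in> U" by (rule in_U[OF Y y(7)])
    moreover have "s \<notin> U" "s' \<notin> U" using F(1) rep(2)[OF Y(1)] rep(2)[OF Y(2)] y(5,6) by (auto simp: g_def)
    moreover have "rep y \<noteq> rep y'"
    proof
      assume eq: "rep y = rep y'"
      have "N (rep y) y' = Same" using rep(1)[OF Y(2)] eq graphD(2)[OF graphs(1)] by simp
      then have "N y y' = Same"
        using graphD(4)[OF graphs(1) y(1) _ rep(1)[OF Y(1)], of y'] rep(2)[OF Y(1)] by simp
      then show False using y(7) by simp
    qed
    then have "s \<noteq> s'" using inj_onD[OF F(2) _ rep(2)[OF Y(1)] rep(2)[OF Y(2)]] y(5,6) by (auto simp: g_def)
    ultimately show "s \<noteq> s' \<and> s \<noteq> s'' \<and> s' \<noteq> s''" by auto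
  qed
  have "adjoin e (h g) N \<in> nets \<alpha> k r (Suc n)"
    using ext_in_nets_or_blocked[OF gG] by (auto simp: g_def)
  then show ?thesis using adjoin_restrict adjoin_pull by blast
qed

end

text \<open>If \<open>N'\<close> identifies \<open>i\<close> with some \<open>l\<close>, the new
  point is a copy of \<open>s l\<close>. Shades are spent only in the separated case.\<close>

lemma nets_extend:
  assumes \<alpha>: "ord_nat 2 < \<alpha>" and k: "k \<ge> 1" and r: "(n + 2)^2 + (n + 2) \<le> r"
    and N: "N \<in> nets \<alpha> k r n" and N': "N' \<in> nets \<alpha> k r 0"
    and s: "fv \<alpha> (ord_plus \<alpha> n) s" and i: "i < \<alpha>" and NN': "agree i (pull \<alpha> s N) N'"
  shows "\<exists>M\<in>nets \<alpha> k r (Suc n). pull (ord_plus \<alpha> n) (\<lambda>a. a) M = N \<and> pull \<alpha> (s(i := ord_plus \<alpha> n)) M = N'"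
proof (cases "\<exists>l<\<alpha>. l \<noteq> i \<and> N' i l = Same")
  case True
  then obtain l where l: "l < \<alpha>" "l \<noteq> i" "N' i l = Same" by blast
  let ?e = "ord_plus \<alpha> n"
  let ?c = "\<lambda>x. if x = ?e then s l else x"
  let ?M = "pull (ord_plus \<alpha> (Suc n)) ?c N"
  note g = netsD(1)[OF N] and g' = netsD(1)[OF N', simplified]
  have s_lt: "s a < ?e" "s a \<noteq> ?e" if "a < \<alpha>" for a using s that by (auto simp: fv_def)
  have "?M \<in> nets \<alpha> k r (Suc n)" by (rule nets_pull[OF N fv_collapse[OF s_lt(1)[OF l(1)]]])
  moreover have "pull ?e (\<lambda>a. a) ?M = N"
    using graphD(1)[OF g] by (auto simp: pull_def fun_eq_iff less_ord_plus_Suc)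
  moreover have "pull \<alpha> (s(i := ?e)) ?M = N'"
  proof (intro ext)
    fix a b
    have eq: "N' a b = N (s a) (s b)" if "a < \<alpha>" "b < \<alpha>" "a \<noteq> i" "b \<noteq> i" for a b
      using NN'[unfolded agree_def pull_def, rule_format, of a b] that by simp
    have Ni: "N' i b = N' l b" for b using graphD(4)[OF g' i l(1,3)] .
    show "pull \<alpha> (s(i := ?e)) ?M a b = N' a b"
    proof (cases "a < \<alpha> \<and> b < \<alpha>")
      case True
      then show ?thesis
        using Ni eq[of a b] eq[of l b] eq[of a l] l s_lt graphD(2)[OF g', of a i] graphD(2)[OF g', of a l]
          graphD(3)[OF g'] graphD(3)[OF g]
        by (auto simp: pull_def less_ord_plus_Suc)
    qed (use graphD(1)[OF g', of a b] in \<open>auto simp: pull_def\<close>)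
  qed
  ultimately show ?thesis by blast
next
  case False
  then interpret extension \<alpha> k r n N N' s i
    using assms by unfold_locales auto
  show ?thesis by (rule extend[OF k r])
qed

section \<open>Ultrafilters of cylindric algebras\<close>

locale cyl_algebra =
  fixes \<beta> :: "'i::wellorder" and B :: "('i, 'b) cyl_alg"
  assumes CA: "B \<in> CA \<beta>"
begin

abbreviation C where "C \<equiv> carrier B"
abbreviation mt (infixl "\<sqinter>" 70) where "x \<sqinter> y \<equiv> meet B x y"
abbreviation jn (infixl "\<squnion>" 65) where "x \<squnion> y \<equiv> join B x y"
abbreviation neg where "neg x \<equiv> compl B x"
abbreviation c where "c i x \<equiv> cyl B i x"
abbreviation d where "d i j \<equiv> diag B i j"

lemma cyl_type: "cyl_type \<beta> B" using CA by (simp add: CA_def)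

lemma closed [simp, intro]:
  "x \<in> C \<Longrightarrow> y \<in> C \<Longrightarrow> x \<squnion> y \<in> C" "x \<in> C \<Longrightarrow> y \<in> C \<Longrightarrow> x \<sqinter> y \<in> C" "x \<in> C \<Longrightarrow> neg x \<in> C"
  "zer B \<in> C" "one B \<in> C" "i < \<beta> \<Longrightarrow> x \<in> C \<Longrightarrow> c i x \<in> C" "i < \<beta> \<Longrightarrow> j < \<beta> \<Longrightarrow> d i j \<in> C"
  using cyl_type by (simp_all add: cyl_type_def)

lemma ba: "boolean_axioms B" using CA by (simp add: CA_def)

lemma comm: "x \<in> C \<Longrightarrow> y \<in> C \<Longrightarrow> x \<squnion> y = y \<squnion> x" "x \<in> C \<Longrightarrow> y \<in> C \<Longrightarrow> x \<sqinter> y = y \<sqinter> x"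
  using ba unfolding boolean_axioms_def by blast+

lemma dist:
  "x \<in> C \<Longrightarrow> y \<in> C \<Longrightarrow> z \<in> C \<Longrightarrow> x \<squnion> (y \<sqinter> z) = (x \<squnion> y) \<sqinter> (x \<squnion> z)"
  "x \<in> C \<Longrightarrow> y \<in> C \<Longrightarrow> z \<in> C \<Longrightarrow> x \<sqinter> (y \<squnion> z) = (x \<sqinter> y) \<squnion> (x \<sqinter> z)"
  using ba unfolding boolean_axioms_def by blast+

lemma unit: "x \<in> C \<Longrightarrow> x \<squnion> zer B = x" "x \<in> C \<Longrightarrow> x \<sqinter> one B = x"
  "x \<in> C \<Longrightarrow> x \<squnion> neg x = one B" "x \<in> C \<Longrightarrow> x \<sqinter> neg x = zer B"
  using ba unfolding boolean_axioms_def by blast+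

lemma meet_idem: assumes "x \<in> C" shows "x \<sqinter> x = x"
proof -
  have "x = x \<sqinter> (x \<squnion> neg x)" using assms by (simp add: unit)
  also have "\<dots> = (x \<sqinter> x) \<squnion> (x \<sqinter> neg x)" using assms by (simp only: dist(2) closed)
  also have "\<dots> = x \<sqinter> x" using assms by (simp add: unit)
  finally show ?thesis by simp
qed

lemma meet_zer: assumes "x \<in> C" shows "x \<sqinter> zer B = zer B"
proof -
  have "x \<sqinter> zer B = (x \<sqinter> neg x) \<squnion> (x \<sqinter> zer B)" using assms by (simp add: unit comm(1)[of "zer B"])
  also have "\<dots> = x \<sqinter> (neg x \<squnion> zer B)" using assms by (simp only: dist(2) closed)
  also have "\<dots> = zer B" using assms by (simp add: unit)
  finally show ?thesis .
qed

lemma join_one: assumes "x \<in> C" shows "x \<squnion> one B = one B"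
proof -
  have "x \<squnion> one B = (x \<squnion> neg x) \<sqinter> (x \<squnion> one B)" using assms by (simp add: unit comm(2)[of "one B"])
  also have "\<dots> = x \<squnion> (neg x \<sqinter> one B)" using assms by (simp only: dist(1) closed)
  also have "\<dots> = one B" using assms by (simp add: unit)
  finally show ?thesis .
qed

lemma absorb: assumes "x \<in> C" "y \<in> C" shows "x \<sqinter> (x \<squnion> y) = x" "x \<squnion> (x \<sqinter> y) = x"
proof -
  have "x \<sqinter> (x \<squnion> y) = (x \<squnion> zer B) \<sqinter> (x \<squnion> y)" using assms by (simp add: unit)
  also have "\<dots> = x \<squnion> (zer B \<sqinter> y)" using assms by (simp only: dist(1) closed)
  also have "\<dots> = x" using assms by (simp add: comm(2)[of "zer B"] meet_zer unit)
  finally show "x \<sqinter> (x \<squnion> y) = x" .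
  have "x \<squnion> (x \<sqinter> y) = (x \<sqinter> one B) \<squnion> (x \<sqinter> y)" using assms by (simp add: unit)
  also have "\<dots> = x \<sqinter> (one B \<squnion> y)" using assms by (simp only: dist(2) closed)
  also have "\<dots> = x" using assms by (simp add: comm(1)[of "one B"] join_one unit)
  finally show "x \<squnion> (x \<sqinter> y) = x" .
qed

text \<open>Associativity is not among the axioms (these are Huntington's). Both sides have the same
  join with \<open>x\<close> and the same join with \<open>neg x\<close>, and any element is the
  meet of its joins with these two.\<close>

lemma meet_assoc:
  assumes x: "x \<in> C" and y: "y \<in> C" and z: "z \<in> C"
  shows "(x \<sqinter> y) \<sqinter> z = x \<sqinter> (y \<sqinter> z)"
proof -
  let ?L = "x \<sqinter> (y \<sqinter> z)" and ?R = "(x \<sqinter> y) \<sqinter> z"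
  note [simp] = x y z
  have 1: "x \<squnion> ?L = x \<squnion> ?R"
  proof -
    have "x \<squnion> ?R = (x \<squnion> (x \<sqinter> y)) \<sqinter> (x \<squnion> z)" by (simp only: dist(1) closed x y z)
    then show ?thesis by (simp add: absorb)
  qed
  have 2: "neg x \<squnion> ?L = neg x \<squnion> ?R"
  proof -
    have n: "neg x \<squnion> x = one B" by (simp add: comm(1)[of "neg x"] unit)
    have o: "one B \<sqinter> w = w" if "w \<in> C" for w using that by (simp add: comm(2)[of "one B"] unit)
    have "neg x \<squnion> ?L = (neg x \<squnion> x) \<sqinter> (neg x \<squnion> (y \<sqinter> z))" by (simp only: dist(1) closed x y z)
    also have "\<dots> = neg x \<squnion> (y \<sqinter> z)" by (simp add: n o)
    finally have L: "neg x \<squnion> ?L = (neg x \<squnion> y) \<sqinter> (neg x \<squnion> z)" by (simp only: dist(1) closed x y z)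
    have "neg x \<squnion> ?R = ((neg x \<squnion> x) \<sqinter> (neg x \<squnion> y)) \<sqinter> (neg x \<squnion> z)" by (simp only: dist(1) closed x y z)
    also have "\<dots> = (neg x \<squnion> y) \<sqinter> (neg x \<squnion> z)" by (simp add: n o)
    finally show ?thesis using L by simp
  qed
  have split: "w = (w \<squnion> x) \<sqinter> (w \<squnion> neg x)" if "w \<in> C" for w
  proof -
    have "w = w \<squnion> (x \<sqinter> neg x)" using that by (simp add: unit)
    then show ?thesis using that by (simp only: dist(1) closed x)
  qed
  have "?L = (x \<squnion> ?L) \<sqinter> (neg x \<squnion> ?L)" using split[of ?L] by (simp add: comm(1)[of ?L])
  also have "\<dots> = (x \<squnion> ?R) \<sqinter> (neg x \<squnion> ?R)" using 1 2 by simp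
  also have "\<dots> = ?R" using split[of ?R] by (simp add: comm(1)[of ?R])
  finally show ?thesis by simp
qed

definition prop_filter :: "'b set \<Rightarrow> bool" where
  "prop_filter F \<longleftrightarrow> F \<subseteq> C \<and> one B \<in> F \<and> zer B \<notin> F \<and> (\<forall>x\<in>F. \<forall>y\<in>F. x \<sqinter> y \<in> F) \<and>
     (\<forall>x\<in>F. \<forall>y\<in>C. x \<sqinter> y = x \<longrightarrow> y \<in> F)"

text \<open>Ultrafilters, as two-valued homomorphisms; the values of \<phi> outside the carrier are
  free.\<close>

definition st :: "('b \<Rightarrow> bool) \<Rightarrow> bool" where
  "st \<phi> \<longleftrightarrow> (\<forall>x\<in>C. \<forall>y\<in>C. \<phi> (x \<sqinter> y) = (\<phi> x \<and> \<phi> y) \<and> \<phi> (x \<squnion> y) = (\<phi> x \<or> \<phi> y)) \<and>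
     (\<forall>x\<in>C. \<phi> (neg x) = (\<not> \<phi> x))"

lemma stD:
  assumes "st \<phi>"
  shows "x \<in> C \<Longrightarrow> y \<in> C \<Longrightarrow> \<phi> (x \<sqinter> y) \<longleftrightarrow> \<phi> x \<and> \<phi> y"
    "x \<in> C \<Longrightarrow> y \<in> C \<Longrightarrow> \<phi> (x \<squnion> y) \<longleftrightarrow> \<phi> x \<or> \<phi> y" "x \<in> C \<Longrightarrow> \<phi> (neg x) \<longleftrightarrow> \<not> \<phi> x"
    "\<not> \<phi> (zer B)" "\<phi> (one B)"
proof -
  show 1: "x \<in> C \<Longrightarrow> y \<in> C \<Longrightarrow> \<phi> (x \<sqinter> y) \<longleftrightarrow> \<phi> x \<and> \<phi> y"
    "x \<in> C \<Longrightarrow> y \<in> C \<Longrightarrow> \<phi> (x \<squnion> y) \<longleftrightarrow> \<phi> x \<or> \<phi> y" "x \<in> C \<Longrightarrow> \<phi> (neg x) \<longleftrightarrow> \<not> \<phi> x" for x y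
    using assms by (auto simp: st_def)
  show "\<not> \<phi> (zer B)" "\<phi> (one B)"
    using 1(1,2)[of "zer B" "neg (zer B)"] 1(3)[of "zer B"] unit(3,4)[of "zer B"] by auto
qed

lemma ultrafilter_exists:
  assumes F: "prop_filter F"
  shows "\<exists>\<phi>. st \<phi> \<and> (\<forall>x\<in>F. \<phi> x)"
proof -
  let ?A = "{G. prop_filter G \<and> F \<subseteq> G}"
  have "\<exists>M\<in>?A. \<forall>X\<in>?A. M \<subseteq> X \<longrightarrow> X = M"
  proof (rule subset_Zorn_nonempty)
    show "?A \<noteq> {}" using F by blast
  next
    fix K assume ne: "K \<noteq> {}" and K: "subset.chain ?A K"
    have p: "prop_filter X" "F \<subseteq> X" if "X \<in> K" for X using K that by (auto simp: subset.chain_def)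
    have "prop_filter (\<Union>K)"
      unfolding prop_filter_def
    proof (intro conjI ballI impI)
      show "\<Union>K \<subseteq> C" "one B \<in> \<Union>K" "zer B \<notin> \<Union>K" using p ne unfolding prop_filter_def by blast+
    next
      fix x y assume "x \<in> \<Union>K" "y \<in> \<Union>K"
      then obtain X Y where XY: "X \<in> K" "Y \<in> K" "x \<in> X" "y \<in> Y" by blast
      have "X \<subseteq> Y \<or> Y \<subseteq> X" using K XY(1,2) unfolding subset.chain_def by blast
      then obtain Z where "Z \<in> K" "x \<in> Z" "y \<in> Z" using XY by blast
      then show "x \<sqinter> y \<in> \<Union>K" using p unfolding prop_filter_def by blast
    next
      fix x y assume "x \<in> \<Union>K" "y \<in> C" "x \<sqinter> y = x"
      then show "y \<in> \<Union>K" using p unfolding prop_filter_def by blast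
    qed
    then show "\<Union>K \<in> ?A" using p ne by blast
  qed
  then obtain M where "M \<in> ?A" and max': "\<forall>X\<in>?A. M \<subseteq> X \<longrightarrow> X = M" by (elim bexE)
  then have M: "prop_filter M" "F \<subseteq> M" by simp_all
  have max: "X = M" if "prop_filter X" "M \<subseteq> X" for X using max' that M(2) by auto
  have MC: "\<And>x. x \<in> M \<Longrightarrow> x \<in> C" "one B \<in> M" "zer B \<notin> M" "\<And>x y. x \<in> M \<Longrightarrow> y \<in> M \<Longrightarrow> x \<sqinter> y \<in> M"
    "\<And>x y. x \<in> M \<Longrightarrow> y \<in> C \<Longrightarrow> x \<sqinter> y = x \<Longrightarrow> y \<in> M"
    using M(1) by (auto simp: prop_filter_def)
  have up: "y \<in> M" if "x \<sqinter> y \<in> M" "x \<in> C" "y \<in> C" for x y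
    using MC(5)[OF that(1,3)] that meet_assoc[of x y y] meet_idem[of y] by simp
  have ultra: "x \<in> M \<or> neg x \<in> M" if x: "x \<in> C" for x
  proof (rule ccontr)
    assume n: "\<not> ?thesis"
    \<comment> \<open>The filter generated by \<open>M\<close> and \<open>x\<close>. It is proper,
      since an \<open>f\<close> in \<open>M\<close> disjoint from \<open>x\<close> lies below
      \<open>neg x\<close> and would put \<open>neg x\<close> into \<open>M\<close>.\<close>
    define G where "G = {y \<in> C. \<exists>f\<in>M. (f \<sqinter> x) \<sqinter> y = f \<sqinter> x}"
    have "f \<sqinter> x \<noteq> zer B" if f: "f \<in> M" for f
    proof
      assume 0: "f \<sqinter> x = zer B"
      have fC: "f \<in> C" using MC(1) f .
      have "f = f \<sqinter> (x \<squnion> neg x)" using fC x by (simp add: unit)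
      also have "\<dots> = (f \<sqinter> neg x) \<squnion> (f \<sqinter> x)" using fC x by (simp add: dist(2) comm(1)[of "f \<sqinter> x"])
      also have "\<dots> = f \<sqinter> neg x" using 0 fC x by (simp add: unit)
      finally have "f \<sqinter> neg x = f" by simp
      then show False using MC(5)[OF f] x n by blast
    qed
    note ne = this
    have "prop_filter G"
      unfolding prop_filter_def
    proof (intro conjI ballI impI)
      show "G \<subseteq> C" by (auto simp: G_def)
      show "one B \<in> G" unfolding G_def using MC(1,2) x by (auto simp: unit)
      show "zer B \<notin> G"
      proof
        assume "zer B \<in> G"
        then obtain f where f: "f \<in> M" "(f \<sqinter> x) \<sqinter> zer B = f \<sqinter> x" by (auto simp: G_def)
        then show False using ne[OF f(1)] meet_zer[of "f \<sqinter> x"] MC(1)[OF f(1)] x by simp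
      qed
    next
      fix y z assume "y \<in> G" "z \<in> G"
      then obtain f g where fg: "y \<in> C" "z \<in> C" "f \<in> M" "g \<in> M" "(f \<sqinter> x) \<sqinter> y = f \<sqinter> x" "(g \<sqinter> x) \<sqinter> z = g \<sqinter> x"
        by (auto simp: G_def)
      let ?h = "f \<sqinter> g"
      note [simp] = MC(1)[OF fg(3)] MC(1)[OF fg(4)] fg(1,2) x
      have h1: "?h \<sqinter> x = g \<sqinter> (f \<sqinter> x)" by (simp add: comm(2)[of f g] meet_assoc)
      have h2: "?h \<sqinter> x = f \<sqinter> (g \<sqinter> x)" by (simp add: meet_assoc)
      have "(?h \<sqinter> x) \<sqinter> y = ?h \<sqinter> x" unfolding h1 using fg(5) by (simp add: meet_assoc)
      moreover have "(?h \<sqinter> x) \<sqinter> z = ?h \<sqinter> x" unfolding h2 using fg(6) by (simp add: meet_assoc)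
      ultimately have "(?h \<sqinter> x) \<sqinter> (y \<sqinter> z) = ?h \<sqinter> x"
        using meet_assoc[of "?h \<sqinter> x" y z] by simp
      then show "y \<sqinter> z \<in> G" unfolding G_def using MC(4)[OF fg(3,4)] by auto
    next
      fix y z assume "y \<in> G" and z: "z \<in> C" "y \<sqinter> z = y"
      then obtain f where f: "y \<in> C" "f \<in> M" "(f \<sqinter> x) \<sqinter> y = f \<sqinter> x" by (auto simp: G_def)
      then have "(f \<sqinter> x) \<sqinter> z = f \<sqinter> x"
        using meet_assoc[of "f \<sqinter> x" y z] MC(1)[OF f(2)] x z by simp
      then show "z \<in> G" unfolding G_def using f z by auto
    qed
    moreover have "M \<subseteq> G"
    proof
      fix f assume f: "f \<in> M"
      have "(f \<sqinter> x) \<sqinter> f = f \<sqinter> x"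
        using MC(1)[OF f] x by (metis closed(2) comm(2) meet_assoc meet_idem)
      then show "f \<in> G" unfolding G_def using f MC(1) by blast
    qed
    moreover have "x \<in> G"
      unfolding G_def using MC(1,2) x meet_assoc[of "one B" x x] by (auto simp: meet_idem)
    ultimately show False using max n by blast
  qed
  have "st (\<lambda>x. x \<in> M)"
    unfolding st_def
  proof (intro conjI ballI)
    fix x assume x: "x \<in> C"
    show "(neg x \<in> M) = (x \<notin> M)" using ultra[OF x] MC(3,4) unit(4)[OF x] by metis
    fix y assume y: "y \<in> C"
    show m: "(x \<sqinter> y \<in> M) = (x \<in> M \<and> y \<in> M)"
      using up[of x y] up[of y x] comm(2)[OF x y] MC(4) x y by auto
    show "(x \<squnion> y \<in> M) = (x \<in> M \<or> y \<in> M)"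
    proof
      assume j: "x \<squnion> y \<in> M"
      show "x \<in> M \<or> y \<in> M"
      proof (rule ccontr)
        assume n: "\<not> ?thesis"
        then have "neg x \<in> M" using ultra[OF x] by blast
        then have "neg x \<sqinter> (x \<squnion> y) \<in> M" using MC(4) j by blast
        moreover have "neg x \<sqinter> (x \<squnion> y) = neg x \<sqinter> y"
          using x y by (simp add: dist(2) comm(2)[of "neg x" x] unit comm(1)[of "zer B"])
        ultimately show False using up[of "neg x" y] x y n by simp
      qed
    next
      assume "x \<in> M \<or> y \<in> M"
      then show "x \<squnion> y \<in> M"
        using MC(5)[of x "x \<squnion> y"] MC(5)[of y "x \<squnion> y"] absorb(1)[OF x y] absorb(1)[OF y x] comm(1)[OF x y] x y
        by auto
    qed
  qed
  then show ?thesis using M(2) by blast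
qed

lemma state_exists:
  assumes x: "x \<in> C" "x \<noteq> zer B"
  shows "\<exists>\<phi>. st \<phi> \<and> \<phi> x"
proof -
  have "prop_filter {y \<in> C. x \<sqinter> y = x}"
    unfolding prop_filter_def
  proof (intro conjI ballI impI)
    fix y z assume "y \<in> {y \<in> C. x \<sqinter> y = x}" "z \<in> {y \<in> C. x \<sqinter> y = x}"
    then show "y \<sqinter> z \<in> {y \<in> C. x \<sqinter> y = x}" using x meet_assoc[of x y z] by simp
  next
    fix y z assume "y \<in> {y \<in> C. x \<sqinter> y = x}" "z \<in> C" "y \<sqinter> z = y"
    then show "z \<in> {y \<in> C. x \<sqinter> y = x}" using x meet_assoc[of x y z] by simp
  next
    show "one B \<in> {y \<in> C. x \<sqinter> y = x}" using unit(2)[OF x(1)] by simp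
    show "zer B \<notin> {y \<in> C. x \<sqinter> y = x}" using meet_zer[OF x(1)] x(2) by simp
  qed blast
  from ultrafilter_exists[OF this] show ?thesis using x meet_idem[of x] by blast
qed

subsection \<open>Cylindrifications and substitutions\<close>

lemma cyl_axioms:
  "i < \<beta> \<Longrightarrow> c i (zer B) = zer B"
  "i < \<beta> \<Longrightarrow> x \<in> C \<Longrightarrow> x \<squnion> c i x = c i x"
  "i < \<beta> \<Longrightarrow> x \<in> C \<Longrightarrow> y \<in> C \<Longrightarrow> c i (x \<sqinter> c i y) = c i x \<sqinter> c i y"
  "i < \<beta> \<Longrightarrow> j < \<beta> \<Longrightarrow> x \<in> C \<Longrightarrow> c i (c j x) = c j (c i x)"
  "i < \<beta> \<Longrightarrow> d i i = one B"
  "i < \<beta> \<Longrightarrow> j < \<beta> \<Longrightarrow> l < \<beta> \<Longrightarrow> l \<noteq> i \<Longrightarrow> l \<noteq> j \<Longrightarrow> d i j = c l (d i l \<sqinter> d l j)"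
  "i < \<beta> \<Longrightarrow> j < \<beta> \<Longrightarrow> i \<noteq> j \<Longrightarrow> x \<in> C \<Longrightarrow> c i (d i j \<sqinter> x) \<sqinter> c i (d i j \<sqinter> neg x) = zer B"
proof -
  have A: "\<forall>i<\<beta>. c i (zer B) = zer B" "\<forall>i<\<beta>. \<forall>x\<in>C. x \<squnion> c i x = c i x"
    "\<forall>i<\<beta>. \<forall>x\<in>C. \<forall>y\<in>C. c i (x \<sqinter> c i y) = c i x \<sqinter> c i y"
    "\<forall>i<\<beta>. \<forall>j<\<beta>. \<forall>x\<in>C. c i (c j x) = c j (c i x)" "\<forall>i<\<beta>. d i i = one B"
    "\<forall>i<\<beta>. \<forall>j<\<beta>. \<forall>l<\<beta>. l \<noteq> i \<longrightarrow> l \<noteq> j \<longrightarrow> d i j = c l (d i l \<sqinter> d l j)"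
    "\<forall>i<\<beta>. \<forall>j<\<beta>. \<forall>x\<in>C. i \<noteq> j \<longrightarrow> c i (d i j \<sqinter> x) \<sqinter> c i (d i j \<sqinter> neg x) = zer B"
    using CA unfolding CA_def mem_Collect_eq by - (elim conjE, assumption)+
  show "i < \<beta> \<Longrightarrow> c i (zer B) = zer B" using A(1) by blast
  show "i < \<beta> \<Longrightarrow> x \<in> C \<Longrightarrow> x \<squnion> c i x = c i x" using A(2) by blast
  show "i < \<beta> \<Longrightarrow> x \<in> C \<Longrightarrow> y \<in> C \<Longrightarrow> c i (x \<sqinter> c i y) = c i x \<sqinter> c i y" using A(3) by blast
  show "i < \<beta> \<Longrightarrow> j < \<beta> \<Longrightarrow> x \<in> C \<Longrightarrow> c i (c j x) = c j (c i x)" using A(4) by blast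
  show "i < \<beta> \<Longrightarrow> d i i = one B" using A(5) by blast
  show "i < \<beta> \<Longrightarrow> j < \<beta> \<Longrightarrow> l < \<beta> \<Longrightarrow> l \<noteq> i \<Longrightarrow> l \<noteq> j \<Longrightarrow> d i j = c l (d i l \<sqinter> d l j)" using A(6) by blast
  show "i < \<beta> \<Longrightarrow> j < \<beta> \<Longrightarrow> i \<noteq> j \<Longrightarrow> x \<in> C \<Longrightarrow> c i (d i j \<sqinter> x) \<sqinter> c i (d i j \<sqinter> neg x) = zer B" using A(7) by blast
qed

lemma cyl_one: "i < \<beta> \<Longrightarrow> c i (one B) = one B"
  using cyl_axioms(2)[of i "one B"] comm(1)[of "one B" "c i (one B)"] join_one[of "c i (one B)"] by simp

lemma cyl_cyl: "i < \<beta> \<Longrightarrow> x \<in> C \<Longrightarrow> c i (c i x) = c i x"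
  using cyl_axioms(3)[of i "one B" x] cyl_one[of i] comm(2)[of "one B" "c i x"] unit(2)[of "c i x"] by simp

lemma closed_meet: "i < \<beta> \<Longrightarrow> x \<in> C \<Longrightarrow> y \<in> C \<Longrightarrow> c i x = x \<Longrightarrow> c i y = y \<Longrightarrow> c i (x \<sqinter> y) = x \<sqinter> y"
  using cyl_axioms(3)[of i x y] by simp

text \<open>Since \<open>x\<close> is closed, \<open>c i (neg x)\<close> is disjoint from
  \<open>x\<close>, hence lies below \<open>neg x\<close>.\<close>

lemma closed_neg:
  assumes i: "i < \<beta>" and x: "x \<in> C" "c i x = x"
  shows "c i (neg x) = neg x"
proof -
  have "c i (neg x) \<sqinter> x = zer B"
    using cyl_axioms(3)[of i "neg x" x] cyl_axioms(1) i x comm(2)[of "neg x" x] unit(4)[of x] by simp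
  then have 1: "x \<sqinter> c i (neg x) = zer B" using i x comm(2)[of "c i (neg x)" x] by simp
  have "c i (neg x) = (x \<squnion> neg x) \<sqinter> c i (neg x)" using i x comm(2)[of "one B" "c i (neg x)"] by (simp add: unit)
  also have "\<dots> = c i (neg x) \<sqinter> (x \<squnion> neg x)" using i x comm(2)[of "x \<squnion> neg x"] by simp
  also have "\<dots> = (x \<sqinter> c i (neg x)) \<squnion> (neg x \<sqinter> c i (neg x))"
    using i x by (simp only: dist(2) closed comm(2)[of x "c i (neg x)"] comm(2)[of "neg x" "c i (neg x)"])
  also have "\<dots> = neg x \<sqinter> c i (neg x)"
    unfolding 1 using i x comm(1)[of "zer B" "neg x \<sqinter> c i (neg x)"] by (simp add: unit)
  also have "\<dots> = neg x \<sqinter> (neg x \<squnion> c i (neg x))" using i x cyl_axioms(2)[of i "neg x"] by simp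
  also have "\<dots> = neg x" using i x by (simp add: absorb)
  finally show ?thesis .
qed

text \<open>The accessibility relation of \<open>c i\<close> in the canonical frame of
  \<open>B\<close>.\<close>

definition eqv :: "'i \<Rightarrow> ('b \<Rightarrow> bool) \<Rightarrow> ('b \<Rightarrow> bool) \<Rightarrow> bool" where
  "eqv i \<phi> \<psi> \<longleftrightarrow> (\<forall>y\<in>C. c i y = y \<longrightarrow> \<phi> y = \<psi> y)"

lemma eqvD: "eqv i \<phi> \<psi> \<Longrightarrow> y \<in> C \<Longrightarrow> c i y = y \<Longrightarrow> \<phi> y \<longleftrightarrow> \<psi> y"
  by (simp add: eqv_def)

lemma st_cylI: "st \<phi> \<Longrightarrow> i < \<beta> \<Longrightarrow> x \<in> C \<Longrightarrow> \<phi> x \<Longrightarrow> \<phi> (c i x)"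
  using stD(2)[of \<phi> x "c i x"] cyl_axioms(2)[of i x] by simp

text \<open>The truth lemma of the canonical frame. The i-closed elements of \<phi> together with
  \<open>w\<close> generate a proper filter, and because i-closed elements are closed under
  complement, every ultrafilter above it is i-equivalent to \<phi>.\<close>

lemma st_cyl:
  assumes \<phi>: "st \<phi>" and i: "i < \<beta>" and w: "w \<in> C"
  shows "\<phi> (c i w) \<longleftrightarrow> (\<exists>\<psi>. st \<psi> \<and> eqv i \<phi> \<psi> \<and> \<psi> w)"
proof
  assume "\<exists>\<psi>. st \<psi> \<and> eqv i \<phi> \<psi> \<and> \<psi> w"
  then obtain \<psi> where "st \<psi>" "eqv i \<phi> \<psi>" "\<psi> w" by blast
  then show "\<phi> (c i w)" using st_cylI[of \<psi> i w] eqvD[of i \<phi> \<psi> "c i w"] cyl_cyl i w by simp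
next
  assume cw: "\<phi> (c i w)"
  define F where "F = {y \<in> C. \<exists>z\<in>C. \<phi> z \<and> c i z = z \<and> (z \<sqinter> w) \<sqinter> y = z \<sqinter> w}"
  have ne: "z \<sqinter> w \<noteq> zer B" if "z \<in> C" "\<phi> z" "c i z = z" for z
  proof
    assume 0: "z \<sqinter> w = zer B"
    have "c i w \<sqinter> z = c i (w \<sqinter> z)" using cyl_axioms(3)[of i w z] i w that by simp
    also have "\<dots> = zer B" using 0 comm(2)[of z w] that w cyl_axioms(1)[OF i] by simp
    finally show False using stD(1)[OF \<phi>, of "c i w" z] stD(4)[OF \<phi>] cw that i w by simp
  qed
  have "prop_filter F"
    unfolding prop_filter_def
  proof (intro conjI ballI impI)
    show "F \<subseteq> C" by (auto simp: F_def)
    show "one B \<in> F" unfolding F_def using stD(5)[OF \<phi>] cyl_one[OF i] w by (auto simp: unit)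
    show "zer B \<notin> F"
    proof
      assume "zer B \<in> F"
      then obtain z where z: "z \<in> C" "\<phi> z" "c i z = z" "(z \<sqinter> w) \<sqinter> zer B = z \<sqinter> w" by (auto simp: F_def)
      then show False using ne[of z] meet_zer[of "z \<sqinter> w"] w by simp
    qed
  next
    fix y y' assume "y \<in> F" "y' \<in> F"
    then obtain z z' where z: "y \<in> C" "y' \<in> C" "z \<in> C" "z' \<in> C" "\<phi> z" "\<phi> z'" "c i z = z" "c i z' = z'"
      "(z \<sqinter> w) \<sqinter> y = z \<sqinter> w" "(z' \<sqinter> w) \<sqinter> y' = z' \<sqinter> w" by (auto simp: F_def)
    let ?h = "z \<sqinter> z'"
    note [simp] = z(1-4) w
    have h1: "?h \<sqinter> w = z' \<sqinter> (z \<sqinter> w)" by (simp add: comm(2)[of z z'] meet_assoc)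
    have h2: "?h \<sqinter> w = z \<sqinter> (z' \<sqinter> w)" by (simp add: meet_assoc)
    have "(?h \<sqinter> w) \<sqinter> y = ?h \<sqinter> w" unfolding h1 using z(9) by (simp add: meet_assoc)
    moreover have "(?h \<sqinter> w) \<sqinter> y' = ?h \<sqinter> w" unfolding h2 using z(10) by (simp add: meet_assoc)
    ultimately have "(?h \<sqinter> w) \<sqinter> (y \<sqinter> y') = ?h \<sqinter> w"
      using meet_assoc[of "?h \<sqinter> w" y y'] by simp
    moreover have "\<phi> ?h" "c i ?h = ?h" using stD(1)[OF \<phi>] closed_meet[OF i] z by simp_all
    ultimately show "y \<sqinter> y' \<in> F" unfolding F_def using z by auto
  next
    fix y y' assume "y \<in> F" and y': "y' \<in> C" "y \<sqinter> y' = y"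
    then obtain z where z: "y \<in> C" "z \<in> C" "\<phi> z" "c i z = z" "(z \<sqinter> w) \<sqinter> y = z \<sqinter> w" by (auto simp: F_def)
    then have "(z \<sqinter> w) \<sqinter> y' = z \<sqinter> w" using meet_assoc[of "z \<sqinter> w" y y'] w y' by simp
    then show "y' \<in> F" unfolding F_def using z y' by auto
  qed
  from ultrafilter_exists[OF this] obtain \<psi> where \<psi>: "st \<psi>" "\<And>x. x \<in> F \<Longrightarrow> \<psi> x" by blast
  have "w \<in> F"
    unfolding F_def using w stD(5)[OF \<phi>] cyl_one[OF i] meet_assoc[of "one B" w w] by (auto simp: meet_idem)
  then have "\<psi> w" by (rule \<psi>(2))
  have F: "\<psi> y" if "y \<in> C" "c i y = y" "\<phi> y" for y
  proof -
    have "(y \<sqinter> w) \<sqinter> y = y \<sqinter> w" using that(1) w by (metis closed(2) comm(2) meet_assoc meet_idem)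
    then have "y \<in> F" unfolding F_def using that by auto
    then show ?thesis by (rule \<psi>(2))
  qed
  have "eqv i \<phi> \<psi>"
    unfolding eqv_def
  proof (intro ballI impI)
    fix y assume y: "y \<in> C" "c i y = y"
    show "\<phi> y = \<psi> y"
      using F[OF y] F[of "neg y"] y closed_neg[OF i y] stD(3)[OF \<phi> y(1)] stD(3)[OF \<psi>(1) y(1)] by auto
  qed
  with \<psi>(1) \<open>\<psi> w\<close> show "\<exists>\<psi>. st \<psi> \<and> eqv i \<phi> \<psi> \<and> \<psi> w" by blast
qed

text \<open>The usual substitution operator of cylindric algebras, which reads \<open>x\<close> with
  coordinate \<open>i\<close> replaced by coordinate \<open>j\<close>.\<close>

definition sub :: "'i \<Rightarrow> 'i \<Rightarrow> 'b \<Rightarrow> 'b" where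
  "sub i j x = (if i = j then x else c i (d i j \<sqinter> x))"

lemma sub_in [simp, intro]: "i < \<beta> \<Longrightarrow> j < \<beta> \<Longrightarrow> x \<in> C \<Longrightarrow> sub i j x \<in> C"
  by (simp add: sub_def)

lemma diag_closed:
  assumes "i < \<beta>" "j < \<beta>" "l < \<beta>" "l \<noteq> i" "l \<noteq> j"
  shows "c l (d i j) = d i j"
  using cyl_axioms(6)[OF assms] cyl_cyl[of l "d i l \<sqinter> d l j"] assms by simp

lemma st_diag_trans:
  assumes "st \<phi>" "i < \<beta>" "j < \<beta>" "l < \<beta>" "j \<noteq> i" "j \<noteq> l" "\<phi> (d i j)" "\<phi> (d j l)"
  shows "\<phi> (d i l)"
proof -
  have "\<phi> (d i j \<sqinter> d j l)" using assms stD(1)[OF assms(1)] by simp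
  from st_cylI[OF assms(1) assms(3) _ this] show ?thesis using cyl_axioms(6)[OF assms(2,4,3,5,6)] assms by simp
qed

lemma st_diag_cyl:
  assumes "st \<phi>" "i < \<beta>" "j < \<beta>" "i \<noteq> j"
  shows "\<phi> (c i (d i j))" "\<phi> (c i (d j i))"
proof -
  have "\<phi> (c i (d j i \<sqinter> d i j))"
    using stD(5)[OF assms(1)] cyl_axioms(5)[OF assms(3)] cyl_axioms(6)[of j j i] assms by simp
  then show "\<phi> (c i (d i j))" "\<phi> (c i (d j i))"
    using st_cyl[OF assms(1,2)] stD(1) assms by (metis closed(2,7))+
qed

text \<open>Substitution acts on ultrafilters: seen through \<open>sub i j\<close>, \<phi> becomes
  its i-variant on the diagonal, and the last axiom makes the values agree. Laws of substitution can
  thus be verified by following ultrafilters.\<close>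

lemma st_sub_ex:
  assumes \<phi>: "st \<phi>" and ij: "i < \<beta>" "j < \<beta>" "i \<noteq> j"
  shows "\<exists>\<psi>. st \<psi> \<and> eqv i \<phi> \<psi> \<and> \<psi> (d i j) \<and> (\<forall>x\<in>C. \<phi> (sub i j x) = \<psi> x)"
proof -
  obtain \<psi> where \<psi>: "st \<psi>" "eqv i \<phi> \<psi>" "\<psi> (d i j)"
    using st_diag_cyl(1)[OF assms] st_cyl[OF \<phi> ij(1)] ij by auto
  have 1: "\<phi> (c i (d i j \<sqinter> x))" if "x \<in> C" "\<psi> x" for x
    using st_cyl[OF \<phi> ij(1), of "d i j \<sqinter> x"] \<psi> stD(1)[OF \<psi>(1), of "d i j" x] that ij by auto
  have "\<phi> (sub i j x) = \<psi> x" if x: "x \<in> C" for x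
  proof -
    have "\<not> (\<phi> (c i (d i j \<sqinter> x)) \<and> \<phi> (c i (d i j \<sqinter> neg x)))"
      using cyl_axioms(7)[OF ij x] stD(4)[OF \<phi>] stD(1)[OF \<phi>, of "c i (d i j \<sqinter> x)" "c i (d i j \<sqinter> neg x)"] ij x
      by simp
    then show ?thesis using 1[OF x] 1[of "neg x"] stD(3)[OF \<psi>(1) x] x ij by (auto simp: sub_def)
  qed
  with \<psi> show ?thesis by blast
qed

lemma st_sub:
  assumes "st \<phi>" "i < \<beta>" "j < \<beta>"
  shows "st (\<lambda>x. \<phi> (sub i j x))"
proof (cases "i = j")
  case False
  from st_sub_ex[OF assms False] obtain \<psi> where "st \<psi>" "\<forall>x\<in>C. \<phi> (sub i j x) = \<psi> x" by blast
  then show ?thesis unfolding st_def by simp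
qed (use assms in \<open>simp add: sub_def\<close>)

lemma sub_closed_id:
  assumes "st \<phi>" "i < \<beta>" "j < \<beta>" "x \<in> C" "c i x = x"
  shows "\<phi> (sub i j x) = \<phi> x"
proof (cases "i = j")
  case False
  from st_sub_ex[OF assms(1-3) False] show ?thesis using assms(4,5) eqvD by metis
qed (simp add: sub_def)

lemma sub_closed_self: "i < \<beta> \<Longrightarrow> j < \<beta> \<Longrightarrow> i \<noteq> j \<Longrightarrow> x \<in> C \<Longrightarrow> c i (sub i j x) = sub i j x"
  by (simp add: sub_def cyl_cyl)

lemma sub_closed_other:
  assumes "i < \<beta>" "j < \<beta>" "l < \<beta>" "x \<in> C" "c l x = x" "l \<noteq> i" "l \<noteq> j"
  shows "c l (sub i j x) = sub i j x"
  using assms closed_meet[of l "d i j" x] diag_closed[of i j l] cyl_axioms(4)[of l i "d i j \<sqinter> x"]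
  by (simp add: sub_def)

text \<open>Under \<open>d j l\<close> the coordinates \<open>j\<close> and \<open>l\<close> carry
  the same point, so it does not matter from which of them \<open>i\<close> is filled.\<close>

lemma sub_diag:
  assumes \<phi>: "st \<phi>" and b: "i < \<beta>" "j < \<beta>" "l < \<beta>" "j \<noteq> l" "i \<noteq> l" and x: "x \<in> C"
    and dl: "\<phi> (d j l)" and h: "\<phi> (sub i j x)"
  shows "\<phi> (sub i l x)"
proof (cases "i = j")
  case True
  then have "\<phi> (d i l \<sqinter> x)" using assms stD(1)[OF \<phi>, of "d i l" x] by (simp add: sub_def)
  then show ?thesis using st_cylI[OF \<phi>, of i "d i l \<sqinter> x"] b x by (simp add: sub_def)
next
  case False
  from st_sub_ex[OF \<phi> b(1,2) False] h x obtain \<chi> where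
    \<chi>: "st \<chi>" "eqv i \<phi> \<chi>" "\<chi> (d i j)" "\<chi> x" by blast
  have "\<chi> (d j l)" using eqvD[OF \<chi>(2), of "d j l"] diag_closed[of j l i] b False dl by simp
  then have "\<chi> (d i l)" using st_diag_trans[OF \<chi>(1), of i j l] \<chi>(3) b False by simp
  then have "\<chi> (d i l \<sqinter> x)" using \<chi> stD(1)[OF \<chi>(1)] b x by simp
  then show ?thesis using st_cyl[OF \<phi>, of i "d i l \<sqinter> x"] \<chi> b x by (auto simp: sub_def)
qed

text \<open>As functions of \<open>t\<close> both sides behave like ultrafilters. Hence one
  implication is enough, provided that it holds for \<open>t\<close> and for \<open>neg t\<close>;
  \<open>closed_neg\<close> keeps the latter closed.\<close>

lemma sub_sub:
  assumes \<phi>: "st \<phi>" and b: "i < \<beta>" "j < \<beta>" "l < \<beta>" "i \<noteq> j" "i \<noteq> l" and t: "t \<in> C" "c j t = t"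
  shows "\<phi> (sub j l (sub i j t)) = \<phi> (sub i l t)"
proof (cases "j = l")
  case False
  obtain \<psi>1 where 1: "st \<psi>1" "eqv j \<phi> \<psi>1" "\<psi>1 (d j l)" "\<forall>x\<in>C. \<phi> (sub j l x) = \<psi>1 x"
    using st_sub_ex[OF \<phi> b(2,3) False] by blast
  obtain \<psi>2 where 2: "st \<psi>2" "eqv i \<psi>1 \<psi>2" "\<psi>2 (d i j)" "\<forall>x\<in>C. \<psi>1 (sub i j x) = \<psi>2 x"
    using st_sub_ex[OF 1(1) b(1,2,4)] by blast
  have "\<psi>2 (d j l)" using eqvD[OF 2(2), of "d j l"] diag_closed[of j l i] b 1(3) by simp
  then have dil: "\<psi>2 (d i l)" using st_diag_trans[OF 2(1), of i j l] 2(3) b False by simp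
  have imp: "\<phi> (sub i l x)" if x: "x \<in> C" "c j x = x" "\<psi>2 x" for x
  proof -
    let ?y = "c i (d i l \<sqinter> x)"
    have "\<psi>2 (d i l \<sqinter> x)" using dil x stD(1)[OF 2(1), of "d i l" x] b by simp
    then have "\<psi>1 ?y" using st_cyl[OF 1(1), of i "d i l \<sqinter> x"] 2 b x by auto
    moreover have "c j ?y = ?y"
      using closed_meet[of j "d i l" x] diag_closed[of i l j] cyl_axioms(4)[of j i "d i l \<sqinter> x"] b x False by simp
    ultimately have "\<phi> ?y" using eqvD[OF 1(2), of ?y] b x by simp
    then show ?thesis using b by (simp add: sub_def)
  qed
  have s: "st (\<lambda>x. \<phi> (sub i l x))" by (rule st_sub[OF \<phi> b(1,3)])
  have "\<phi> (sub i l t) = \<psi>2 t"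
    using imp[OF t] imp[of "neg t"] closed_neg[OF b(2) t] t(1) stD(3)[OF s t(1)] stD(3)[OF 2(1) t(1)] by auto
  then show ?thesis using 1(4) 2(4) b t by simp
qed (simp add: sub_def)

text \<open>Neither substitution writes to a coordinate that the other one writes or reads. As
  before, one implication is shown for all elements and applied to \<open>t\<close> and
  \<open>neg t\<close>.\<close>

lemma sub_comm:
  assumes \<phi>: "st \<phi>" and b: "i < \<beta>" "j < \<beta>" "l < \<beta>" "m < \<beta>" "i \<noteq> l" "i \<noteq> m" "l \<noteq> j" and t: "t \<in> C"
  shows "\<phi> (sub i j (sub l m t)) = \<phi> (sub l m (sub i j t))"
proof (cases "i = j \<or> l = m")
  case False
  then have ne: "i \<noteq> j" "l \<noteq> m" by auto
  obtain \<psi>1 where 1: "st \<psi>1" "eqv i \<phi> \<psi>1" "\<psi>1 (d i j)" "\<forall>x\<in>C. \<phi> (sub i j x) = \<psi>1 x"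
    using st_sub_ex[OF \<phi> b(1,2) ne(1)] by blast
  obtain \<psi>2 where 2: "st \<psi>2" "eqv l \<psi>1 \<psi>2" "\<psi>2 (d l m)" "\<forall>x\<in>C. \<psi>1 (sub l m x) = \<psi>2 x"
    using st_sub_ex[OF 1(1) b(3,4) ne(2)] by blast
  have dij: "\<psi>2 (d i j)" using eqvD[OF 2(2), of "d i j"] diag_closed[of i j l] b 1(3) by simp
  have imp: "\<phi> (sub l m (sub i j x))" if x: "x \<in> C" "\<psi>2 x" for x
  proof -
    let ?u = "c i (d i j \<sqinter> x)"
    let ?z = "c l (d l m \<sqinter> ?u)"
    have "\<psi>2 ?u" using dij x stD(1)[OF 2(1), of "d i j" x] st_cylI[OF 2(1) b(1), of "d i j \<sqinter> x"] b by simp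
    then have "\<psi>2 (d l m \<sqinter> ?u)" using 2(3) stD(1)[OF 2(1), of "d l m" ?u] b x by simp
    then have "\<psi>1 ?z" using st_cyl[OF 1(1), of l "d l m \<sqinter> ?u"] 2 b x by auto
    moreover have "c i ?z = ?z"
      using closed_meet[of i "d l m" ?u] diag_closed[of l m i] cyl_cyl[of i "d i j \<sqinter> x"]
        cyl_axioms(4)[of i l "d l m \<sqinter> ?u"] b x by simp
    ultimately have "\<phi> ?z" using eqvD[OF 1(2), of ?z] b x by simp
    then show ?thesis using ne by (simp add: sub_def)
  qed
  have s: "st (\<lambda>x. \<phi> (sub l m (sub i j x)))" using st_sub[OF st_sub[OF \<phi> b(3,4)] b(1,2)] .
  have "\<phi> (sub l m (sub i j t)) = \<psi>2 t"
    using imp[OF t] imp[of "neg t"] t stD(3)[OF s t] stD(3)[OF 2(1) t] by auto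
  then show ?thesis using 1(4) 2(4) b t by simp
qed (auto simp: sub_def)

end

section \<open>The network algebras have no dilation with one more dimension\<close>

definition clique :: "'i::{wellorder,no_top} \<Rightarrow> ('i \<Rightarrow> 'i \<Rightarrow> nat) \<Rightarrow> 'i network" where
  "clique \<alpha> g = (let q = (\<lambda>a. if a = ord_nat 1 then ord_nat 2 else a) in
     (\<lambda>a b. if a < \<alpha> \<and> b < \<alpha> then (if q a = q b then Same else Black (g (q a) (q b))) else Same))"

text \<open>Coordinates 1 and 2 are identified on purpose: a bad sequence in dimension \<alpha> is
  injective, hence onto, so it would have to contain two distinct points of the clique joined by
  \<open>Same\<close>.\<close>

lemma clique_in_nets:
  assumes \<alpha>: "ord_nat 2 < \<alpha>" and g: "\<And>a b. g a b = g b a"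
  shows "clique \<alpha> g \<in> nets \<alpha> k r 0"
proof -
  have G: "graph \<alpha> k r (clique \<alpha> g)"
    unfolding graph_def clique_def Let_def using g by (simp split: if_splits)
  have "\<not> bad \<alpha> (pull \<alpha> t (clique \<alpha> g))" if t: "fv \<alpha> \<alpha> t" for t
  proof
    assume b: "bad \<alpha> (pull \<alpha> t (clique \<alpha> g))"
    note inj = bad_distinct(1)[OF \<alpha> G b]
    obtain i j where ij: "i < \<alpha>" "j < \<alpha>" "t i = ord_nat 1" "t j = ord_nat 2"
      using surj_fv[OF t inj, of "ord_nat 1"] surj_fv[OF t inj, of "ord_nat 2"] \<alpha> ord_nats_less[OF \<alpha>] by auto
    then have "i \<noteq> j" by (metis ord_nat_eq_iff numeral_eq_one_iff semiring_norm(85))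
    moreover have "clique \<alpha> g (t i) (t j) = Same" by (simp add: ij(3,4) clique_def)
    ultimately show False using bad_distinct(2)[OF \<alpha> G b ij(1,2)] by simp
  qed
  with G show ?thesis by (simp add: nets_def)
qed

text \<open>Enumerates the k + 3 coordinates that are not taken by the clique on 2, 3, ... below
  \<alpha>: they are 0, 1 and the added ones \<alpha>, ..., \<alpha> + k. Hence the shift by
  2.\<close>

definition zeta :: "'i::{wellorder,no_top} \<Rightarrow> nat \<Rightarrow> 'i" where
  "zeta \<alpha> m = (if m = 0 then ord_nat 0 else if m = 1 then ord_nat 1 else ord_plus \<alpha> (m - 2))"

text \<open>Coordinate 0 completes the black clique, and its kind is recorded on the edge to
  coordinate 2. Coordinate 1 is left unconstrained, as the place for a second point over the same
  clique.\<close>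

definition Tset :: "'i::{wellorder,no_top} \<Rightarrow> ('i network \<Rightarrow> 'w) \<Rightarrow> 'i network set \<Rightarrow> nat \<Rightarrow> 'w set" where
  "Tset \<alpha> e W j = e ` {N \<in> W. N (ord_nat 0) (ord_nat 2) = Black j \<and>
     (\<forall>a<\<alpha>. \<forall>b<\<alpha>. a \<noteq> b \<longrightarrow> a \<noteq> ord_nat 1 \<longrightarrow> b \<noteq> ord_nat 1 \<longrightarrow> is_black (N a b))}"

definition Kset :: "('i::{wellorder,no_top} network \<Rightarrow> 'w) \<Rightarrow> 'i network set \<Rightarrow> nat \<Rightarrow> nat \<Rightarrow> 'w set" where
  "Kset e W c s = e ` {N \<in> W. N (ord_nat 0) (ord_nat 1) = Colour c s}"

section \<open>Black cliques and coloured edges as elements of the network algebra\<close>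

locale net_algebra =
  fixes \<alpha> :: "'i::{wellorder,no_top}" and k r :: nat and e :: "'i network \<Rightarrow> 'w"
  assumes \<alpha>: "ord_nat 2 < \<alpha>" and e: "inj e"
begin

abbreviation "o0 \<equiv> ord_nat 0"
abbreviation "o1 \<equiv> ord_nat 1"
abbreviation "o2 \<equiv> ord_nat 2"
abbreviation "W \<equiv> nets \<alpha> k r 0"
abbreviation "A \<equiv> net_alg e W"
abbreviation "T \<equiv> Tset \<alpha> e W"
abbreviation "K \<equiv> Kset e W"

lemma o_less: "o0 < \<alpha>" "o1 < \<alpha>" "ord_nat (Suc 0) < \<alpha>" "o2 < \<alpha>"
  using \<alpha> ord_nats_less[OF \<alpha>] by auto

lemma in_cyl: "N \<in> W \<Longrightarrow> e N \<in> cyl A i X \<longleftrightarrow> (\<exists>M\<in>W. e M \<in> X \<and> agree i N M)"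
  using in_cyl_net_alg[of e W N i X] e by (auto intro: inj_on_subset)

lemma in_diag: "N \<in> W \<Longrightarrow> e N \<in> diag A i j \<longleftrightarrow> N i j = Same"
  using in_diag_net_alg[of e W N i j] e by (auto intro: inj_on_subset)

lemma W_graph: "N \<in> W \<Longrightarrow> graph \<alpha> k r N"
  using netsD(1)[of N \<alpha> k r 0] by simp

lemma in_T: "N \<in> W \<Longrightarrow> e N \<in> T j \<longleftrightarrow> N o0 o2 = Black j \<and>
    (\<forall>a<\<alpha>. \<forall>b<\<alpha>. a \<noteq> b \<longrightarrow> a \<noteq> o1 \<longrightarrow> b \<noteq> o1 \<longrightarrow> is_black (N a b))"
  using e by (auto simp: Tset_def inj_eq inj_image_mem_iff)

lemma in_K: "N \<in> W \<Longrightarrow> e N \<in> K c s \<longleftrightarrow> N o0 o1 = Colour c s"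
  using e by (auto simp: Kset_def inj_eq)

lemma T_sub: "T j \<subseteq> e ` W" "K c s \<subseteq> e ` W"
  by (auto simp: Tset_def Kset_def)

lemma eqI: "X \<subseteq> e ` W \<Longrightarrow> Y \<subseteq> e ` W \<Longrightarrow> (\<And>N. N \<in> W \<Longrightarrow> e N \<in> X \<longleftrightarrow> e N \<in> Y) \<Longrightarrow> X = Y"
  by (rule net_alg_eqI)

lemma cyl_closedI:
  assumes "X \<subseteq> e ` W" "\<And>N M. N \<in> W \<Longrightarrow> M \<in> W \<Longrightarrow> e M \<in> X \<Longrightarrow> agree i N M \<Longrightarrow> e N \<in> X"
  shows "cyl A i X = X"
proof (rule eqI[OF _ assms(1)])
  fix N assume "N \<in> W"
  then show "e N \<in> cyl A i X \<longleftrightarrow> e N \<in> X"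
    unfolding in_cyl[OF \<open>N \<in> W\<close>] using assms(2)[OF \<open>N \<in> W\<close>] agree_refl[of i N] by blast
qed (rule cyl_net_alg_subset)

lemma T_closed: "cyl A o1 (T j) = T j"
proof (rule cyl_closedI[OF T_sub(1)])
  fix N M assume "N \<in> W" "M \<in> W" "e M \<in> T j" "agree o1 N M"
  then show "e N \<in> T j" by (simp add: in_T agree_def)
qed

lemma K_closed: "cyl A o2 (K c s) = K c s"
proof (rule cyl_closedI[OF T_sub(2)])
  fix N M assume "N \<in> W" "M \<in> W" "e M \<in> K c s" "agree o2 N M"
  then show "e N \<in> K c s" by (simp add: in_K agree_def)
qed

lemma T_nonempty: "T j \<noteq> {}"
proof -
  have "clique \<alpha> (\<lambda>_ _. j) \<in> W" by (rule clique_in_nets[OF \<alpha>]) simp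
  moreover have "e (clique \<alpha> (\<lambda>_ _. j)) \<in> T j"
    unfolding in_T[OF calculation] using o_less by (auto simp: clique_def)
  ultimately show ?thesis by blast
qed

text \<open>The clique itself does not know the kind of the point at 0. Relabelling the edge between
  0 and 2 certainly gives a network once coordinate 1 is identified with 2, and amalgamation
  restores the original coordinate 1.\<close>

lemma cyl_T_sub: "cyl A o0 (T j) \<subseteq> cyl A o0 (T l)"
proof
  fix x assume x: "x \<in> cyl A o0 (T j)"
  then obtain N where N: "N \<in> W" "x = e N" using cyl_net_alg_subset(1)[of e W o0 "T j"] by blast
  then obtain M where M: "M \<in> W" "e M \<in> T j" "agree o0 N M" using x in_cyl[OF N(1)] by blast
  have TM: "is_black (M a b)" if "a < \<alpha>" "b < \<alpha>" "a \<noteq> b" "a \<noteq> o1" "b \<noteq> o1" for a b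
    using M(2) that unfolding in_T[OF M(1)] by blast
  note gM = graphD[OF W_graph[OF M(1)]]
  define g where "g a b = (if {a, b} = {o0, o2} then l else (THE m. M a b = Black m))" for a b
  define P where "P = clique \<alpha> g"
  have PW: "P \<in> W"
    unfolding P_def by (rule clique_in_nets[OF \<alpha>]) (simp add: g_def gM(2) insert_commute)
  have P: "P a b = (if {a, b} = {o0, o2} then Black l else M a b)"
    if ab: "a < \<alpha>" "b < \<alpha>" "a \<noteq> b" "a \<noteq> o1" "b \<noteq> o1" for a b
  proof -
    obtain m where "M a b = Black m" using TM[OF ab] by blast
    then show ?thesis using ab by (auto simp: P_def clique_def g_def)
  qed
  have PM: "P a b = M a b" if "a \<noteq> o0" "a \<noteq> o1" "b \<noteq> o0" "b \<noteq> o1" for a b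
  proof (cases "a < \<alpha> \<and> b < \<alpha> \<and> a \<noteq> b")
    case True
    then show ?thesis using P[of a b] that by (auto simp: doubleton_eq_iff)
  next
    case False
    then show ?thesis
      using gM(1)[of a b] gM(3)[of a] graphD(1)[OF W_graph[OF PW], of a b] graphD(3)[OF W_graph[OF PW], of a] by auto
  qed
  \<comment> \<open>The intermediate labelling for the amalgamation: it agrees with \<open>P\<close>
    off 0 and with \<open>M\<close> off 1.\<close>
  let ?Q = "\<lambda>a b. if a = o1 \<or> b = o1 then P a b else M a b"
  have "agree o0 P ?Q" "agree o1 ?Q M" using PM by (auto simp: agree_def)
  from nets_amalgam[OF \<alpha> _ PW M(1) _ _ this] obtain L where L: "L \<in> W" "agree o1 P L" "agree o0 L M"
    using o_less by auto
  have "e L \<in> T l"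
    unfolding in_T[OF L(1)]
  proof (intro conjI allI impI)
    have LP: "L a b = P a b" if "a \<noteq> o1" "b \<noteq> o1" for a b using L(2) that by (simp add: agree_def)
    show "L o0 o2 = Black l" using LP[of o0 o2] P[of o0 o2] o_less by simp
    fix a b assume ab: "a < \<alpha>" "b < \<alpha>" "a \<noteq> b" "a \<noteq> o1" "b \<noteq> o1"
    show "is_black (L a b)" using LP[OF ab(4,5)] P[OF ab] TM[OF ab] by auto
  qed
  moreover have "agree o0 N L" using agree_trans[OF M(3) agree_sym[OF L(3)]] .
  ultimately show "x \<in> cyl A o0 (T l)" unfolding N(2) in_cyl[OF N(1)] using L(1) by blast
qed

lemma diag_subst:
  assumes "N \<in> W" "e N \<in> cyl A i (diag A i j \<inter> X)" "i < \<alpha>" "j < \<alpha>"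
  shows "\<exists>M\<in>W. e M \<in> X \<and> agree i N M \<and> (\<forall>b. b \<noteq> i \<longrightarrow> M i b = N j b) \<or> i = j"
proof (cases "i = j")
  case False
  have "\<exists>M\<in>W. e M \<in> diag A i j \<inter> X \<and> agree i N M" using assms(2) unfolding in_cyl[OF assms(1)] .
  then obtain M where M: "M \<in> W" "e M \<in> diag A i j" "e M \<in> X" "agree i N M" by blast
  then have Mij: "M i j = Same" using in_diag[OF M(1)] by simp
  have "M i b = N j b" if "b \<noteq> i" for b
    using graphD(4)[OF W_graph[OF M(1)] assms(3,4) Mij, of b] M(4) that False by (simp add: agree_def)
  then show ?thesis using M by blast
qed (use assms(1) in blast)

text \<open>Here 0 and 1 complete the same clique with different kinds. They are not equal, because
  their edges to 2 differ, and a grey or black edge between them would be bad; so only a colour is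
  left.\<close>

lemma T_T:
  assumes "j \<noteq> l"
  shows "T j \<inter> cyl A o0 (diag A o0 o1 \<inter> T l) \<subseteq> (\<Union>(c, s)\<in>{..k} \<times> {..r}. K c s)"
proof
  fix x assume x: "x \<in> T j \<inter> cyl A o0 (diag A o0 o1 \<inter> T l)"
  then obtain N where N: "N \<in> W" "x = e N" using T_sub(1) by blast
  note g = graphD[OF W_graph[OF N(1)]]
  have Tj: "N o0 o2 = Black j" "\<And>a b. a < \<alpha> \<Longrightarrow> b < \<alpha> \<Longrightarrow> a \<noteq> b \<Longrightarrow> a \<noteq> o1 \<Longrightarrow> b \<noteq> o1 \<Longrightarrow> is_black (N a b)"
    using x in_T[OF N(1)] N(2) by auto
  obtain M where M: "M \<in> W" "e M \<in> T l" "agree o0 N M" "\<And>b. b \<noteq> o0 \<Longrightarrow> M o0 b = N o1 b"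
    using diag_subst[OF N(1), of o0 o1 "T l"] x N(2) o_less by auto
  have Tl: "N o1 o2 = Black l" "\<And>b. b < \<alpha> \<Longrightarrow> b \<noteq> o0 \<Longrightarrow> b \<noteq> o1 \<Longrightarrow> is_black (N o1 b)"
  proof -
    have T: "M o0 o2 = Black l" "\<And>b. b < \<alpha> \<Longrightarrow> o0 \<noteq> b \<Longrightarrow> b \<noteq> o1 \<Longrightarrow> is_black (M o0 b)"
      using M(2) o_less unfolding in_T[OF M(1)] by auto
    show "N o1 o2 = Black l" using T(1) M(4)[of o2] by simp
    show "is_black (N o1 b)" if "b < \<alpha>" "b \<noteq> o0" "b \<noteq> o1" for b using T(2)[of b] M(4)[of b] that by simp
  qed
  have "\<not> bad \<alpha> (pull \<alpha> (\<lambda>a. a) N)"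
    using netsD(2)[OF N(1), of "\<lambda>a. a"] fv_id[of \<alpha> \<alpha>] by simp
  then have nb: "\<not> bad \<alpha> N" using pull_id[OF W_graph[OF N(1)]] by simp
  have "is_black (N a b)" if ab: "a < \<alpha>" "b < \<alpha>" "a \<noteq> b" "{a, b} \<noteq> {o0, o1}" for a b
  proof -
    consider "a = o1" "b \<noteq> o0" "b \<noteq> o1" | "b = o1" "a \<noteq> o0" "a \<noteq> o1" | "a \<noteq> o1" "b \<noteq> o1"
      using ab by blast
    then show ?thesis
    proof cases
      case 1 then show ?thesis using Tl(2) ab by simp
    next
      case 2 then show ?thesis using Tl(2)[of a] ab g(2)[of a b] by simp
    next
      case 3 then show ?thesis using Tj(2) ab by simp
    qed
  qed
  then have "N o0 o1 \<noteq> Grey \<and> \<not> is_black (N o0 o1)" using nb unfolding bad_def by blast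
  moreover have "N o0 o1 \<noteq> Same" using g(4)[of o0 o1 o2] Tj(1) Tl(1) o_less assms by auto
  ultimately obtain c s where c: "N o0 o1 = Colour c s" by (cases "N o0 o1") auto
  then have "e N \<in> K c s" "c \<le> k" "s \<le> r" using in_K[OF N(1)] g(5,6) by auto
  then show "x \<in> (\<Union>(c, s)\<in>{..k} \<times> {..r}. K c s)" unfolding N(2) by blast
qed

text \<open>The three sets speak of the edges 0-1, 0-2 and 1-2 of a forbidden triangle. They are
  expressed by the single pattern \<open>K\<close> and substitutions, in the form that can be
  transferred to a dilation.\<close>

lemma K_K:
  "K c s \<inter> cyl A o1 (diag A o1 o2 \<inter> K c s) \<inter>
    cyl A o0 (diag A o0 o1 \<inter> cyl A o1 (diag A o1 o2 \<inter> K c s')) = {}"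
proof (rule equals0I)
  fix x assume x: "x \<in> K c s \<inter> cyl A o1 (diag A o1 o2 \<inter> K c s) \<inter>
    cyl A o0 (diag A o0 o1 \<inter> cyl A o1 (diag A o1 o2 \<inter> K c s'))"
  then obtain N where N: "N \<in> W" "x = e N" using T_sub(2) by blast
  note g = graphD[OF W_graph[OF N(1)]]
  have sub: "N' o0 o2 = Colour c t" if N': "N' \<in> W" and m: "e N' \<in> cyl A o1 (diag A o1 o2 \<inter> K c t)" for N' t
  proof -
    obtain M where M: "M \<in> W" "e M \<in> K c t" "\<And>b. b \<noteq> o1 \<Longrightarrow> M o1 b = N' o2 b"
      using diag_subst[OF N', of o1 o2 "K c t"] m o_less by auto
    then show ?thesis using M(3)[of o0] in_K[OF M(1)] graphD(2)[OF W_graph[OF M(1)], of o0 o1]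
        graphD(2)[OF W_graph[OF N'], of o0 o2] by simp
  qed
  have 1: "N o0 o1 = Colour c s" "N o0 o2 = Colour c s" using x N in_K[OF N(1)] sub[OF N(1)] by auto
  obtain M where M: "M \<in> W" "e M \<in> cyl A o1 (diag A o1 o2 \<inter> K c s')" "\<And>b. b \<noteq> o0 \<Longrightarrow> M o0 b = N o1 b"
    using diag_subst[OF N(1), of o0 o1 "cyl A o1 (diag A o1 o2 \<inter> K c s')"] x N(2) o_less by auto
  have "N o1 o2 = Colour c s'" using sub[OF M(1,2)] M(3)[of o2] by simp
  then show False using g(7)[OF 1] by blast
qed

end

section \<open>The Ramsey argument inside a dilation\<close>

locale dilation = net_algebra \<alpha> k r e + cyl_algebra "ord_plus \<alpha> (k + 1)" B
  for \<alpha> :: "'i::{wellorder,no_top}" and k r :: nat and e :: "'i network \<Rightarrow> 'w" and B :: "('i, 'b) cyl_alg" +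
  fixes f :: "'w set \<Rightarrow> 'b"
  assumes f: "cyl_hom \<alpha> (net_alg e (nets \<alpha> k r 0)) (neat_reduct \<alpha> (ord_plus \<alpha> (k + 1)) B) f"
    and f_inj: "inj_on f (Pow (e ` nets \<alpha> k r 0))"
begin

abbreviation "\<beta> \<equiv> ord_plus \<alpha> (k + 1)"
abbreviation "z \<equiv> zeta \<alpha>"

lemma f_in: "X \<subseteq> e ` W \<Longrightarrow> f X \<in> C"
  and f_closed: "X \<subseteq> e ` W \<Longrightarrow> \<alpha> \<le> i \<Longrightarrow> i < \<beta> \<Longrightarrow> c i (f X) = f X"
  and f_join: "X \<subseteq> e ` W \<Longrightarrow> Y \<subseteq> e ` W \<Longrightarrow> f (X \<union> Y) = f X \<squnion> f Y"
  and f_meet: "X \<subseteq> e ` W \<Longrightarrow> Y \<subseteq> e ` W \<Longrightarrow> f (X \<inter> Y) = f X \<sqinter> f Y"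
  and f_zer: "f {} = zer B"
  and f_cyl: "X \<subseteq> e ` W \<Longrightarrow> i < \<alpha> \<Longrightarrow> f (cyl A i X) = c i (f X)"
  and f_diag: "i < \<alpha> \<Longrightarrow> j < \<alpha> \<Longrightarrow> f (diag A i j) = d i j"
  using f unfolding cyl_hom_def neat_reduct_def by auto

lemma o_less': "o0 < \<beta>" "o1 < \<beta>" "o2 < \<beta>"
  using o_less less_ord_plus by blast+

lemma z_less: "m \<le> k + 2 \<Longrightarrow> z m < \<beta>"
  using o_less' by (auto simp: zeta_def)

lemma z_simps: "z 0 = o0" "z (Suc 0) = o1" "z 1 = o1"
  by (simp_all add: zeta_def)

lemma z_ge: "2 \<le> m \<Longrightarrow> \<alpha> \<le> z m"
  by (simp add: zeta_def)

lemma z_inj: "z m = z n \<longleftrightarrow> m = n"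
proof -
  have 01: "z 0 < \<alpha>" "z 1 < \<alpha>" "z 0 \<noteq> z 1" using o_less by (simp_all add: z_simps)
  have *: "z m \<noteq> z n" if "m < n" for m n
  proof (cases "2 \<le> m")
    case True
    then show ?thesis using that by (simp add: zeta_def)
  next
    case False
    then have m: "m = 0 \<or> m = 1" by auto
    show ?thesis
    proof (cases "2 \<le> n")
      case True
      then show ?thesis using m 01(1,2) z_ge[of n] by auto
    next
      case False
      then have "m = 0" "n = 1" using that by auto
      then show ?thesis using 01(3) by simp
    qed
  qed
  show ?thesis using *[of m n] *[of n m] by (metis linorder_neqE_nat)
qed

lemma z_ne: "m \<noteq> 0 \<Longrightarrow> z m \<noteq> o0" "m \<noteq> 1 \<Longrightarrow> z m \<noteq> o1" "2 \<le> m \<Longrightarrow> z m \<noteq> o2"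
  using z_inj[of m 0] z_inj[of m 1] z_ge[of m] o_less by (auto simp: z_simps)

lemma f_mono:
  assumes "st \<phi>" "X \<subseteq> Y" "Y \<subseteq> e ` W" "\<phi> (f X)"
  shows "\<phi> (f Y)"
proof -
  have "f Y = f X \<squnion> f Y" using f_join[of X Y] assms(2,3) by (simp add: Un_absorb1)
  then show ?thesis using stD(2)[OF assms(1), of "f X" "f Y"] f_in assms by (metis order_trans)
qed

text \<open>\<open>f\<close> preserves binary joins only, so the step from a union to one of its
  members relies on there being finitely many colours and shades.\<close>

lemma f_Union:
  assumes "st \<phi>" "finite I" "\<And>i. i \<in> I \<Longrightarrow> X i \<subseteq> e ` W" "\<phi> (f (\<Union>i\<in>I. X i))"
  shows "\<exists>i\<in>I. \<phi> (f (X i))"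
  using assms(2-)
proof (induction I)
  case empty
  then show ?case using stD(4)[OF assms(1)] by (simp add: f_zer)
next
  case (insert i I)
  have "(\<Union>i\<in>I. X i) \<subseteq> e ` W" using insert.prems(1) by blast
  then have "f (\<Union>i\<in>insert i I. X i) = f (X i) \<squnion> f (\<Union>i\<in>I. X i)" "f (X i) \<in> C" "f (\<Union>i\<in>I. X i) \<in> C"
    using f_join[of "X i" "\<Union>i\<in>I. X i"] f_in insert.prems(1) by auto
  then have "\<phi> (f (X i)) \<or> \<phi> (f (\<Union>i\<in>I. X i))"
    using insert.prems(2) stD(2)[OF assms(1)] by simp
  then show ?case using insert by blast
qed

lemma f_sub:
  assumes "X \<subseteq> e ` W" "i < \<alpha>" "j < \<alpha>" "i \<noteq> j"
  shows "f (cyl A i (diag A i j \<inter> X)) = sub i j (f X)"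
  using assms f_cyl[of "diag A i j \<inter> X" i] f_meet[of "diag A i j" X] f_diag cyl_net_alg_subset(2)[of e W]
  by (simp add: sub_def inf.coboundedI1)

lemma fT: "f (T j) \<in> C" "c o1 (f (T j)) = f (T j)"
  using f_in[OF T_sub(1)] f_cyl[OF T_sub(1)] T_closed o_less by metis+

lemma fK: "f (K p s) \<in> C" "c o2 (f (K p s)) = f (K p s)"
  using f_in[OF T_sub(2)] f_cyl[OF T_sub(2)] K_closed o_less by metis+

text \<open>The elements \<open>Tm m j\<close> and \<open>Km m m' p s\<close> say that the point at coordinate \<open>z m\<close> satisfies \<open>T j\<close>,
  and that the points at the coordinates \<open>z m\<close>, \<open>z m'\<close> (where \<open>m < m'\<close>) are joined by colour \<open>p\<close> of
  shade \<open>s\<close>.\<close>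

definition Tm :: "nat \<Rightarrow> nat \<Rightarrow> 'b" where
  "Tm m j = sub o0 (z m) (f (T j))"

definition Km :: "nat \<Rightarrow> nat \<Rightarrow> nat \<Rightarrow> nat \<Rightarrow> 'b" where
  "Km m m' p s = sub o0 (z m) (sub o1 (z m') (f (K p s)))"

lemma Tm_in: "m \<le> k + 2 \<Longrightarrow> Tm m j \<in> C"
  unfolding Tm_def using fT z_less o_less' by simp

lemma Km_in: "m \<le> k + 2 \<Longrightarrow> m' \<le> k + 2 \<Longrightarrow> Km m m' p s \<in> C"
  unfolding Km_def using fK z_less o_less' by simp

text \<open>Among the free coordinates \<open>Tm m j\<close> depends on \<open>z m\<close> only:
  coordinate 0 is bound by the substitution, coordinate 1 does not matter by
  \<open>T_closed\<close>, and those from \<alpha> on do not matter because \<open>f\<close> maps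
  into the neat reduct.\<close>

lemma Tm_closed:
  assumes "m \<le> k + 2" "b \<le> k + 2" "b \<noteq> m"
  shows "c (z b) (Tm m j) = Tm m j"
proof (cases "b = 0")
  case True
  then show ?thesis
    unfolding Tm_def using sub_closed_self[of o0 "z m" "f (T j)"] z_less[OF assms(1)] z_ne(1)[of m] o_less' fT assms
    by (simp add: z_simps)
next
  case False
  have "c (z b) (f (T j)) = f (T j)"
    using fT f_closed[OF T_sub(1) z_ge z_less, of b] False assms by (cases "b = 1") (auto simp: z_simps)
  then show ?thesis
    unfolding Tm_def using sub_closed_other[of o0 "z m" "z b" "f (T j)"] z_less assms False z_inj[of b m] z_ne(1)[of b]
      o_less' fT by simp
qed

lemma Km_closed:
  assumes "m < m'" "m' \<le> k + 2" "b \<le> k + 2" "b \<noteq> m" "b \<noteq> m'"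
  shows "c (z b) (Km m m' p s) = Km m m' p s"
proof (cases "b = 0")
  case True
  then show ?thesis
    unfolding Km_def
    using sub_closed_self[of o0 "z m" "sub o1 (z m') (f (K p s))"] z_less[of m] z_less[of m'] z_ne(1)[of m]
      o_less' fK assms by (simp add: z_simps)
next
  case False
  have lt: "z b < \<beta>" "z m < \<beta>" "z m' < \<beta>" using z_less assms by auto
  have "c (z b) (sub o1 (z m') (f (K p s))) = sub o1 (z m') (f (K p s))"
  proof (cases "b = 1")
    case True
    then show ?thesis
      using sub_closed_self[of o1 "z m'" "f (K p s)"] lt o_less' fK assms z_ne(2)[of m'] by (auto simp: z_simps)
  next
    case b: False
    have "c (z b) (f (K p s)) = f (K p s)"
      using f_closed[OF T_sub(2) z_ge z_less, of b] False b assms by simp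
    then show ?thesis
      using sub_closed_other[of o1 "z m'" "z b" "f (K p s)"] lt o_less' fK assms z_inj[of b m'] z_ne(2)[OF b] by simp
  qed
  then show ?thesis
    unfolding Km_def
    using sub_closed_other[of o0 "z m" "z b" "sub o1 (z m') (f (K p s))"] lt o_less' fK assms z_inj[of b m]
      z_ne(1)[OF False] by simp
qed

text \<open>The points at \<open>z m\<close> and \<open>z m'\<close> are moved to the coordinates 0
  and 1, where \<open>T_T\<close> applies. Coordinate 0 is overwritten first, and m < m' ensures
  that \<open>z m'\<close> is a different coordinate.\<close>

lemma Tm_Tm:
  assumes \<phi>: "st \<phi>" and m: "m < m'" "m' \<le> k + 2" and jl: "j \<noteq> l" and T: "\<phi> (Tm m j)" "\<phi> (Tm m' l)"
  shows "\<exists>p\<le>k. \<exists>s\<le>r. \<phi> (Km m m' p s)"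
proof -
  have lt: "z m < \<beta>" "z m' < \<beta>" using z_less m by auto
  have m0: "z m' \<noteq> o0" using z_ne(1)[of m'] m by auto
  define \<phi>1 where "\<phi>1 x = \<phi> (sub o0 (z m) x)" for x
  define \<phi>2 where "\<phi>2 x = \<phi>1 (sub o1 (z m') x)" for x
  have 1: "st \<phi>1" unfolding \<phi>1_def[abs_def] by (rule st_sub[OF \<phi> o_less'(1) lt(1)])
  have 2: "st \<phi>2" unfolding \<phi>2_def[abs_def] by (rule st_sub[OF 1 o_less'(2) lt(2)])
  let ?Y = "cyl A o0 (diag A o0 o1 \<inter> T l)"
  have "\<phi>2 (f (T j)) = \<phi>1 (f (T j))"
    unfolding \<phi>2_def by (rule sub_closed_id[OF 1 o_less'(2) lt(2) fT])
  then have a: "\<phi>2 (f (T j))" using T(1) by (simp add: \<phi>1_def Tm_def)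
  have "\<phi>2 (f ?Y) = \<phi>1 (sub o1 (z m') (sub o0 o1 (f (T l))))"
    using f_sub[OF T_sub(1), of o0 o1 l] o_less by (simp add: \<phi>2_def)
  also have "\<dots> = \<phi>1 (sub o0 (z m') (f (T l)))"
    by (rule sub_sub[OF 1 o_less'(1,2) lt(2) _ m0[symmetric] fT]) simp
  also have "\<dots> = \<phi> (sub o0 (z m') (f (T l)))"
    unfolding \<phi>1_def
    by (rule sub_closed_id[OF \<phi> o_less'(1) lt(1)]) (use o_less' lt m0 fT in \<open>auto intro: sub_closed_self\<close>)
  finally have b: "\<phi>2 (f ?Y)" using T(2) by (simp add: Tm_def)
  have Y: "?Y \<subseteq> e ` W" by (rule cyl_net_alg_subset)
  have "\<phi>2 (f (T j \<inter> ?Y))"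
    using a b f_meet[OF T_sub(1) Y] stD(1)[OF 2 f_in[OF T_sub(1)] f_in[OF Y]] by simp
  then have "\<phi>2 (f (\<Union>(p, s)\<in>{..k} \<times> {..r}. K p s))"
    by (rule f_mono[OF 2 T_T[OF jl], rotated]) (use T_sub(2) in blast)
  then have "\<exists>x\<in>{..k} \<times> {..r}. \<phi>2 (f (case x of (p, s) \<Rightarrow> K p s))"
    by (intro f_Union[OF 2]) (use T_sub(2) in auto)
  then show ?thesis by (auto simp: \<phi>2_def \<phi>1_def Km_def)
qed

text \<open>The three points are moved to the coordinates 0, 1 and 2, where \<open>K_K\<close>
  applies. Coordinate 2 can be overwritten here, since \<open>K p s\<close> does not depend on
  it.\<close>

lemma Km_Km:
  assumes \<phi>: "st \<phi>" and m: "m < m'" "m' < m''" "m'' \<le> k + 2"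
  shows "\<not> (\<phi> (Km m m' p s) \<and> \<phi> (Km m m'' p s) \<and> \<phi> (Km m' m'' p s'))"
proof
  assume K: "\<phi> (Km m m' p s) \<and> \<phi> (Km m m'' p s) \<and> \<phi> (Km m' m'' p s')"
  have lt: "z m < \<beta>" "z m' < \<beta>" "z m'' < \<beta>" using z_less m by auto
  have ne: "z m' \<noteq> o0" "z m'' \<noteq> o0" "z m'' \<noteq> o1" "z m'' \<noteq> o2"
    using z_ne(1)[of m'] z_ne[of m''] m by auto
  have on: "o0 \<noteq> o1" "o1 \<noteq> o2" "o0 \<noteq> o2" by simp_all
  define \<phi>1 where "\<phi>1 x = \<phi> (sub o0 (z m) x)" for x
  define \<phi>2 where "\<phi>2 x = \<phi>1 (sub o1 (z m') x)" for x
  define \<phi>3 where "\<phi>3 x = \<phi>2 (sub o2 (z m'') x)" for x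
  have 1: "st \<phi>1" unfolding \<phi>1_def[abs_def] by (rule st_sub[OF \<phi> o_less'(1) lt(1)])
  have 2: "st \<phi>2" unfolding \<phi>2_def[abs_def] by (rule st_sub[OF 1 o_less'(2) lt(2)])
  have 3: "st \<phi>3" unfolding \<phi>3_def[abs_def] by (rule st_sub[OF 2 o_less'(3) lt(3)])
  define y where "y s = sub o1 (z m'') (f (K p s))" for s
  have y: "y s \<in> C" "c o1 (y s) = y s" for s
    unfolding y_def using o_less' lt ne fK by (auto intro: sub_closed_self)
  let ?L = "\<lambda>s. cyl A o1 (diag A o1 o2 \<inter> K p s)"
  have L: "?L s \<subseteq> e ` W" for s by (rule cyl_net_alg_subset)
  have fL: "f (?L s) = sub o1 o2 (f (K p s))" for s using f_sub[OF T_sub(2)] o_less on by simp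
  let ?X = "cyl A o0 (diag A o0 o1 \<inter> ?L s')"
  have X: "?X \<subseteq> e ` W" by (rule cyl_net_alg_subset)
  have fX: "f ?X = sub o0 o1 (sub o1 o2 (f (K p s')))"
    using f_sub[OF L, of o0 o1 s'] fL o_less on by simp
  have "\<phi>3 (f (K p s)) = \<phi>2 (f (K p s))"
    unfolding \<phi>3_def by (rule sub_closed_id[OF 2 o_less'(3) lt(3) fK])
  then have a: "\<phi>3 (f (K p s))" using K by (simp add: \<phi>2_def \<phi>1_def Km_def)
  have "\<phi>3 (f (?L s)) = \<phi>2 (y s)"
    unfolding \<phi>3_def fL y_def by (rule sub_sub[OF 2 o_less'(2,3) lt(3) on(2) ne(3)[symmetric] fK])
  also have "\<dots> = \<phi>1 (y s)" unfolding \<phi>2_def by (rule sub_closed_id[OF 1 o_less'(2) lt(2) y])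
  finally have b: "\<phi>3 (f (?L s))" using K by (simp add: \<phi>1_def Km_def y_def)
  define \<psi> where "\<psi> x = \<phi>2 (sub o0 o1 x)" for x
  have \<psi>: "st \<psi>" unfolding \<psi>_def[abs_def] by (rule st_sub[OF 2 o_less'(1,2)])
  have "\<phi>3 (f ?X) = \<psi> (sub o2 (z m'') (sub o1 o2 (f (K p s'))))"
    unfolding \<phi>3_def fX \<psi>_def
    by (rule sub_comm[OF 2 o_less'(3) lt(3) o_less'(1,2)]) (use on ne o_less' fK in auto)
  also have "\<dots> = \<psi> (y s')"
    unfolding y_def by (rule sub_sub[OF \<psi> o_less'(2,3) lt(3) on(2) ne(3)[symmetric] fK])
  also have "\<dots> = \<phi>1 (sub o0 (z m') (y s'))"
    unfolding \<psi>_def \<phi>2_def by (rule sub_sub[OF 1 o_less'(1,2) lt(2) on(1) ne(1)[symmetric] y])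
  also have "\<dots> = \<phi> (sub o0 (z m') (y s'))"
    unfolding \<phi>1_def
    by (rule sub_closed_id[OF \<phi> o_less'(1) lt(1)]) (use o_less' lt ne y in \<open>auto intro: sub_closed_self\<close>)
  finally have c: "\<phi>3 (f ?X)" using K by (simp add: Km_def y_def)
  have "\<phi>3 (f (K p s \<inter> ?L s \<inter> ?X))"
    using a b c stD(1)[OF 3] f_in T_sub(2) L X f_meet[of "K p s \<inter> ?L s" ?X] f_meet[OF T_sub(2) L]
    by (simp add: inf.coboundedI1)
  then show False unfolding K_K f_zer using stD(4)[OF 3] by blast
qed

text \<open>A point of kind \<open>j\<close> at \<open>z b\<close>, joined to the pins at
  \<open>z 0\<close>, \<open>z 1\<close>, ... as the list \<open>ps\<close> prescribes. Under
  \<open>c (z b)\<close> it becomes the statement that such a point exists, and the coordinate is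
  free again.\<close>

definition V :: "(nat \<times> nat) list \<Rightarrow> nat \<Rightarrow> nat \<Rightarrow> 'b" where
  "V ps b j = foldr (\<lambda>a x. Km a b (fst (ps ! a)) (snd (ps ! a)) \<sqinter> x) [0..<length ps] (Tm b j)"

lemma V_props:
  assumes "length ps \<le> b" "b \<le> k + 2"
  shows "V ps b j \<in> C"
    "st \<phi> \<Longrightarrow> \<phi> (V ps b j) \<longleftrightarrow> \<phi> (Tm b j) \<and> (\<forall>a<length ps. \<phi> (Km a b (fst (ps ! a)) (snd (ps ! a))))"
    "b' \<le> k + 2 \<Longrightarrow> length ps \<le> b' \<Longrightarrow> b' \<noteq> b \<Longrightarrow> c (z b') (V ps b j) = V ps b j"
proof -
  let ?F = "\<lambda>xs. foldr (\<lambda>a x. Km a b (fst (ps ! a)) (snd (ps ! a)) \<sqinter> x) xs (Tm b j)"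
  have C: "?F xs \<in> C" if "set xs \<subseteq> {..<b}" for xs
    using that by (induction xs) (use assms Tm_in Km_in in auto)
  show "V ps b j \<in> C" unfolding V_def by (rule C) (use assms in auto)
  have "\<phi> (?F xs) \<longleftrightarrow> \<phi> (Tm b j) \<and> (\<forall>a\<in>set xs. \<phi> (Km a b (fst (ps ! a)) (snd (ps ! a))))"
    if "st \<phi>" "set xs \<subseteq> {..<b}" for xs
    using that(2)
  proof (induction xs)
    case (Cons a xs)
    then have "Km a b (fst (ps ! a)) (snd (ps ! a)) \<in> C" "?F xs \<in> C" using assms C by (auto intro: Km_in)
    then show ?case using Cons stD(1)[OF that(1)] by auto
  qed simp
  moreover have "set [0..<length ps] \<subseteq> {..<b}" using assms by auto
  ultimately show "st \<phi> \<Longrightarrow> \<phi> (V ps b j) \<longleftrightarrow> \<phi> (Tm b j) \<and> (\<forall>a<length ps. \<phi> (Km a b (fst (ps ! a)) (snd (ps ! a))))"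
    unfolding V_def by (simp add: Ball_def)
  assume b': "b' \<le> k + 2" "length ps \<le> b'" "b' \<noteq> b"
  have "c (z b') (?F xs) = ?F xs" if "set xs \<subseteq> {..<b} \<inter> {..<b'}" for xs
    using that
  proof (induction xs)
    case Nil
    then show ?case using Tm_closed[OF assms(2) b'(1,3)] by simp
  next
    case (Cons a xs)
    let ?x = "Km a b (fst (ps ! a)) (snd (ps ! a))"
    have "?x \<in> C" "?F xs \<in> C" "c (z b') ?x = ?x"
      using Cons.prems assms C b' by (auto intro: Km_in Km_closed)
    then show ?case using Cons closed_meet[OF z_less[OF b'(1)], of ?x "?F xs"] by simp
  qed
  then show "c (z b') (V ps b j) = V ps b j"
    unfolding V_def by this (use assms b' in auto)
qed

lemma Tm_shift:
  assumes "st \<phi>" "m \<le> k + 2" "m' \<le> k + 2" "m \<noteq> m'" "m' \<noteq> 0" "\<phi> (d (z m) (z m'))" "\<phi> (Tm m j)"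
  shows "\<phi> (Tm m' j)"
  unfolding Tm_def
  by (rule sub_diag[OF assms(1) o_less'(1) z_less[OF assms(2)] z_less[OF assms(3)] _ _ fT(1) assms(6) assms(7)[unfolded Tm_def]])
    (use z_inj[of m m'] z_ne(1)[of m'] assms in auto)

lemma Km_shift:
  assumes \<phi>: "st \<phi>" and a: "a < m" "m < m'" "m' \<le> k + 2" and dg: "\<phi> (d (z m) (z m'))" and K: "\<phi> (Km a m p s)"
  shows "\<phi> (Km a m' p s)"
proof -
  have lt: "z a < \<beta>" "z m < \<beta>" "z m' < \<beta>" using z_less a by auto
  define \<phi>1 where "\<phi>1 x = \<phi> (sub o0 (z a) x)" for x
  have 1: "st \<phi>1" unfolding \<phi>1_def[abs_def] by (rule st_sub[OF \<phi> o_less'(1) lt(1)])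
  have "c o0 (d (z m) (z m')) = d (z m) (z m')"
    by (rule diag_closed) (use lt o_less' z_ne(1)[of m] z_ne(1)[of m'] a in auto)
  then have "\<phi>1 (d (z m) (z m'))"
    unfolding \<phi>1_def using sub_closed_id[OF \<phi> o_less'(1) lt(1), of "d (z m) (z m')"] dg lt by simp
  from sub_diag[OF 1 o_less'(2) lt(2,3) _ _ fK(1) this] K show ?thesis
    using z_inj[of m m'] z_ne(2)[of m'] a by (auto simp: \<phi>1_def Km_def)
qed

text \<open>A change of bound variable: the witness at \<open>z m\<close> is copied to the next
  coordinate, which vacates \<open>z m\<close> for a new pin.\<close>

lemma V_swap:
  assumes \<phi>: "st \<phi>" and m: "length ps = m" "m + 1 \<le> k + 2" and h: "\<phi> (c (z m) (V ps m j))"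
  shows "\<phi> (c (z (m + 1)) (V ps (m + 1) j))"
proof -
  have lt: "z m < \<beta>" "z (m + 1) < \<beta>" using z_less m by auto
  have Vm: "V ps m j \<in> C" "V ps (m + 1) j \<in> C" using V_props(1) m by auto
  obtain \<psi> where \<psi>: "st \<psi>" "eqv (z m) \<phi> \<psi>" "\<psi> (V ps m j)" using h st_cyl[OF \<phi> lt(1) Vm(1)] by blast
  obtain \<chi> where \<chi>: "st \<chi>" "eqv (z (m + 1)) \<psi> \<chi>" "\<chi> (d (z m) (z (m + 1)))"
    using st_diag_cyl(2)[OF \<psi>(1) lt(2,1)] st_cyl[OF \<psi>(1) lt(2), of "d (z m) (z (m + 1))"] z_inj[of "m + 1" m] lt
    by auto
  have "\<chi> (V ps m j)" using eqvD[OF \<chi>(2) Vm(1)] V_props(3)[of ps m "m + 1" j] m \<psi>(3) by simp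
  then have "\<chi> (V ps (m + 1) j)"
    using V_props(2)[OF _ _ \<chi>(1), of ps m j] V_props(2)[OF _ _ \<chi>(1), of ps "m + 1" j] m
      Tm_shift[OF \<chi>(1), of m "m + 1" j] Km_shift[OF \<chi>(1), of _ m "m + 1"] \<chi>(3) by auto
  then have "\<psi> (c (z (m + 1)) (V ps (m + 1) j))" using st_cyl[OF \<psi>(1) lt(2) Vm(2)] \<chi> by blast
  moreover have "c (z m) (c (z (m + 1)) (V ps (m + 1) j)) = c (z (m + 1)) (V ps (m + 1) j)"
    using cyl_axioms(4)[OF lt Vm(2)] V_props(3)[of ps "m + 1" m j] m by simp
  ultimately show ?thesis using eqvD[OF \<psi>(2), of "c (z (m + 1)) (V ps (m + 1) j)"] lt Vm by simp
qed

text \<open>The pins at the first coordinates carry the colours of the list \<open>ps\<close> towards all remaining points;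
  a new pin needs a new colour, because any earlier colour is excluded by a triangle.\<close>

lemma ramsey_step:
  assumes \<phi>: "st \<phi>" and m: "length ps = m" "m \<le> k + 1" and Q: "infinite Q"
    and h: "\<And>j. j \<in> Q \<Longrightarrow> \<phi> (c (z m) (V ps m j))"
  shows "\<exists>\<psi> R x. st \<psi> \<and> infinite R \<and> x \<in> {..k} \<times> {..r} \<and> fst x \<notin> fst ` set ps \<and>
    (\<forall>j\<in>R. \<psi> (c (z (m + 1)) (V (ps @ [x]) (m + 1) j)))"
proof -
  have mk: "m \<le> k + 2" "m + 1 \<le> k + 2" using m by auto
  have lt: "z m < \<beta>" "z (m + 1) < \<beta>" using z_less mk by auto
  have V_in: "V ps m j \<in> C" "V ps (m + 1) j \<in> C" "V (ps @ [x]) (m + 1) j \<in> C" for j x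
    using V_props(1) m mk by auto
  \<comment> \<open>The new pin has kind \<open>i\<close>; it is fixed at \<open>z m\<close> by
    passing from \<phi> to a suitable variant \<psi>.\<close>
  obtain i where i: "i \<in> Q" using Q by (metis finite.emptyI ex_in_conv)
  obtain \<psi> where \<psi>: "st \<psi>" "eqv (z m) \<phi> \<psi>" "\<psi> (V ps m i)"
    using h[OF i] st_cyl[OF \<phi> lt(1) V_in(1)] by blast
  have "\<exists>x\<in>{..k} \<times> {..r}. fst x \<notin> fst ` set ps \<and> \<psi> (c (z (m + 1)) (V (ps @ [x]) (m + 1) j))"
    if j: "j \<in> Q - {i}" for j
  proof -
    have "\<psi> (c (z m) (V ps m j))"
      using h[of j] j eqvD[OF \<psi>(2), of "c (z m) (V ps m j)"] cyl_cyl[OF lt(1) V_in(1)] lt V_in by simp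
    then have "\<psi> (c (z (m + 1)) (V ps (m + 1) j))" by (rule V_swap[OF \<psi>(1) m(1) mk(2)])
    then obtain \<chi> where \<chi>: "st \<chi>" "eqv (z (m + 1)) \<psi> \<chi>" "\<chi> (V ps (m + 1) j)"
      using st_cyl[OF \<psi>(1) lt(2) V_in(2)] by blast
    have "\<chi> (V ps m i)" using eqvD[OF \<chi>(2) V_in(1)] V_props(3)[of ps m "m + 1" i] m mk \<psi>(3) by simp
    then have 1: "\<chi> (Tm m i)" "\<And>a. a < m \<Longrightarrow> \<chi> (Km a m (fst (ps ! a)) (snd (ps ! a)))"
      using V_props(2)[of ps m \<chi> i] m mk \<chi>(1) by auto
    have 2: "\<chi> (Tm (m + 1) j)" "\<And>a. a < m \<Longrightarrow> \<chi> (Km a (m + 1) (fst (ps ! a)) (snd (ps ! a)))"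
      using \<chi>(3) V_props(2)[of ps "m + 1" \<chi> j] m mk \<chi>(1) by auto
    obtain p s where ps: "p \<le> k" "s \<le> r" "\<chi> (Km m (m + 1) p s)"
      using Tm_Tm[OF \<chi>(1) _ mk(2) _ 1(1) 2(1)] j by auto
    \<comment> \<open>Pin \<open>a\<close> is joined to \<open>z m\<close> and to
      \<open>z (m + 1)\<close> in the same colour and shade, so the edge between these two must
      avoid that colour.\<close>
    have "p \<noteq> fst (ps ! a)" if "a < m" for a
      using Km_Km[OF \<chi>(1) that _ mk(2), of "fst (ps ! a)" "snd (ps ! a)" s] 1(2)[OF that] 2(2)[OF that] ps(3) by auto
    then have new: "p \<notin> fst ` set ps" using m(1) by (metis imageE in_set_conv_nth)
    have "\<chi> (V (ps @ [(p, s)]) (m + 1) j)"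
      using V_props(2)[of "ps @ [(p, s)]" "m + 1" \<chi> j] m mk \<chi>(1) 2 ps(3) by (auto simp: nth_append less_Suc_eq)
    then have "\<psi> (c (z (m + 1)) (V (ps @ [(p, s)]) (m + 1) j))"
      using st_cyl[OF \<psi>(1) lt(2) V_in(3)] \<chi> by blast
    then show ?thesis using ps new by (intro bexI[of _ "(p, s)"]) auto
  qed
  then obtain x where x: "\<And>j. j \<in> Q - {i} \<Longrightarrow> x j \<in> {..k} \<times> {..r} \<and> fst (x j) \<notin> fst ` set ps \<and>
      \<psi> (c (z (m + 1)) (V (ps @ [x j]) (m + 1) j))"
    by metis
  have "x ` (Q - {i}) \<subseteq> {..k} \<times> {..r}" using x by blast
  then have "finite (x ` (Q - {i}))" by (rule finite_subset) simp
  from pigeonhole_infinite[OF _ this] Q obtain j0 where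
    j0: "j0 \<in> Q - {i}" "infinite {j \<in> Q - {i}. x j = x j0}" by auto
  have "\<psi> (c (z (m + 1)) (V (ps @ [x j0]) (m + 1) j))" if "j \<in> {j \<in> Q - {i}. x j = x j0}" for j
    using x[of j] that by auto
  moreover have "x j0 \<in> {..k} \<times> {..r}" "fst (x j0) \<notin> fst ` set ps" using x[OF j0(1)] by simp_all
  ultimately show ?thesis using \<psi>(1) j0(2) by (intro exI conjI ballI)
qed

text \<open>Pins in k + 1 distinct colours use up all colours. The k + 3 coordinates still allow one
  more step at this moment, and that step would need yet another colour.\<close>

lemma ramsey:
  assumes "length ps + n = k + 1" "distinct (map fst ps)" "fst ` set ps \<subseteq> {..k}" "infinite Q" "st \<phi>"
    and "\<And>j. j \<in> Q \<Longrightarrow> \<phi> (c (z (length ps)) (V ps (length ps) j))"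
  shows False
  using assms
proof (induction n arbitrary: ps Q \<phi>)
  case (0 ps Q \<phi>)
  obtain x where x: "x \<in> {..k} \<times> {..r}" "fst x \<notin> fst ` set ps"
    using ramsey_step[OF 0(5) refl _ 0(4,6)] 0(1) by auto
  have "card (fst ` set ps) = card {..k}"
    using 0(1,2) distinct_card[OF 0(2)] by simp
  then have "fst ` set ps = {..k}" using 0(3) by (intro card_subset_eq) auto
  then show False using x by auto
next
  case (Suc n ps Q \<phi>)
  obtain \<psi> R x where x: "st \<psi>" "infinite R" "x \<in> {..k} \<times> {..r}" "fst x \<notin> fst ` set ps"
    "\<And>j. j \<in> R \<Longrightarrow> \<psi> (c (z (length ps + 1)) (V (ps @ [x]) (length ps + 1) j))"
    using ramsey_step[OF Suc.prems(5) refl _ Suc.prems(4,6)] Suc.prems(1) by auto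
  show False
    by (rule Suc.IH[of "ps @ [x]" R \<psi>]) (use Suc.prems x in auto)
qed

text \<open>An ultrafilter through the image of \<open>cyl A o0 (T 0)\<close> contains the images
  for all kinds by \<open>cyl_T_sub\<close>, so the argument starts with infinitely many kinds and
  no pins.\<close>

lemma contradiction: False
proof -
  let ?X = "cyl A o0 (T 0)"
  have X: "?X \<subseteq> e ` W" by (rule cyl_net_alg_subset)
  obtain N where N: "N \<in> W" "e N \<in> T 0" using T_nonempty[of 0] T_sub(1)[of 0] by blast
  have "e N \<in> ?X" unfolding in_cyl[OF N(1)] using N agree_refl[of o0 N] by blast
  then have "f ?X \<noteq> f {}" using inj_onD[OF f_inj, of ?X "{}"] X by auto
  then obtain \<phi> where \<phi>: "st \<phi>" "\<phi> (f ?X)" using state_exists[of "f ?X"] f_in[OF X] f_zer by auto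
  have "\<phi> (c (z 0) (V [] 0 j))" for j
  proof -
    have "\<phi> (f (cyl A o0 (T j)))" by (rule f_mono[OF \<phi>(1) cyl_T_sub cyl_net_alg_subset(1) \<phi>(2)])
    then show ?thesis
      using f_cyl[OF T_sub(1), of o0 j] o_less by (simp add: V_def Tm_def z_simps sub_def)
  qed
  then show False using ramsey[of "[]" "k + 1" "UNIV :: nat set" \<phi>] \<phi>(1) by simp
qed

end

lemma net_alg_not_in_SNr_CA:
  fixes \<alpha> :: "'i::{wellorder,no_top}" and e :: "'i network \<Rightarrow> 'w"
  assumes \<alpha>: "ord_nat 2 < \<alpha>" and e: "inj e"
  shows "net_alg e (nets \<alpha> k r 0) \<notin> SNr_CA \<alpha> (ord_plus \<alpha> (k + 1))"
proof
  assume "net_alg e (nets \<alpha> k r 0) \<in> SNr_CA \<alpha> (ord_plus \<alpha> (k + 1))"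
  then obtain B :: "('i, ('i, 'w set) cterm) cyl_alg" and C where
    B: "B \<in> CA (ord_plus \<alpha> (k + 1))" "subalgebra \<alpha> C (neat_reduct \<alpha> (ord_plus \<alpha> (k + 1)) B)"
      "isomorphic \<alpha> (net_alg e (nets \<alpha> k r 0)) C"
    by (auto simp: SNr_CA_def)
  obtain f where f: "cyl_hom \<alpha> (net_alg e (nets \<alpha> k r 0)) (neat_reduct \<alpha> (ord_plus \<alpha> (k + 1)) B) f"
    "inj_on f (carrier (net_alg e (nets \<alpha> k r 0)))"
    using iso_subalgebra_imp_embedding[OF B(2,3)] by blast
  interpret dilation \<alpha> k r e B f
    by unfold_locales (simp_all only: \<alpha> e B(1) f(1) f(2)[unfolded net_alg_sel])
  show False by (rule contradiction)
qed

section \<open>Ultrafilters\<close>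

definition ultra :: "'x filter \<Rightarrow> bool" where
  "ultra U \<longleftrightarrow> U \<noteq> bot \<and> (\<forall>P. eventually P U \<or> eventually (\<lambda>x. \<not> P x) U)"

lemma ultra_not: "ultra U \<Longrightarrow> eventually (\<lambda>x. \<not> P x) U \<longleftrightarrow> \<not> eventually P U"
  unfolding ultra_def using eventually_conj[of P U "\<lambda>x. \<not> P x"] by (auto simp: trivial_limit_def)

lemma ultra_disj: "ultra U \<Longrightarrow> eventually (\<lambda>x. P x \<or> Q x) U \<longleftrightarrow> eventually P U \<or> eventually Q U"
  using ultra_not[of U P] ultra_not[of U Q] ultra_not[of U "\<lambda>x. P x \<or> Q x"]
  by (auto simp: eventually_conj_iff)

lemma ultra_const: "ultra U \<Longrightarrow> eventually (\<lambda>x. P) U \<longleftrightarrow> P"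
  by (cases P) (auto simp: ultra_def trivial_limit_def)

text \<open>A power set is a cylindric algebra of dimension 0, so the Boolean ultrafilter theorem
  proved above can be reused.\<close>

lemma ultrafilter_below:
  assumes F: "F \<noteq> bot"
  shows "\<exists>U. ultra U \<and> U \<le> (F :: 'x filter)"
proof -
  define B :: "(nat, 'x set) cyl_alg" where
    "B = \<lparr>carrier = UNIV, join = (\<union>), meet = (\<inter>), compl = uminus, zer = {}, one = UNIV,
      cyl = (\<lambda>i X. X), diag = (\<lambda>i j. UNIV)\<rparr>"
  have sel: "carrier B = UNIV" "join B = (\<union>)" "meet B = (\<inter>)" "compl B = uminus" "zer B = {}" "one B = UNIV"
    by (simp_all add: B_def)
  have "B \<in> CA 0"
    unfolding CA_def cyl_type_def boolean_axioms_def mem_Collect_eq sel by auto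
  then interpret cyl_algebra 0 B by unfold_locales
  have "prop_filter {S. eventually (\<lambda>x. x \<in> S) F}"
    unfolding prop_filter_def sel using F by (auto simp: trivial_limit_def eventually_conj elim: eventually_mono)
  from ultrafilter_exists[OF this] obtain \<phi>
    where \<phi>: "st \<phi>" "\<And>S. eventually (\<lambda>x. x \<in> S) F \<Longrightarrow> \<phi> S" by auto
  note S = stD[OF \<phi>(1), unfolded sel, simplified]
  have mono: "\<phi> Y" if "\<phi> X" "X \<subseteq> Y" for X Y
    using S(1)[of X Y] that by (simp add: Int_absorb2)
  have "is_filter (\<lambda>P. \<phi> {x. P x})"
  proof
    show "\<phi> {x. P x \<and> Q x}" if "\<phi> {x. P x}" "\<phi> {x. Q x}" for P Q
      using S(1)[of "{x. P x}" "{x. Q x}"] that by (simp add: Collect_conj_eq)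
    show "\<phi> {x. Q x}" if "\<forall>x. P x \<longrightarrow> Q x" "\<phi> {x. P x}" for P Q by (rule mono[OF that(2)]) (use that(1) in auto)
  qed (use S(5) in simp)
  then have ev: "eventually P (Abs_filter (\<lambda>P. \<phi> {x. P x})) \<longleftrightarrow> \<phi> {x. P x}" for P
    by (rule eventually_Abs_filter)
  have "ultra (Abs_filter (\<lambda>P. \<phi> {x. P x}))"
    unfolding ultra_def trivial_limit_def ev using S(3) S(4) by (auto simp: Collect_neg_eq)
  moreover have "Abs_filter (\<lambda>P. \<phi> {x. P x}) \<le> F"
    unfolding le_filter_def ev using \<phi>(2) by auto
  ultimately show ?thesis by blast
qed

text \<open>An ultrafilter finer than \<open>finite_subsets_at_top\<close>: in the limit every
  single element is present, although each stage is finite.\<close>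

lemma ultrafilter_finite_subsets:
  "\<exists>U :: 'x set filter. ultra U \<and> eventually finite U \<and> (\<forall>x. eventually (\<lambda>X. x \<in> X) U)"
proof -
  obtain U :: "'x set filter" where U: "ultra U" "U \<le> finite_subsets_at_top UNIV"
    using ultrafilter_below[OF finite_subsets_at_top_neq_bot] by blast
  have "eventually finite (finite_subsets_at_top (UNIV :: 'x set))"
    by (auto simp: eventually_finite_subsets_at_top intro: exI[of _ "{}"])
  moreover have "eventually (\<lambda>X. x \<in> X) (finite_subsets_at_top (UNIV :: 'x set))" for x
    unfolding eventually_finite_subsets_at_top by (rule exI[of _ "{x}"]) auto
  ultimately show ?thesis using U filter_leD[OF U(2)] by blast
qed

lemma ultra_nonprincipal: "nonprincipal_ultrafilter F \<Longrightarrow> ultra F"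
  by (simp add: nonprincipal_ultrafilter_def ultra_def)

lemma nonprincipal_ge:
  assumes F: "nonprincipal_ultrafilter (F :: nat filter)"
  shows "eventually (\<lambda>r. n \<le> r) F"
proof (induction n)
  case (Suc n)
  have "eventually (\<lambda>r. r \<noteq> n) F"
    using F ultra_not[OF ultra_nonprincipal[OF F]] by (simp add: nonprincipal_ultrafilter_def)
  with Suc show ?case by eventually_elim auto
qed simp

lemma nonprincipal_exists: "\<exists>F :: nat filter. nonprincipal_ultrafilter F"
proof -
  obtain U :: "nat filter" where U: "ultra U" "U \<le> sequentially"
    using ultrafilter_below[OF sequentially_bot] by blast
  have "\<not> eventually (\<lambda>x. x = r) U" for r
  proof -
    have "eventually (\<lambda>x. x \<noteq> r) U"
      using filter_leD[OF U(2) eventually_gt_at_top[of r]] by (rule eventually_mono) simp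
    then show ?thesis using ultra_not[OF U(1)] by blast
  qed
  with U(1) show ?thesis by (auto simp: nonprincipal_ultrafilter_def ultra_def)
qed

section \<open>Finite approximations of a representation\<close>

text \<open>Names of points of the representation. \<open>Witness i f \<sigma>\<close> names a witness for the demand that the
  sequence which varies the identity by \<open>\<sigma>\<close> lies in the \<open>i\<close>-th cylindrification of the element
  represented by \<open>f\<close>.\<close>

datatype ('i, 'f) name = Point 'i | Witness 'i 'f "('i \<times> ('i, 'f) name) list"

lemma size_name: "(l, v) \<in> set \<sigma> \<Longrightarrow> size v < size (Witness i f \<sigma>)"
  by (induction \<sigma>) auto

definition seq :: "(('i, 'f) name \<Rightarrow> 'i) \<Rightarrow> ('i \<times> ('i, 'f) name) list \<Rightarrow> 'i \<Rightarrow> 'i" where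
  "seq val \<sigma> l = (case map_of \<sigma> l of Some v \<Rightarrow> val v | None \<Rightarrow> l)"

lemma seq_cong: "(\<And>l v. (l, v) \<in> set \<sigma> \<Longrightarrow> val v = val' v) \<Longrightarrow> seq val \<sigma> = seq val' \<sigma>"
  by (auto simp: seq_def fun_eq_iff split: option.split dest: map_of_SomeD)

lemma fv_seq:
  assumes "\<And>v. val v < b" "a \<le> b"
  shows "fv a b (seq val \<sigma>)"
proof (rule fv_finite_change[OF fv_id[OF assms(2)], of "fst ` set \<sigma>"])
  show "seq val \<sigma> i = i" if "i \<notin> fst ` set \<sigma>" for i
    using that by (simp add: seq_def map_of_eq_None_iff[THEN iffD2])
  show "seq val \<sigma> i < b" if "i < a" for i
    using that assms by (auto simp: seq_def split: option.split)
qed simp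

text \<open>\<open>f\<close> selects an element in every algebra at once. Names therefore do not
  mention \<open>r\<close>, and one name serves as witness throughout the ultraproduct.\<close>

definition demand :: "'i::{wellorder,no_top} \<Rightarrow> ('i, 'w set) cyl_alg \<Rightarrow> ('i network \<Rightarrow> 'w) \<Rightarrow> nat \<Rightarrow> 'i network \<Rightarrow>
    (('i, nat \<Rightarrow> 'w set) name \<Rightarrow> 'i) \<Rightarrow> 'i \<Rightarrow> (nat \<Rightarrow> 'w set) \<Rightarrow> ('i \<times> ('i, nat \<Rightarrow> 'w set) name) list \<Rightarrow> bool" where
  "demand \<alpha> A e r N val i f \<sigma> \<longleftrightarrow>
     (i < \<alpha> \<and> e (pull \<alpha> (seq val \<sigma>) N) \<in> cyl A i (f r) \<longrightarrow>
      e (pull \<alpha> ((seq val \<sigma>)(i := val (Witness i f \<sigma>))) N) \<in> f r)"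

text \<open>A position of the game over the base network \<open>P\<close> after \<open>n\<close>
  added points. The valuation is total, but a \<open>Witness\<close> name outside \<Phi> is only
  required to denote some point.\<close>

definition approx :: "'i::{wellorder,no_top} \<Rightarrow> nat \<Rightarrow> nat \<Rightarrow> ('i network \<Rightarrow> 'w) \<Rightarrow> 'i network \<Rightarrow>
    ('i, nat \<Rightarrow> 'w set) name set \<Rightarrow> nat \<Rightarrow> 'i network \<Rightarrow> (('i, nat \<Rightarrow> 'w set) name \<Rightarrow> 'i) \<Rightarrow> bool" where
  "approx \<alpha> k r e P \<Phi> n N val \<longleftrightarrow>
     N \<in> nets \<alpha> k r n \<and> pull \<alpha> (\<lambda>i. i) N = P \<and> (\<forall>v. val v < ord_plus \<alpha> n) \<and> (\<forall>i<\<alpha>. val (Point i) = i) \<and>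
     (\<forall>i f \<sigma>. Witness i f \<sigma> \<in> \<Phi> \<longrightarrow> demand \<alpha> (net_alg e (nets \<alpha> k r 0)) e r N val i f \<sigma>)"

text \<open>A largest name is served last. The names inside the sequence of a demand are smaller
  than its witness, so the final assignment leaves all sequences in \<Phi> unchanged. Each demand
  costs at most one point, hence the same bound on \<open>r\<close> covers every extension
  made.\<close>

lemma approx_exists:
  assumes \<alpha>: "ord_nat 2 < \<alpha>" and k: "k \<ge> 1" and e: "inj e" and P: "P \<in> nets \<alpha> k r 0"
  shows "finite \<Phi> \<Longrightarrow> card \<Phi> = m \<Longrightarrow> (m + 2)^2 + (m + 2) \<le> r \<Longrightarrow> \<exists>n\<le>m. \<exists>N val. approx \<alpha> k r e P \<Phi> n N val"
proof (induction m arbitrary: \<Phi>)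
  case 0
  then have "\<Phi> = {}" by simp
  moreover have "pull \<alpha> (\<lambda>i. i) P = P" using pull_id[OF netsD(1)[OF P]] by simp
  ultimately have "approx \<alpha> k r e P \<Phi> 0 P (\<lambda>v. case v of Point i \<Rightarrow> if i < \<alpha> then i else ord_nat 0 | _ \<Rightarrow> ord_nat 0)"
    using P ord_nats_less[OF \<alpha>] by (simp add: approx_def split: name.split)
  then show ?case by blast
next
  case (Suc m)
  let ?A = "net_alg e (nets \<alpha> k r 0)"
  have ne: "\<Phi> \<noteq> {}" using Suc.prems by auto
  then have "Max (size ` \<Phi>) \<in> size ` \<Phi>" using Suc.prems(1) by (intro Max_in) auto
  then obtain w where w: "w \<in> \<Phi>" "size w = Max (size ` \<Phi>)" by auto
  then have max: "size v \<le> size w" if "v \<in> \<Phi>" for v using that Suc.prems(1) by simp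
  have mr: "(m + 2)^2 + (m + 2) \<le> r"
    using Suc.prems(3) power_mono[of "m + 2" "Suc m + 2" 2] by linarith
  obtain n N val where n: "n \<le> m" and a: "approx \<alpha> k r e P (\<Phi> - {w}) n N val"
    using Suc.IH[of "\<Phi> - {w}"] Suc.prems(1,2) w(1) mr by auto
  note a' = a[unfolded approx_def]
  have N: "N \<in> nets \<alpha> k r n" "pull \<alpha> (\<lambda>i. i) N = P" "\<And>v. val v < ord_plus \<alpha> n" "\<And>i. i < \<alpha> \<Longrightarrow> val (Point i) = i"
    and dem: "\<And>i f \<sigma>. Witness i f \<sigma> \<in> \<Phi> \<Longrightarrow> Witness i f \<sigma> \<noteq> w \<Longrightarrow> demand \<alpha> ?A e r N val i f \<sigma>"
    using a' by auto
  have s: "fv \<alpha> (ord_plus \<alpha> n) (seq val \<sigma>)" for \<sigma> by (rule fv_seq[OF N(3)]) simp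
  have inN: "e M \<in> cyl ?A i X \<longleftrightarrow> (\<exists>M'\<in>nets \<alpha> k r 0. e M' \<in> X \<and> agree i M M')" if "M \<in> nets \<alpha> k r 0" for M i X
    by (rule in_cyl_net_alg[OF inj_on_subset[OF e subset_UNIV] that])
  show ?case
  proof (cases "\<exists>i f \<sigma>. w = Witness i f \<sigma> \<and> \<not> demand \<alpha> ?A e r N val i f \<sigma>")
    case False
    then have "approx \<alpha> k r e P \<Phi> n N val" using N dem unfolding approx_def by metis
    then show ?thesis using n by (metis le_Suc_eq)
  next
    case True
    then obtain i f \<sigma> where wit: "w = Witness i f \<sigma>" "i < \<alpha>" "e (pull \<alpha> (seq val \<sigma>) N) \<in> cyl ?A i (f r)"
      unfolding demand_def by blast
    have N0: "pull \<alpha> (seq val \<sigma>) N \<in> nets \<alpha> k r 0" using nets_pull[OF N(1), of 0 "seq val \<sigma>"] s by simp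
    obtain N' where N': "N' \<in> nets \<alpha> k r 0" "e N' \<in> f r" "agree i (pull \<alpha> (seq val \<sigma>) N) N'"
      using wit(3) unfolding inN[OF N0] by blast
    have nr: "(n + 2)^2 + (n + 2) \<le> r"
      using mr power_mono[of "n + 2" "m + 2" 2] n by linarith
    obtain M where M: "M \<in> nets \<alpha> k r (Suc n)" "pull (ord_plus \<alpha> n) (\<lambda>a. a) M = N"
      "pull \<alpha> ((seq val \<sigma>)(i := ord_plus \<alpha> n)) M = N'"
      using nets_extend[OF \<alpha> k nr N(1) N'(1) s wit(2) N'(3)] by blast
    let ?val = "val(w := ord_plus \<alpha> n)"
    have MN: "pull \<alpha> t M = pull \<alpha> t N" if "\<And>l. l < \<alpha> \<Longrightarrow> t l < ord_plus \<alpha> n" for t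
      unfolding M(2)[symmetric] by (subst pull_pull) (use that in \<open>auto simp: comp_def\<close>)
    have seq_eq: "seq ?val \<tau> = seq val \<tau>" if "Witness i' f' \<tau> \<in> \<Phi>" for i' f' \<tau>
    proof (rule seq_cong)
      fix l v assume "(l, v) \<in> set \<tau>"
      then have "v \<noteq> w" using size_name[of l v \<tau> i' f'] max[OF that] by auto
      then show "?val v = val v" by simp
    qed
    have s_lt: "l < \<alpha> \<Longrightarrow> seq val \<tau> l < ord_plus \<alpha> n" for \<tau> l using s by (simp add: fv_def)
    have "approx \<alpha> k r e P \<Phi> (Suc n) M ?val"
      unfolding approx_def
    proof (intro conjI allI impI)
      show "pull \<alpha> (\<lambda>i. i) M = P" using MN[of "\<lambda>i. i"] N(2) less_ord_plus by blast
      show "?val v < ord_plus \<alpha> (Suc n)" for v using N(3)[of v] by (simp add: less_ord_plus_Suc)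
      show "?val (Point i') = i'" if "i' < \<alpha>" for i' using N(4)[OF that] wit(1) by simp
      fix i' f' \<tau> assume \<tau>: "Witness i' f' \<tau> \<in> \<Phi>"
      show "demand \<alpha> ?A e r M ?val i' f' \<tau>"
      proof (cases "Witness i' f' \<tau> = w")
        case True
        then have "i' = i" "f' = f" "\<tau> = \<sigma>" using wit(1) by auto
        then show ?thesis unfolding demand_def seq_eq[OF \<tau>] using M(3) N'(2) wit(1) by simp
      next
        case False
        have "pull \<alpha> (seq val \<tau>) M = pull \<alpha> (seq val \<tau>) N" by (rule MN) (rule s_lt)
        moreover have "pull \<alpha> ((seq val \<tau>)(i' := val (Witness i' f' \<tau>))) M = pull \<alpha> ((seq val \<tau>)(i' := val (Witness i' f' \<tau>))) N"
          by (rule MN) (use s_lt N(3) in auto)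
        ultimately show ?thesis
          using dem[OF \<tau> False] False unfolding demand_def seq_eq[OF \<tau>] by simp
      qed
    qed (rule M(1))
    then show ?thesis using n by (metis Suc_le_mono)
  qed
qed

section \<open>Representing the ultraproduct\<close>

text \<open>\<open>U\<close> lives on sets of coordinates, \<open>G\<close> on sets of demands. An
  arbitrary sequence is approximated by following it on a finite set \<open>J\<close> and keeping
  the base point elsewhere, which is a finite variation; \<open>J\<close> then tends to the limit
  along \<open>U\<close>.\<close>

locale representation =
  fixes \<alpha> :: "'i::{wellorder,no_top}" and k :: nat and e :: "'i network \<Rightarrow> 'w" and F :: "nat filter"
    and P :: "nat \<Rightarrow> 'i network" and U :: "'i set filter" and G :: "('i, nat \<Rightarrow> 'w set) name set filter"
  assumes \<alpha>: "ord_nat 2 < \<alpha>" and k: "k \<ge> 1" and e: "inj e" and F: "nonprincipal_ultrafilter F"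
    and P: "\<And>r. P r \<in> nets \<alpha> k r 0"
    and U: "ultra U" "eventually finite U" "\<And>i. eventually (\<lambda>J. i \<in> J) U"
    and G: "ultra G" "eventually finite G" "\<And>v. eventually (\<lambda>\<Phi>. v \<in> \<Phi>) G"
begin

abbreviation W where "W r \<equiv> nets \<alpha> k r 0"
abbreviation A where "A r \<equiv> net_alg e (W r)"

lemmas uF = ultra_nonprincipal[OF F]

definition pos :: "('i, nat \<Rightarrow> 'w set) name set \<Rightarrow> nat \<Rightarrow> 'i network \<times> (('i, nat \<Rightarrow> 'w set) name \<Rightarrow> 'i)" where
  "pos \<Phi> r = (SOME p. \<exists>n. approx \<alpha> k r e (P r) \<Phi> n (fst p) (snd p))"

abbreviation "N \<Phi> r \<equiv> fst (pos \<Phi> r)"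
abbreviation "vl \<Phi> r \<equiv> snd (pos \<Phi> r)"

definition good :: "('i, nat \<Rightarrow> 'w set) name set \<Rightarrow> nat \<Rightarrow> bool" where
  "good \<Phi> r \<longleftrightarrow> (\<exists>n. approx \<alpha> k r e (P r) \<Phi> n (N \<Phi> r) (vl \<Phi> r))"

text \<open>The order of the limits matters: a name may depend on \<open>J\<close>, almost every
  \<Phi> contains that name, and \<open>r\<close> has to be large for \<Phi>. Three ultrafilters
  make \<open>evv\<close> commute with all connectives.\<close>

definition evv :: "('i set \<Rightarrow> ('i, nat \<Rightarrow> 'w set) name set \<Rightarrow> nat \<Rightarrow> bool) \<Rightarrow> bool" where
  "evv Q \<longleftrightarrow> (\<forall>\<^sub>F J in U. \<forall>\<^sub>F \<Phi> in G. \<forall>\<^sub>F r in F. Q J \<Phi> r)"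

lemma evv_conj: "evv (\<lambda>J \<Phi> r. Q J \<Phi> r \<and> R J \<Phi> r) \<longleftrightarrow> evv Q \<and> evv R"
  by (simp add: evv_def eventually_conj_iff)

lemma evv_not: "evv (\<lambda>J \<Phi> r. \<not> Q J \<Phi> r) \<longleftrightarrow> \<not> evv Q"
  by (simp add: evv_def ultra_not[OF uF] ultra_not[OF G(1)] ultra_not[OF U(1)])

lemma evv_mono: "evv Q \<Longrightarrow> (\<And>J \<Phi> r. Q J \<Phi> r \<Longrightarrow> R J \<Phi> r) \<Longrightarrow> evv R"
  unfolding evv_def by (elim eventually_mono)

lemma evv_cong:
  assumes "evv C" "\<And>J \<Phi> r. C J \<Phi> r \<Longrightarrow> Q J \<Phi> r \<longleftrightarrow> R J \<Phi> r"
  shows "evv Q \<longleftrightarrow> evv R"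
proof -
  have "evv Q \<longleftrightarrow> evv (\<lambda>J \<Phi> r. C J \<Phi> r \<and> Q J \<Phi> r)" using assms(1) by (simp add: evv_conj)
  also have "\<dots> \<longleftrightarrow> evv (\<lambda>J \<Phi> r. C J \<Phi> r \<and> R J \<Phi> r)" by (simp add: assms(2) cong: conj_cong)
  also have "\<dots> \<longleftrightarrow> evv R" using assms(1) by (simp add: evv_conj)
  finally show ?thesis .
qed

lemma evv_disj: "evv (\<lambda>J \<Phi> r. Q J \<Phi> r \<or> R J \<Phi> r) \<longleftrightarrow> evv Q \<or> evv R"
  using evv_not[of "\<lambda>J \<Phi> r. Q J \<Phi> r \<or> R J \<Phi> r"] evv_not[of Q] evv_not[of R] by (auto simp: evv_conj)

lemma evv_False: "\<not> evv (\<lambda>J \<Phi> r. False)"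
  by (simp add: evv_def ultra_const[OF uF] ultra_const[OF G(1)] ultra_const[OF U(1)])

lemma evv_J: "eventually Q U \<Longrightarrow> evv (\<lambda>J \<Phi> r. Q J)"
  by (simp add: evv_def ultra_const[OF uF] ultra_const[OF G(1)])

lemma evv_r: "evv (\<lambda>J \<Phi> r. Q r) \<longleftrightarrow> eventually Q F"
  by (simp add: evv_def ultra_const[OF G(1)] ultra_const[OF U(1)])

lemma evv_\<Phi>: "evv (\<lambda>J \<Phi> r. x J \<in> \<Phi>)"
  using G(3) by (simp add: evv_def ultra_const[OF uF])

lemma evv_good: "evv (\<lambda>J \<Phi> r. good \<Phi> r \<and> finite J)"
proof -
  have "\<forall>\<^sub>F r in F. good \<Phi> r" if "finite \<Phi>" for \<Phi>
    using nonprincipal_ge[OF F, of "(card \<Phi> + 2)^2 + (card \<Phi> + 2)"]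
  proof eventually_elim
    case (elim r)
    from approx_exists[OF \<alpha> k e P that refl elim] have "\<exists>p. \<exists>n. approx \<alpha> k r e (P r) \<Phi> n (fst p) (snd p)" by auto
    then show ?case unfolding good_def pos_def by (rule someI_ex)
  qed
  then have "\<forall>\<^sub>F \<Phi> in G. \<forall>\<^sub>F r in F. good \<Phi> r" using G(2) by (auto elim: eventually_mono)
  then have "evv (\<lambda>J \<Phi> r. good \<Phi> r)" by (simp add: evv_def ultra_const[OF U(1)])
  then show ?thesis using evv_J[OF U(2)] by (simp add: evv_conj)
qed

lemma good_pull: "good \<Phi> r \<Longrightarrow> pull \<alpha> (\<lambda>i. i) (N \<Phi> r) = P r"
  and good_Point: "good \<Phi> r \<Longrightarrow> i < \<alpha> \<Longrightarrow> vl \<Phi> r (Point i) = i"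
  and good_demand: "good \<Phi> r \<Longrightarrow> Witness i f \<sigma> \<in> \<Phi> \<Longrightarrow> demand \<alpha> (A r) e r (N \<Phi> r) (vl \<Phi> r) i f \<sigma>"
  unfolding good_def approx_def by auto

lemma good:
  assumes "good \<Phi> r"
  obtains n where "N \<Phi> r \<in> nets \<alpha> k r n" "graph (ord_plus \<alpha> n) k r (N \<Phi> r)" "\<And>v. vl \<Phi> r v < ord_plus \<alpha> n"
  using assms netsD(1) unfolding good_def approx_def by metis

definition tr :: "('i \<Rightarrow> 'i set \<Rightarrow> ('i, nat \<Rightarrow> 'w set) name) \<Rightarrow> 'i set \<Rightarrow> ('i, nat \<Rightarrow> 'w set) name set \<Rightarrow> nat \<Rightarrow> 'i \<Rightarrow> 'i" where
  "tr x J \<Phi> r l = (if l \<in> J then vl \<Phi> r (x l J) else l)"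

definition net :: "('i \<Rightarrow> 'i set \<Rightarrow> ('i, nat \<Rightarrow> 'w set) name) \<Rightarrow> 'i set \<Rightarrow> ('i, nat \<Rightarrow> 'w set) name set \<Rightarrow> nat \<Rightarrow> 'i network" where
  "net x J \<Phi> r = pull \<alpha> (tr x J \<Phi> r) (N \<Phi> r)"

lemma fv_tr:
  assumes "finite J" "\<And>v. vl \<Phi> r v < ord_plus \<alpha> n"
  shows "fv \<alpha> (ord_plus \<alpha> n) (tr x J \<Phi> r)"
  by (rule fv_finite_change[OF fv_id[OF ord_plus_ge] assms(1)]) (use assms(2) less_ord_plus in \<open>auto simp: tr_def\<close>)

lemma tr_less:
  assumes "\<And>v. vl \<Phi> r v < ord_plus \<alpha> n" "l < \<alpha>"
  shows "tr x J \<Phi> r l < ord_plus \<alpha> n"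
  using assms by (auto simp: tr_def intro: less_ord_plus)

lemma net_in:
  assumes "good \<Phi> r" "finite J"
  shows "net x J \<Phi> r \<in> W r"
proof -
  obtain n where n: "N \<Phi> r \<in> nets \<alpha> k r n" "\<And>v. vl \<Phi> r v < ord_plus \<alpha> n"
    by (rule good[OF assms(1)]) (rule that)
  show ?thesis
    unfolding net_def using nets_pull[OF n(1), of 0 "tr x J \<Phi> r"] fv_tr[OF assms(2) n(2)] by simp
qed

lemma in_cyl: "M \<in> W r \<Longrightarrow> e M \<in> cyl (A r) i X \<longleftrightarrow> (\<exists>M'\<in>W r. e M' \<in> X \<and> agree i M M')"
  by (rule in_cyl_net_alg[OF inj_on_subset[OF e subset_UNIV]])

lemma in_diag: "M \<in> W r \<Longrightarrow> e M \<in> diag (A r) i j \<longleftrightarrow> M i j = Same"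
  by (rule in_diag_net_alg[OF inj_on_subset[OF e subset_UNIV]])

text \<open>Points of the representation are functions from \<open>J\<close> to names modulo this
  relation. For a sequence that moves infinitely many coordinates, the witness may be a different
  name at each stage \<open>J\<close>.\<close>

definition near :: "('i set \<Rightarrow> ('i, nat \<Rightarrow> 'w set) name) \<Rightarrow> ('i set \<Rightarrow> ('i, nat \<Rightarrow> 'w set) name) \<Rightarrow> bool" where
  "near x y \<longleftrightarrow> evv (\<lambda>J \<Phi> r. N \<Phi> r (vl \<Phi> r (x J)) (vl \<Phi> r (y J)) = Same)"

lemma near_refl: "near x x"
  unfolding near_def using evv_good
proof (rule evv_mono)
  fix J :: "'i set" and \<Phi> r assume "good \<Phi> r \<and> finite J"
  then have "good \<Phi> r" by simp
  then obtain n where "graph (ord_plus \<alpha> n) k r (N \<Phi> r)" by (rule good) (rule that)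
  then show "N \<Phi> r (vl \<Phi> r (x J)) (vl \<Phi> r (x J)) = Same" by (rule graphD(3))
qed

lemma near_trans:
  assumes "near x y" "near x z"
  shows "near y z"
  unfolding near_def
proof (rule evv_mono)
  show "evv (\<lambda>J \<Phi> r. (good \<Phi> r \<and> finite J) \<and> N \<Phi> r (vl \<Phi> r (x J)) (vl \<Phi> r (y J)) = Same \<and>
      N \<Phi> r (vl \<Phi> r (x J)) (vl \<Phi> r (z J)) = Same)"
    using assms evv_good unfolding near_def by (simp only: evv_conj)
  fix J \<Phi> r
  assume *: "(good \<Phi> r \<and> finite J) \<and> N \<Phi> r (vl \<Phi> r (x J)) (vl \<Phi> r (y J)) = Same \<and>
      N \<Phi> r (vl \<Phi> r (x J)) (vl \<Phi> r (z J)) = Same"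
  from * have "good \<Phi> r" by simp
  then obtain n where n: "graph (ord_plus \<alpha> n) k r (N \<Phi> r)" "\<And>v. vl \<Phi> r v < ord_plus \<alpha> n" by (rule good) (rule that)
  then show "N \<Phi> r (vl \<Phi> r (y J)) (vl \<Phi> r (z J)) = Same"
    using graphD(4)[OF n(1) n(2) n(2), of "x J" "y J" "vl \<Phi> r (z J)"] * by simp
qed

lemma near_sym: "near x y \<Longrightarrow> near y x"
  using near_trans near_refl by blast

abbreviation cls :: "('i set \<Rightarrow> ('i, nat \<Rightarrow> 'w set) name) \<Rightarrow> ('i set \<Rightarrow> ('i, nat \<Rightarrow> 'w set) name) set" where
  "cls x \<equiv> {y. near x y}"

text \<open>Constant representatives are preferred, so that the sequence of all \<open>Point i\<close> is the base point
  \<open>P r\<close> at every finite set of coordinates simultaneously.\<close>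

definition rep :: "('i set \<Rightarrow> ('i, nat \<Rightarrow> 'w set) name) set \<Rightarrow> 'i set \<Rightarrow> ('i, nat \<Rightarrow> 'w set) name" where
  "rep X = (if \<exists>l<\<alpha>. (\<lambda>_. Point l) \<in> X then (\<lambda>_. Point (SOME l. l < \<alpha> \<and> (\<lambda>_. Point l) \<in> X)) else (SOME x. x \<in> X))"

lemma rep_Point:
  assumes "l < \<alpha>"
  shows "\<exists>l'<\<alpha>. rep (cls (\<lambda>_. Point l)) = (\<lambda>_. Point l') \<and> near (\<lambda>_. Point l) (\<lambda>_. Point l')"
proof -
  have ex: "\<exists>l'. l' < \<alpha> \<and> (\<lambda>_. Point l') \<in> cls (\<lambda>_. Point l)" using near_refl assms by auto
  from someI_ex[OF this] show ?thesis using ex by (auto simp: rep_def)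
qed

lemma near_rep: "near x (rep (cls x))"
proof (cases "\<exists>l<\<alpha>. (\<lambda>_. Point l) \<in> cls x")
  case True
  then have "\<exists>l. l < \<alpha> \<and> (\<lambda>_. Point l) \<in> cls x" by blast
  from someI_ex[OF this] show ?thesis using True by (auto simp: rep_def)
next
  case False
  have "(SOME y. y \<in> cls x) \<in> cls x" by (rule someI[of _ x]) (simp add: near_refl)
  then show ?thesis unfolding rep_def if_not_P[OF False] by simp
qed

definition V :: "('i set \<Rightarrow> ('i, nat \<Rightarrow> 'w set) name) set set" where
  "V = range (\<lambda>x. {y. near x y})"

lemma rep_eq: "u \<in> V \<Longrightarrow> v \<in> V \<Longrightarrow> near (rep u) (rep v) \<longleftrightarrow> u = v"
proof -
  assume "u \<in> V" "v \<in> V"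
  then obtain x y where xy: "u = cls x" "v = cls y" by (auto simp: V_def)
  have "near (rep u) (rep v) \<longleftrightarrow> near x y"
    using near_rep[of x] near_rep[of y] near_trans near_sym unfolding xy by metis
  also have "\<dots> \<longleftrightarrow> cls x = cls y" using near_trans near_sym near_refl by blast
  finally show ?thesis by (simp add: xy)
qed

definition h :: "(nat \<Rightarrow> 'w set) \<Rightarrow> ('i \<Rightarrow> ('i set \<Rightarrow> ('i, nat \<Rightarrow> 'w set) name) set) set" where
  "h f = {q \<in> {..<\<alpha>} \<rightarrow>\<^sub>E V. evv (\<lambda>J \<Phi> r. e (net (\<lambda>l. rep (q l)) J \<Phi> r) \<in> f r)}"

lemma h_cong: "\<forall>\<^sub>F r in F. f r = g r \<Longrightarrow> h f = h g"
proof -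
  assume "\<forall>\<^sub>F r in F. f r = g r"
  then have "evv (\<lambda>J \<Phi> r. f r = g r)" by (simp add: evv_r)
  then have "evv (\<lambda>J \<Phi> r. e (net x J \<Phi> r) \<in> f r) \<longleftrightarrow> evv (\<lambda>J \<Phi> r. e (net x J \<Phi> r) \<in> g r)" for x
    by (rule evv_cong) simp
  then show ?thesis by (simp add: h_def)
qed

lemma h_bool:
  "h (\<lambda>r. f r \<union> g r) = h f \<union> h g" "h (\<lambda>r. f r \<inter> g r) = h f \<inter> h g"
  "h (\<lambda>r. e ` W r - f r) = ({..<\<alpha>} \<rightarrow>\<^sub>E V) - h f" "h (\<lambda>r. {}) = {}" "h (\<lambda>r. e ` W r) = {..<\<alpha>} \<rightarrow>\<^sub>E V"
proof -
  have W: "evv (\<lambda>J \<Phi> r. e (net x J \<Phi> r) \<in> e ` W r)" for x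
    using evv_good by (rule evv_mono) (use net_in in blast)
  show "h (\<lambda>r. e ` W r) = {..<\<alpha>} \<rightarrow>\<^sub>E V" using W by (simp add: h_def)
  show "h (\<lambda>r. e ` W r - f r) = ({..<\<alpha>} \<rightarrow>\<^sub>E V) - h f"
    using W by (auto simp: h_def evv_conj evv_not)
  show "h (\<lambda>r. f r \<union> g r) = h f \<union> h g" by (auto simp: h_def evv_disj)
  show "h (\<lambda>r. f r \<inter> g r) = h f \<inter> h g" by (auto simp: h_def evv_conj)
  show "h (\<lambda>r. {}) = {}" by (simp add: h_def evv_False)
qed

lemma net_agree: "(\<And>l. l \<noteq> i \<Longrightarrow> x l = y l) \<Longrightarrow> agree i (net x J \<Phi> r) (net y J \<Phi> r)"
  by (simp add: agree_def net_def pull_def tr_def)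

lemma h_cyl:
  assumes i: "i < \<alpha>" and f: "\<And>r. f r \<subseteq> e ` W r"
  shows "h (\<lambda>r. cyl (A r) i (f r)) = {q \<in> {..<\<alpha>} \<rightarrow>\<^sub>E V. \<exists>u\<in>V. q(i := u) \<in> h f}"
proof -
  have "evv (\<lambda>J \<Phi> r. e (net (\<lambda>l. rep (q l)) J \<Phi> r) \<in> cyl (A r) i (f r)) \<longleftrightarrow> (\<exists>u\<in>V. q(i := u) \<in> h f)"
    if q: "q \<in> {..<\<alpha>} \<rightarrow>\<^sub>E V" for q
  proof
    assume "\<exists>u\<in>V. q(i := u) \<in> h f"
    then obtain u where "evv (\<lambda>J \<Phi> r. e (net (\<lambda>l. rep ((q(i := u)) l)) J \<Phi> r) \<in> f r)" by (auto simp: h_def)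
    with evv_good have "evv (\<lambda>J \<Phi> r. (good \<Phi> r \<and> finite J) \<and> e (net (\<lambda>l. rep ((q(i := u)) l)) J \<Phi> r) \<in> f r)"
      by (simp add: evv_conj)
    then show "evv (\<lambda>J \<Phi> r. e (net (\<lambda>l. rep (q l)) J \<Phi> r) \<in> cyl (A r) i (f r))"
    proof (rule evv_mono)
      fix J \<Phi> r assume *: "(good \<Phi> r \<and> finite J) \<and> e (net (\<lambda>l. rep ((q(i := u)) l)) J \<Phi> r) \<in> f r"
      have "agree i (net (\<lambda>l. rep (q l)) J \<Phi> r) (net (\<lambda>l. rep ((q(i := u)) l)) J \<Phi> r)" by (rule net_agree) simp
      then show "e (net (\<lambda>l. rep (q l)) J \<Phi> r) \<in> cyl (A r) i (f r)"
        using in_cyl[OF net_in, of \<Phi> r J] net_in * by blast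
    qed
  next
    assume c: "evv (\<lambda>J \<Phi> r. e (net (\<lambda>l. rep (q l)) J \<Phi> r) \<in> cyl (A r) i (f r))"
    \<comment> \<open>At stage \<open>J\<close> the witness is the name whose demand concerns the
      part of \<open>q\<close> on \<open>J\<close>. Almost every \<Phi> contains this name, so its
      demand is met.\<close>
    define \<sigma> where "\<sigma> J = map (\<lambda>l. (l, rep (q l) J)) (sorted_list_of_set J)" for J
    define x where "x J = Witness i f (\<sigma> J)" for J
    let ?q = "q(i := cls x)"
    have "?q \<in> {..<\<alpha>} \<rightarrow>\<^sub>E V" using q i by (auto simp: V_def PiE_iff extensional_def)
    moreover have "evv (\<lambda>J \<Phi> r. e (net (\<lambda>l. rep (?q l)) J \<Phi> r) \<in> f r)"
    proof (rule evv_mono)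
      show "evv (\<lambda>J \<Phi> r. e (net (\<lambda>l. rep (q l)) J \<Phi> r) \<in> cyl (A r) i (f r) \<and> (good \<Phi> r \<and> finite J) \<and>
          i \<in> J \<and> x J \<in> \<Phi> \<and> N \<Phi> r (vl \<Phi> r (x J)) (vl \<Phi> r (rep (cls x) J)) = Same)"
        using c evv_good evv_J[OF U(3)] evv_\<Phi>[of x] near_rep[of x] unfolding near_def by (simp only: evv_conj)
      fix J \<Phi> r
      assume *: "e (net (\<lambda>l. rep (q l)) J \<Phi> r) \<in> cyl (A r) i (f r) \<and> (good \<Phi> r \<and> finite J) \<and>
          i \<in> J \<and> x J \<in> \<Phi> \<and> N \<Phi> r (vl \<Phi> r (x J)) (vl \<Phi> r (rep (cls x) J)) = Same"
      then have gd: "good \<Phi> r" and J: "finite J" "i \<in> J" by auto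
      obtain n where n: "graph (ord_plus \<alpha> n) k r (N \<Phi> r)" "\<And>v. vl \<Phi> r v < ord_plus \<alpha> n"
        by (rule good[OF gd]) (rule that)
      have seq: "seq (vl \<Phi> r) (\<sigma> J) = tr (\<lambda>l. rep (q l)) J \<Phi> r"
        unfolding seq_def \<sigma>_def tr_def fun_eq_iff using J(1) by (simp add: map_of_map_restrict)
      let ?t = "(tr (\<lambda>l. rep (q l)) J \<Phi> r)(i := vl \<Phi> r (x J))"
      have "e (pull \<alpha> ?t (N \<Phi> r)) \<in> f r"
        using good_demand[OF gd, of i f "\<sigma> J"] * i unfolding demand_def seq net_def x_def by blast
      \<comment> \<open>The representative of the class of \<open>x\<close> may be another name, but
        it is \<open>near\<close> to \<open>x\<close>, so at these stages it denotes a point joined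
        to it by \<open>Same\<close> and all labels coincide.\<close>
      moreover have "pull \<alpha> ?t (N \<Phi> r) = net (\<lambda>l. rep (?q l)) J \<Phi> r"
      proof -
        have "N \<Phi> r (?t a) (?t b) = N \<Phi> r (tr (\<lambda>l. rep (?q l)) J \<Phi> r a) (tr (\<lambda>l. rep (?q l)) J \<Phi> r b)"
          if ab: "a < \<alpha>" "b < \<alpha>" for a b
        proof (rule same_cong[OF n(1)])
          have s: "N \<Phi> r (?t a) (tr (\<lambda>l. rep (?q l)) J \<Phi> r a) = Same" for a
            using * J graphD(3)[OF n(1)] by (simp add: tr_def)
          show "N \<Phi> r (?t a) (tr (\<lambda>l. rep (?q l)) J \<Phi> r a) = Same"
            "N \<Phi> r (?t b) (tr (\<lambda>l. rep (?q l)) J \<Phi> r b) = Same" by (rule s)+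
        qed (use ab n(2) tr_less[OF n(2)] in simp_all)
        then show ?thesis by (simp add: net_def pull_def fun_eq_iff)
      qed
      ultimately show "e (net (\<lambda>l. rep (?q l)) J \<Phi> r) \<in> f r" by simp
    qed
    ultimately have "?q \<in> h f" by (simp add: h_def)
    then show "\<exists>u\<in>V. q(i := u) \<in> h f" by (auto simp: V_def)
  qed
  then show ?thesis unfolding h_def by blast
qed

lemma h_diag:
  assumes ij: "i < \<alpha>" "j < \<alpha>"
  shows "h (\<lambda>r. diag (A r) i j) = {q \<in> {..<\<alpha>} \<rightarrow>\<^sub>E V. q i = q j}"
proof -
  have "evv (\<lambda>J \<Phi> r. e (net (\<lambda>l. rep (q l)) J \<Phi> r) \<in> diag (A r) i j) \<longleftrightarrow> q i = q j"
    if q: "q \<in> {..<\<alpha>} \<rightarrow>\<^sub>E V" for q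
  proof -
    have "evv (\<lambda>J \<Phi> r. e (net (\<lambda>l. rep (q l)) J \<Phi> r) \<in> diag (A r) i j) \<longleftrightarrow> near (rep (q i)) (rep (q j))"
      unfolding near_def
    proof (rule evv_cong)
      show "evv (\<lambda>J \<Phi> r. (good \<Phi> r \<and> finite J) \<and> i \<in> J \<and> j \<in> J)"
        using evv_good evv_J[OF U(3)] by (simp add: evv_conj)
      fix J \<Phi> r assume *: "(good \<Phi> r \<and> finite J) \<and> i \<in> J \<and> j \<in> J"
      then show "e (net (\<lambda>l. rep (q l)) J \<Phi> r) \<in> diag (A r) i j \<longleftrightarrow>
          N \<Phi> r (vl \<Phi> r (rep (q i) J)) (vl \<Phi> r (rep (q j) J)) = Same"
        using in_diag[OF net_in, of \<Phi> r J] ij by (simp add: net_def pull_def tr_def)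
    qed
    then show ?thesis using rep_eq[of "q i" "q j"] q ij by (auto simp: PiE_iff)
  qed
  then show ?thesis unfolding h_def by blast
qed

definition base :: "'i \<Rightarrow> ('i set \<Rightarrow> ('i, nat \<Rightarrow> 'w set) name) set" where
  "base = (\<lambda>l\<in>{..<\<alpha>}. {y. near (\<lambda>_. Point l) y})"

text \<open>The class of \<open>Point l\<close> may be represented by another
  \<open>Point (p l)\<close>. As this does not depend on \<open>J\<close>, the networks
  \<open>P r\<close> identify \<open>l\<close> with \<open>p l\<close> for almost all
  \<open>r\<close>, simultaneously for the finitely many \<open>l\<close> in \<open>J\<close>; so
  the sequence \<open>base\<close> reads exactly \<open>P r\<close>.\<close>

lemma base_in_h: "base \<in> h f \<longleftrightarrow> (\<forall>\<^sub>F r in F. e (P r) \<in> f r)"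
proof -
  have "base \<in> {..<\<alpha>} \<rightarrow>\<^sub>E V" by (auto simp: base_def V_def)
  moreover have "evv (\<lambda>J \<Phi> r. e (net (\<lambda>l. rep (base l)) J \<Phi> r) \<in> f r) \<longleftrightarrow> evv (\<lambda>J \<Phi> r. e (P r) \<in> f r)"
  proof -
    obtain p where p: "\<And>l. l < \<alpha> \<Longrightarrow> p l < \<alpha> \<and> rep (cls (\<lambda>_. Point l)) = (\<lambda>_. Point (p l)) \<and> near (\<lambda>_. Point l) (\<lambda>_. Point (p l))"
      using rep_Point by metis
    have PN: "N \<Phi> r a b = P r a b" if "good \<Phi> r" "a < \<alpha>" "b < \<alpha>" for \<Phi> r a b
    proof -
      from fun_cong[OF fun_cong[OF good_pull[OF that(1)], of a], of b] show ?thesis using that(2,3) by (simp add: pull_def)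
    qed
    have same: "\<forall>\<^sub>F r in F. P r l (p l) = Same" if l: "l < \<alpha>" for l
      unfolding evv_r[symmetric]
    proof (rule evv_mono)
      show "evv (\<lambda>J \<Phi> r. (good \<Phi> r \<and> finite J) \<and> N \<Phi> r (vl \<Phi> r (Point l)) (vl \<Phi> r (Point (p l))) = Same)"
        using evv_good p[OF l] unfolding near_def by (simp only: evv_conj)
      fix J \<Phi> r
      assume *: "(good \<Phi> r \<and> finite J) \<and> N \<Phi> r (vl \<Phi> r (Point l)) (vl \<Phi> r (Point (p l))) = Same"
      have "vl \<Phi> r (Point i) = i" if "i < \<alpha>" for i using good_Point * that by simp
      then show "P r l (p l) = Same" using * PN[of \<Phi> r l "p l"] l p[OF l] by simp
    qed
    have "\<forall>\<^sub>F r in F. \<forall>l\<in>J \<inter> {..<\<alpha>}. P r l (p l) = Same" if "finite J" for J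
      using that same by (intro eventually_ball_finite) auto
    then have "\<forall>\<^sub>F J in U. \<forall>\<^sub>F r in F. \<forall>l\<in>J \<inter> {..<\<alpha>}. P r l (p l) = Same"
      using U(2) by (auto elim: eventually_mono)
    then have all: "evv (\<lambda>J \<Phi> r. \<forall>l\<in>J \<inter> {..<\<alpha>}. P r l (p l) = Same)"
      by (simp add: evv_def ultra_const[OF G(1)])
    show ?thesis
    proof (rule evv_cong)
      show "evv (\<lambda>J \<Phi> r. (good \<Phi> r \<and> finite J) \<and> (\<forall>l\<in>J \<inter> {..<\<alpha>}. P r l (p l) = Same))"
        using all evv_good by (simp only: evv_conj)
      fix J \<Phi> r assume *: "(good \<Phi> r \<and> finite J) \<and> (\<forall>l\<in>J \<inter> {..<\<alpha>}. P r l (p l) = Same)"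
      then have gd: "good \<Phi> r" by simp
      have val: "vl \<Phi> r (Point i) = i" if "i < \<alpha>" for i by (rule good_Point[OF gd that])
      have g: "graph \<alpha> k r (P r)" using netsD(1)[OF P] by simp
      define t where "t l = (if l \<in> J then p l else l)" for l
      have t: "tr (\<lambda>l. rep (base l)) J \<Phi> r l = t l" "t l < \<alpha>" "P r l (t l) = Same" if "l < \<alpha>" for l
        using that p[OF that] val[of "p l"] * graphD(3)[OF g] by (auto simp: tr_def base_def t_def)
      have "net (\<lambda>l. rep (base l)) J \<Phi> r = P r"
      proof (intro ext)
        fix a b
        show "net (\<lambda>l. rep (base l)) J \<Phi> r a b = P r a b"
        proof (cases "a < \<alpha> \<and> b < \<alpha>")
          case True
          then have "P r a b = P r (t a) (t b)" using same_cong[OF g t(3) t(3)] t(2) by simp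
          then show ?thesis using True t PN[OF gd] by (simp add: net_def pull_def)
        qed (use graphD(1)[OF g, of a b] in \<open>auto simp: net_def pull_def\<close>)
      qed
      then show "e (net (\<lambda>l. rep (base l)) J \<Phi> r) \<in> f r \<longleftrightarrow> e (P r) \<in> f r" by simp
    qed
  qed
  ultimately show ?thesis by (simp add: h_def evv_r)
qed

end

section \<open>Operations of an ultraproduct and evaluation of terms\<close>

definition upc :: "'r filter \<Rightarrow> ('r \<Rightarrow> ('i, 'a) cyl_alg) \<Rightarrow> ('r \<Rightarrow> 'a) \<Rightarrow> ('r \<Rightarrow> 'a) set" where
  "upc F A f = {g \<in> (\<Pi> r\<in>UNIV. carrier (A r)). \<forall>\<^sub>F r in F. g r = f r}"

lemma upc_self: "f \<in> (\<Pi> r\<in>UNIV. carrier (A r)) \<Longrightarrow> f \<in> upc F A f"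
  by (simp add: upc_def)

lemma upc_eq_iff:
  assumes "f \<in> (\<Pi> r\<in>UNIV. carrier (A r))" "g \<in> (\<Pi> r\<in>UNIV. carrier (A r))"
  shows "upc F A f = upc F A g \<longleftrightarrow> (\<forall>\<^sub>F r in F. f r = g r)"
proof
  assume "upc F A f = upc F A g"
  then show "\<forall>\<^sub>F r in F. f r = g r" using upc_self[OF assms(1), of F] by (simp add: upc_def)
next
  assume eq: "\<forall>\<^sub>F r in F. f r = g r"
  have "(\<forall>\<^sub>F r in F. x r = f r) \<longleftrightarrow> (\<forall>\<^sub>F r in F. x r = g r)" for x
    using eq by (auto elim: eventually_elim2)
  then show "upc F A f = upc F A g" by (simp add: upc_def)
qed

lemma carrier_ultraproduct: "carrier (ultraproduct F A) = upc F A ` (\<Pi> r\<in>UNIV. carrier (A r))"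
  by (auto simp: ultraproduct_def upc_def Let_def)

lemma upc_some:
  assumes "X \<in> carrier (ultraproduct F A)"
  shows "(SOME f. f \<in> X) \<in> (\<Pi> r\<in>UNIV. carrier (A r))" "upc F A (SOME f. f \<in> X) = X"
proof -
  obtain f where f: "f \<in> (\<Pi> r\<in>UNIV. carrier (A r))" "X = upc F A f"
    using assms by (auto simp: carrier_ultraproduct)
  have some: "(SOME g. g \<in> upc F A f) \<in> upc F A f" by (rule someI[of "\<lambda>g. g \<in> upc F A f", OF upc_self[OF f(1)]])
  then show *: "(SOME f. f \<in> X) \<in> (\<Pi> r\<in>UNIV. carrier (A r))" by (simp add: f(2) upc_def)
  show "upc F A (SOME f. f \<in> X) = X"
    using some upc_eq_iff[OF * f(1), of F] unfolding f(2) by (simp add: upc_def[of F A f])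
qed

context
  fixes A :: "'r \<Rightarrow> ('i::wellorder, 'a) cyl_alg" and \<alpha> :: 'i and F :: "'r filter"
  assumes A: "\<And>r. cyl_type \<alpha> (A r)"
begin

abbreviation (input) "PA \<equiv> (\<Pi> r\<in>UNIV. carrier (A r))"

lemma PA_closed:
  "f \<in> PA \<Longrightarrow> g \<in> PA \<Longrightarrow> (\<lambda>r. join (A r) (f r) (g r)) \<in> PA"
  "f \<in> PA \<Longrightarrow> g \<in> PA \<Longrightarrow> (\<lambda>r. meet (A r) (f r) (g r)) \<in> PA"
  "f \<in> PA \<Longrightarrow> (\<lambda>r. compl (A r) (f r)) \<in> PA"
  "(\<lambda>r. zer (A r)) \<in> PA" "(\<lambda>r. one (A r)) \<in> PA"
  "i < \<alpha> \<Longrightarrow> f \<in> PA \<Longrightarrow> (\<lambda>r. cyl (A r) i (f r)) \<in> PA"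
  "i < \<alpha> \<Longrightarrow> j < \<alpha> \<Longrightarrow> (\<lambda>r. diag (A r) i j) \<in> PA"
  using A by (auto simp: cyl_type_def Pi_iff)

lemma ultraproduct_ops:
  "f \<in> PA \<Longrightarrow> g \<in> PA \<Longrightarrow> join (ultraproduct F A) (upc F A f) (upc F A g) = upc F A (\<lambda>r. join (A r) (f r) (g r))"
  "f \<in> PA \<Longrightarrow> g \<in> PA \<Longrightarrow> meet (ultraproduct F A) (upc F A f) (upc F A g) = upc F A (\<lambda>r. meet (A r) (f r) (g r))"
  "f \<in> PA \<Longrightarrow> compl (ultraproduct F A) (upc F A f) = upc F A (\<lambda>r. compl (A r) (f r))"
  "zer (ultraproduct F A) = upc F A (\<lambda>r. zer (A r))" "one (ultraproduct F A) = upc F A (\<lambda>r. one (A r))"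
  "f \<in> PA \<Longrightarrow> cyl (ultraproduct F A) i (upc F A f) = upc F A (\<lambda>r. cyl (A r) i (f r))"
  "diag (ultraproduct F A) i j = upc F A (\<lambda>r. diag (A r) i j)"
proof -
  have two: "{x \<in> PA. \<exists>f'\<in>upc F A f. \<exists>g'\<in>upc F A g. \<forall>\<^sub>F r in F. x r = p r (f' r) (g' r)} = upc F A (\<lambda>r. p r (f r) (g r))"
    if "f \<in> PA" "g \<in> PA" for f g p
  proof -
    have "(\<exists>f'\<in>upc F A f. \<exists>g'\<in>upc F A g. \<forall>\<^sub>F r in F. x r = p r (f' r) (g' r)) \<longleftrightarrow>
        (\<forall>\<^sub>F r in F. x r = p r (f r) (g r))" for x
    proof
      assume "\<exists>f'\<in>upc F A f. \<exists>g'\<in>upc F A g. \<forall>\<^sub>F r in F. x r = p r (f' r) (g' r)"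
      then obtain f' g' where "\<forall>\<^sub>F r in F. f' r = f r" "\<forall>\<^sub>F r in F. g' r = g r"
        "\<forall>\<^sub>F r in F. x r = p r (f' r) (g' r)" by (auto simp: upc_def)
      then show "\<forall>\<^sub>F r in F. x r = p r (f r) (g r)" by eventually_elim simp
    qed (use that upc_self in blast)
    then show ?thesis by (simp add: upc_def[of F A "\<lambda>r. p r (f r) (g r)"])
  qed
  have un: "{x \<in> PA. \<exists>f'\<in>upc F A f. \<forall>\<^sub>F r in F. x r = p r (f' r)} = upc F A (\<lambda>r. p r (f r))"
    if "f \<in> PA" for f p
    using two[OF that that, of "\<lambda>r a b. p r a"] upc_self[OF that, of F] by auto
  have sel: "join (ultraproduct F A) X Y = {x \<in> PA. \<exists>f\<in>X. \<exists>g\<in>Y. \<forall>\<^sub>F r in F. x r = join (A r) (f r) (g r)}"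
    "meet (ultraproduct F A) X Y = {x \<in> PA. \<exists>f\<in>X. \<exists>g\<in>Y. \<forall>\<^sub>F r in F. x r = meet (A r) (f r) (g r)}"
    "compl (ultraproduct F A) X = {x \<in> PA. \<exists>f\<in>X. \<forall>\<^sub>F r in F. x r = compl (A r) (f r)}"
    "cyl (ultraproduct F A) i X = {x \<in> PA. \<exists>f\<in>X. \<forall>\<^sub>F r in F. x r = cyl (A r) i (f r)}" for X Y
    by (simp_all add: ultraproduct_def Let_def)
  show "join (ultraproduct F A) (upc F A f) (upc F A g) = upc F A (\<lambda>r. join (A r) (f r) (g r))"
    "meet (ultraproduct F A) (upc F A f) (upc F A g) = upc F A (\<lambda>r. meet (A r) (f r) (g r))"
    if "f \<in> PA" "g \<in> PA"
    unfolding sel using two[OF that, of "\<lambda>r. join (A r)"] two[OF that, of "\<lambda>r. meet (A r)"] by auto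
  show "compl (ultraproduct F A) (upc F A f) = upc F A (\<lambda>r. compl (A r) (f r))"
    "cyl (ultraproduct F A) i (upc F A f) = upc F A (\<lambda>r. cyl (A r) i (f r))" if "f \<in> PA"
    unfolding sel using un[OF that, of "\<lambda>r. compl (A r)"] un[OF that, of "\<lambda>r. cyl (A r) i"] by auto
  show "zer (ultraproduct F A) = upc F A (\<lambda>r. zer (A r))" "one (ultraproduct F A) = upc F A (\<lambda>r. one (A r))"
    "diag (ultraproduct F A) i j = upc F A (\<lambda>r. diag (A r) i j)"
    by (simp_all add: ultraproduct_def upc_def Let_def)
qed

lemma cyl_type_ultraproduct: "cyl_type \<alpha> (ultraproduct F A)"
  unfolding cyl_type_def carrier_ultraproduct ball_simps
  using PA_closed by (auto simp: ultraproduct_ops)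

text \<open>The theorem of Los for terms. It carries the failure of an equation from almost all
  factors to the ultraproduct.\<close>

lemma eval_term_ultraproduct:
  assumes "\<And>v. \<rho> v \<in> PA" "inds t \<subseteq> {..<\<alpha>}"
  shows "(\<lambda>r. eval_term (A r) (\<lambda>v. \<rho> v r) t) \<in> PA \<and>
    eval_term (ultraproduct F A) (\<lambda>v. upc F A (\<rho> v)) t = upc F A (\<lambda>r. eval_term (A r) (\<lambda>v. \<rho> v r) t)"
  using assms(2)
proof (induction t)
  case (Var v)
  then show ?case using assms(1)[of v] by (simp add: eta_contract_eq)
next
  case (Join s t)
  then show ?case using PA_closed(1) by (simp add: ultraproduct_ops)
next
  case (Meet s t)
  then show ?case using PA_closed(2) by (simp add: ultraproduct_ops)
next
  case (Compl t)
  then show ?case using PA_closed(3) by (simp add: ultraproduct_ops)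
next
  case (Cyl i t)
  then show ?case using PA_closed(6) by (simp add: ultraproduct_ops)
qed (use PA_closed in \<open>simp_all add: ultraproduct_ops\<close>)

end

text \<open>Taking one separating homomorphism for each pair of distinct elements yields an
  embedding into a product. The bases may come from any type, by
  \<open>RCA_any_type\<close>.\<close>

lemma RCA_I:
  fixes A :: "('i::wellorder, 'a) cyl_alg"
  assumes A: "cyl_type \<alpha> A"
    and sep: "\<And>a b. a \<in> carrier A \<Longrightarrow> b \<in> carrier A \<Longrightarrow> a \<noteq> b \<Longrightarrow>
      \<exists>(V :: 'u set) h. cyl_hom \<alpha> A (full_set_alg \<alpha> V) h \<and> h a \<noteq> h b"
  shows "A \<in> RCA \<alpha>"
proof -
  define K where "K = {(a, b). a \<in> carrier A \<and> b \<in> carrier A \<and> a \<noteq> b}"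
  have "\<exists>(V :: 'u set) h. cyl_hom \<alpha> A (full_set_alg \<alpha> V) h \<and> h (fst p) \<noteq> h (snd p)" if "p \<in> K" for p
    using that sep[of "fst p" "snd p"] by (auto simp: K_def)
  then obtain V :: "'a \<times> 'a \<Rightarrow> 'u set" and g
    where g: "\<And>p. p \<in> K \<Longrightarrow> cyl_hom \<alpha> A (full_set_alg \<alpha> (V p)) (g p)"
      "\<And>p. p \<in> K \<Longrightarrow> g p (fst p) \<noteq> g p (snd p)"
    by metis
  let ?C = "\<lambda>p. full_set_alg \<alpha> (V p)"
  have Cs: "\<forall>p\<in>K. ?C p \<in> Cs \<alpha>"
    using cyl_type_full_set_alg by (auto simp: Cs_def subalgebra_def cyl_hom_def)
  have ct: "cyl_type \<alpha> (direct_product K ?C)"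
    by (rule cyl_type_direct_product) (rule cyl_type_full_set_alg)
  have hom: "cyl_hom \<alpha> A (direct_product K ?C) (\<lambda>x. \<lambda>p\<in>K. g p x)"
    using g(1) A ct unfolding cyl_hom_def by (auto simp: direct_product_def fun_eq_iff)
  have "inj_on (\<lambda>x. \<lambda>p\<in>K. g p x) (carrier A)"
  proof (rule inj_onI, rule ccontr)
    fix a b assume *: "a \<in> carrier A" "b \<in> carrier A" "(\<lambda>p\<in>K. g p a) = (\<lambda>p\<in>K. g p b)" "a \<noteq> b"
    then have "(a, b) \<in> K" by (auto simp: K_def)
    then show False using g(2)[of "(a, b)"] fun_cong[OF *(3), of "(a, b)"] by auto
  qed
  from embedding_imp_iso_subalgebra[OF hom this] obtain D where
    "subalgebra \<alpha> D (direct_product K ?C)" "isomorphic \<alpha> A D" by blast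
  with Cs show ?thesis by (rule RCA_any_type)
qed

text \<open>By \<open>h_cong\<close> the value of \<open>h\<close> depends only on the class of its
  argument, so choosing a member of the class is harmless.\<close>

lemma (in representation) ultraproduct_hom:
  "cyl_hom \<alpha> (ultraproduct F A) (full_set_alg \<alpha> V) (\<lambda>X. h (SOME f. f \<in> X))"
proof -
  let ?H = "\<lambda>X. h (SOME f. f \<in> X)" and ?PA = "\<Pi> r\<in>UNIV. carrier (A r)"
  have ct: "\<And>r. cyl_type \<alpha> (A r)" by (rule cyl_type_net_alg)
  note ops = ultraproduct_ops[where A=A and F=F, OF ct]
  note cl = PA_closed[where A=A, OF ct]
  have H: "?H (upc F A f) = h f" if "f \<in> ?PA" for f
  proof (rule h_cong)
    have "(SOME g. g \<in> upc F A f) \<in> upc F A f" by (rule someI[of "\<lambda>g. g \<in> upc F A f", OF upc_self[OF that]])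
    then show "\<forall>\<^sub>F r in F. (SOME g. g \<in> upc F A f) r = f r" by (simp add: upc_def)
  qed
  have sel: "carrier (full_set_alg \<alpha> V) = Pow ({..<\<alpha>} \<rightarrow>\<^sub>E V)"
    "join (full_set_alg \<alpha> V) x y = x \<union> y" "meet (full_set_alg \<alpha> V) x y = x \<inter> y"
    "compl (full_set_alg \<alpha> V) x = ({..<\<alpha>} \<rightarrow>\<^sub>E V) - x" "zer (full_set_alg \<alpha> V) = {}"
    "one (full_set_alg \<alpha> V) = {..<\<alpha>} \<rightarrow>\<^sub>E V"
    "cyl (full_set_alg \<alpha> V) i x = {s \<in> {..<\<alpha>} \<rightarrow>\<^sub>E V. \<exists>u\<in>V. s(i := u) \<in> x}"
    "diag (full_set_alg \<alpha> V) i j = {s \<in> {..<\<alpha>} \<rightarrow>\<^sub>E V. s i = s j}" for x y i j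
    by (simp_all add: full_set_alg_def)
  have *: "h f \<in> Pow ({..<\<alpha>} \<rightarrow>\<^sub>E V)" for f by (auto simp: h_def)
  have J: "?H (upc F A (\<lambda>r. f r \<union> g r)) = h f \<union> h g" "?H (upc F A (\<lambda>r. f r \<inter> g r)) = h f \<inter> h g"
    if "f \<in> ?PA" "g \<in> ?PA" for f g
    using H[OF cl(1)[OF that]] H[OF cl(2)[OF that]] h_bool by simp_all
  have N: "?H (upc F A (\<lambda>r. e ` W r - f r)) = ({..<\<alpha>} \<rightarrow>\<^sub>E V) - h f" if "f \<in> ?PA" for f
    using H[OF cl(3)[OF that]] h_bool by simp
  have Z: "?H (upc F A (\<lambda>r. {})) = {}" "?H (upc F A (\<lambda>r. e ` W r)) = {..<\<alpha>} \<rightarrow>\<^sub>E V"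
    using H[OF cl(4)] H[OF cl(5)] h_bool by simp_all
  have Y: "?H (upc F A (\<lambda>r. cyl (A r) i (f r))) = {s \<in> {..<\<alpha>} \<rightarrow>\<^sub>E V. \<exists>u\<in>V. s(i := u) \<in> h f}"
    if "i < \<alpha>" "f \<in> ?PA" for i f
    using H[OF cl(6)[OF that]] h_cyl[OF that(1), of f] that(2) by (simp add: Pi_iff)
  have D: "?H (upc F A (\<lambda>r. diag (A r) i j)) = {s \<in> {..<\<alpha>} \<rightarrow>\<^sub>E V. s i = s j}" if "i < \<alpha>" "j < \<alpha>" for i j
    using H[OF cl(7)[OF that]] h_diag[OF that] by simp
  show ?thesis
    unfolding cyl_hom_def sel carrier_ultraproduct ball_simps
  proof (intro conjI ballI allI impI)
    show "cyl_type \<alpha> (ultraproduct F A)" by (rule cyl_type_ultraproduct) (rule ct)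
    show "?H (zer (ultraproduct F A)) = {}" "?H (one (ultraproduct F A)) = {..<\<alpha>} \<rightarrow>\<^sub>E V"
      using Z by (simp_all add: ops)
  qed (simp_all only: ops H J N Y D net_alg_sel * cyl_type_full_set_alg)
qed

text \<open>For two distinct classes the base network \<open>P r\<close> is taken from the symmetric
  difference of their representatives wherever these differ. By \<open>base_in_h\<close> the
  sequence \<open>base\<close> then separates the images.\<close>

lemma ultraproduct_net_alg_in_RCA:
  fixes \<alpha> :: "'i::{wellorder,no_top}" and e :: "'i network \<Rightarrow> 'w"
  assumes \<alpha>: "ord_nat 2 < \<alpha>" and k: "k \<ge> 1" and e: "inj e" and F: "nonprincipal_ultrafilter F"
  shows "ultraproduct F (\<lambda>r. net_alg e (nets \<alpha> k r 0)) \<in> RCA \<alpha>"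
proof (rule RCA_I)
  let ?A = "\<lambda>r. net_alg e (nets \<alpha> k r 0)"
  show "cyl_type \<alpha> (ultraproduct F ?A)" by (rule cyl_type_ultraproduct) (rule cyl_type_net_alg)
  fix a b assume ab: "a \<in> carrier (ultraproduct F ?A)" "b \<in> carrier (ultraproduct F ?A)" "a \<noteq> b"
  define f g where "f = (SOME f. f \<in> a)" and "g = (SOME g. g \<in> b)"
  have fg: "f \<in> (\<Pi> r\<in>UNIV. carrier (?A r))" "g \<in> (\<Pi> r\<in>UNIV. carrier (?A r))" "upc F ?A f = a" "upc F ?A g = b"
    using upc_some[OF ab(1)] upc_some[OF ab(2)] by (simp_all add: f_def g_def)
  note uF = ultra_nonprincipal[OF F]
  have "\<not> (\<forall>\<^sub>F r in F. f r = g r)" using upc_eq_iff[OF fg(1,2), of F] fg(3,4) ab(3) by simp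
  then have ne: "\<forall>\<^sub>F r in F. f r \<noteq> g r" using ultra_not[OF uF] by blast
  have "\<exists>N. N \<in> nets \<alpha> k r 0 \<and> (f r \<noteq> g r \<longrightarrow> (e N \<in> f r \<longleftrightarrow> e N \<notin> g r))" for r
  proof (cases "f r = g r")
    case True
    then show ?thesis using clique_in_nets[OF \<alpha>, of "\<lambda>_ _. 0"] by auto
  next
    case False
    moreover have "f r \<subseteq> e ` nets \<alpha> k r 0" "g r \<subseteq> e ` nets \<alpha> k r 0" using fg(1,2) by (auto simp: Pi_iff)
    ultimately show ?thesis by blast
  qed
  then obtain P where P: "\<And>r. P r \<in> nets \<alpha> k r 0" "\<And>r. f r \<noteq> g r \<Longrightarrow> e (P r) \<in> f r \<longleftrightarrow> e (P r) \<notin> g r"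
    by metis
  have diff: "\<forall>\<^sub>F r in F. (e (P r) \<in> f r \<longleftrightarrow> e (P r) \<notin> g r)" using ne P(2) by (rule eventually_mono)
  obtain U :: "'i set filter" where U: "ultra U" "eventually finite U" "\<forall>x. eventually (\<lambda>X. x \<in> X) U"
    using ultrafilter_finite_subsets by blast
  obtain G :: "('i, nat \<Rightarrow> 'w set) name set filter" where
    G: "ultra G" "eventually finite G" "\<forall>x. eventually (\<lambda>X. x \<in> X) G"
    using ultrafilter_finite_subsets by blast
  interpret representation \<alpha> k e F P U G
    by unfold_locales (simp_all add: \<alpha> k[simplified] e F P(1) U G)
  from diff have "(\<forall>\<^sub>F r in F. e (P r) \<in> f r) \<longleftrightarrow> (\<forall>\<^sub>F r in F. e (P r) \<notin> g r)"
    by (auto elim: eventually_elim2)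
  then have "base \<in> h f \<longleftrightarrow> base \<notin> h g" unfolding base_in_h using ultra_not[OF uF] by simp
  then have "h f \<noteq> h g" by blast
  then show "\<exists>(V :: ('i set \<Rightarrow> ('i, nat \<Rightarrow> 'w set) name) set set) H.
      cyl_hom \<alpha> (ultraproduct F ?A) (full_set_alg \<alpha> V) H \<and> H a \<noteq> H b"
    using ultraproduct_hom unfolding f_def g_def by (intro exI conjI)
qed

section \<open>Set algebras and equations\<close>

lemma full_set_alg_sel:
  "carrier (full_set_alg \<alpha> V) = Pow ({..<\<alpha>} \<rightarrow>\<^sub>E V)"
  "join (full_set_alg \<alpha> V) = (\<union>)" "meet (full_set_alg \<alpha> V) = (\<inter>)"
  "compl (full_set_alg \<alpha> V) x = ({..<\<alpha>} \<rightarrow>\<^sub>E V) - x" "zer (full_set_alg \<alpha> V) = {}"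
  "one (full_set_alg \<alpha> V) = {..<\<alpha>} \<rightarrow>\<^sub>E V"
  "cyl (full_set_alg \<alpha> V) i x = {s \<in> {..<\<alpha>} \<rightarrow>\<^sub>E V. \<exists>u\<in>V. s(i := u) \<in> x}"
  "diag (full_set_alg \<alpha> V) i j = {s \<in> {..<\<alpha>} \<rightarrow>\<^sub>E V. s i = s j}"
  by (simp_all add: full_set_alg_def)

lemma PiE_lessThan_upd: "s \<in> {..<\<beta>} \<rightarrow>\<^sub>E V \<Longrightarrow> i < \<beta> \<Longrightarrow> u \<in> V \<Longrightarrow> s(i := u) \<in> {..<\<beta>} \<rightarrow>\<^sub>E V"
  by (auto simp: PiE_iff extensional_def)

lemma PiE_lessThan_mem: "s \<in> {..<\<beta>} \<rightarrow>\<^sub>E V \<Longrightarrow> i < \<beta> \<Longrightarrow> s i \<in> V"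
  by (auto simp: PiE_iff)

lemma full_set_alg_CA: "full_set_alg \<beta> V \<in> CA (\<beta> :: 'i::wellorder)"
proof -
  let ?S = "{..<\<beta>} \<rightarrow>\<^sub>E V"
  let ?c = "\<lambda>i X. {s \<in> ?S. \<exists>u\<in>V. s(i := u) \<in> X}"
  note upd = PiE_lessThan_upd[of _ \<beta> V] and mem = PiE_lessThan_mem[of _ \<beta> V]
  have comm: "?c i (?c j X) \<subseteq> ?c j (?c i X)" if "i < \<beta>" "j < \<beta>" for i j X
  proof (cases "i = j")
    case False
    show ?thesis
    proof
      fix s assume "s \<in> ?c i (?c j X)"
      then obtain u v where "s \<in> ?S" "u \<in> V" "v \<in> V" "s(i := u, j := v) \<in> X" by auto
      then show "s \<in> ?c j (?c i X)" using upd that False by (auto simp: fun_upd_twist)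
    qed
  qed simp
  have c3: "?c i (X \<inter> ?c i Y) = ?c i X \<inter> ?c i Y" if "i < \<beta>" for i X Y
    using upd that by auto
  have c2: "X \<union> ?c i X = ?c i X" if "i < \<beta>" "X \<subseteq> ?S" for i X
  proof -
    have "s \<in> ?c i X" if s: "s \<in> X" for s
    proof -
      have "s \<in> ?S" using s \<open>X \<subseteq> ?S\<close> by blast
      moreover have "s(i := s i) \<in> X" using s by simp
      ultimately show ?thesis using mem \<open>i < \<beta>\<close> by blast
    qed
    then show ?thesis by blast
  qed
  have c6: "{s \<in> ?S. s i = s j} = ?c l ({s \<in> ?S. s i = s l} \<inter> {s \<in> ?S. s l = s j})"
    if "i < \<beta>" "j < \<beta>" "l < \<beta>" "l \<noteq> i" "l \<noteq> j" for i j l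
  proof (intro set_eqI iffI)
    fix s assume "s \<in> {s \<in> ?S. s i = s j}"
    then have "s \<in> ?S" "s i = s j" by auto
    then show "s \<in> ?c l ({s \<in> ?S. s i = s l} \<inter> {s \<in> ?S. s l = s j})"
      using upd[of s l "s i"] mem[of s i] that by auto
  qed (use that in auto)
  have c7: "?c i ({s \<in> ?S. s i = s j} \<inter> X) \<inter> ?c i ({s \<in> ?S. s i = s j} \<inter> (?S - X)) = {}"
    if "i \<noteq> j" for i j X
    using that by auto
  have c4: "?c i (?c j X) = ?c j (?c i X)" if "i < \<beta>" "j < \<beta>" for i j X
    by (rule subset_antisym[OF comm[OF that] comm[OF that(2,1)]])
  have c1: "?c i {} = {}" "{s \<in> ?S. s i = s i} = ?S" for i by auto
  have "boolean_axioms (full_set_alg \<beta> V)"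
    unfolding boolean_axioms_def full_set_alg_sel by auto
  then show ?thesis
    unfolding CA_def mem_Collect_eq full_set_alg_sel
    apply (intro conjI ballI allI impI)
    subgoal by (rule cyl_type_full_set_alg)
    subgoal by assumption
    subgoal by (rule c1)
    subgoal for i X by (rule c2) simp_all
    subgoal for i X Y using c3[of i X Y] by simp
    subgoal for i j X using c4[of i j X] by simp
    subgoal by (rule c1)
    subgoal for i j l using c6[of i j l] by simp
    subgoal for i j X using c7[of i j X] by simp
    done
qed

lemma eval_term_hom:
  assumes "cyl_hom \<alpha> A B g" "inds t \<subseteq> {..<\<alpha>}" "range \<rho> \<subseteq> carrier A"
  shows "eval_term A \<rho> t \<in> carrier A \<and> g (eval_term A \<rho> t) = eval_term B (\<lambda>v. g (\<rho> v)) t"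
  using assms(2) by (induction t) (use assms(1,3) in \<open>auto simp: cyl_hom_def cyl_type_def\<close>)

lemma cyl_hom_comp:
  assumes "cyl_hom \<alpha> A B f" "cyl_hom \<alpha> B C g"
  shows "cyl_hom \<alpha> A C (\<lambda>x. g (f x))"
  using assms unfolding cyl_hom_def by simp

lemma RCA_hom:
  fixes A :: "('i::wellorder, 'a) cyl_alg"
  assumes A: "A \<in> RCA \<alpha>" and ab: "a \<in> carrier A" "b \<in> carrier A" "a \<noteq> b"
  shows "\<exists>(V :: ('i, 'a) wit set) g. cyl_hom \<alpha> A (full_set_alg \<alpha> V) g \<and> g a \<noteq> g b"
proof -
  obtain J :: "('a \<times> 'a) set" and C :: "'a \<times> 'a \<Rightarrow> ('i, ('i \<Rightarrow> ('i, 'a) wit) set) cyl_alg" and D where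
    C: "\<forall>j\<in>J. C j \<in> Cs \<alpha>" and D: "subalgebra \<alpha> D (direct_product J C)" "isomorphic \<alpha> A D"
    using A unfolding RCA_def mem_Collect_eq by (elim exE conjE)
  obtain f where f: "cyl_hom \<alpha> A (direct_product J C) f" and inj: "inj_on f (carrier A)"
    using iso_subalgebra_imp_embedding[OF D] by blast
  have "f a \<noteq> f b" using inj ab by (auto dest: inj_onD)
  moreover have "f a \<in> carrier (direct_product J C)" "f b \<in> carrier (direct_product J C)"
    using f ab by (auto simp: cyl_hom_def)
  ultimately obtain j where j: "j \<in> J" "f a j \<noteq> f b j"
    unfolding direct_product_def by simp (metis PiE_ext)
  obtain V where V: "subalgebra \<alpha> (C j) (full_set_alg \<alpha> V)" using C j by (auto simp: Cs_def)
  have "cyl_hom \<alpha> A (C j) (\<lambda>x. f x j)"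
    using f V j(1) unfolding cyl_hom_def subalgebra_def direct_product_def by (auto simp: PiE_iff)
  from cyl_hom_comp[OF this V[unfolded subalgebra_def]] j(2) show ?thesis by blast
qed

lemma transport_hom:
  assumes B: "cyl_type \<alpha> B" and G: "cyl_type \<alpha> (B\<lparr>carrier := G\<rparr>)" "G \<subseteq> carrier B" and e: "inj_on e G"
  shows "cyl_hom \<alpha> (transport e G B) B (the_inv_into G e)"
proof -
  have d: "the_inv_into G e (e x) = x" if "x \<in> G" for x
    using e that by (rule the_inv_into_f_f)
  have GB: "x \<in> carrier B" if "x \<in> G" for x using G(2) that by auto
  have cl: "x \<in> G \<Longrightarrow> y \<in> G \<Longrightarrow> join B x y \<in> G" "x \<in> G \<Longrightarrow> y \<in> G \<Longrightarrow> meet B x y \<in> G"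
    "x \<in> G \<Longrightarrow> compl B x \<in> G" "zer B \<in> G" "one B \<in> G" "i < \<alpha> \<Longrightarrow> x \<in> G \<Longrightarrow> cyl B i x \<in> G"
    "i < \<alpha> \<Longrightarrow> j < \<alpha> \<Longrightarrow> diag B i j \<in> G" for x y i j
    using G(1) by (simp_all add: cyl_type_def)
  have sel: "carrier (transport e G B) = e ` G"
    "x \<in> G \<Longrightarrow> y \<in> G \<Longrightarrow> join (transport e G B) (e x) (e y) = e (join B x y)"
    "x \<in> G \<Longrightarrow> y \<in> G \<Longrightarrow> meet (transport e G B) (e x) (e y) = e (meet B x y)"
    "x \<in> G \<Longrightarrow> compl (transport e G B) (e x) = e (compl B x)"
    "zer (transport e G B) = e (zer B)" "one (transport e G B) = e (one B)"
    "x \<in> G \<Longrightarrow> cyl (transport e G B) i (e x) = e (cyl B i x)"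
    "diag (transport e G B) i j = e (diag B i j)" for x y i j
    by (simp_all add: transport_def d)
  have "cyl_type \<alpha> (transport e G B)" unfolding cyl_type_def by (simp add: sel cl)
  then show ?thesis
    unfolding cyl_hom_def sel(1) ball_simps using B by (simp add: sel cl d GB)
qed

text \<open>Cylinders over \<alpha>-dimensional sets are insensitive to the coordinates from
  \<alpha> on. This is how a failure in a set algebra becomes a failure in neat reducts of every
  larger dimension.\<close>

lemma full_set_alg_neat_hom:
  fixes \<alpha> \<beta> :: "'i::wellorder" and V :: "'u set"
  assumes ab: "\<alpha> \<le> \<beta>"
  shows "cyl_hom \<alpha> (full_set_alg \<alpha> V) (neat_reduct \<alpha> \<beta> (full_set_alg \<beta> V))
    (\<lambda>X. {s \<in> {..<\<beta>} \<rightarrow>\<^sub>E V. restrict s {..<\<alpha>} \<in> X})"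
proof -
  let ?S = "{..<\<beta>} \<rightarrow>\<^sub>E V" and ?T = "{..<\<alpha>} \<rightarrow>\<^sub>E V"
  let ?R = "neat_reduct \<alpha> \<beta> (full_set_alg \<beta> V)"
  let ?c = "\<lambda>i X. {s \<in> ?S. \<exists>u\<in>V. s(i := u) \<in> X}"
  let ?f = "\<lambda>X. {s \<in> ?S. restrict s {..<\<alpha>} \<in> X}"
  note upd = PiE_lessThan_upd[of _ \<beta> V] and mem = PiE_lessThan_mem[of _ \<beta> V]
  have lt: "i < \<alpha> \<Longrightarrow> i < \<beta>" for i using ab by auto
  have res: "restrict s {..<\<alpha>} \<in> ?T" if "s \<in> ?S" for s using that lt by (auto simp: PiE_iff)
  have res_upd: "restrict (s(i := u)) {..<\<alpha>} = (restrict s {..<\<alpha>})(i := u)" if "i < \<alpha>" for s :: "'i \<Rightarrow> 'u" and i u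
    using that by (auto simp: fun_eq_iff)
  have res_upd': "restrict (s(i := u)) {..<\<alpha>} = restrict s {..<\<alpha>}" if "\<alpha> \<le> i" for s :: "'i \<Rightarrow> 'u" and i u
    using that by (auto simp: fun_eq_iff)
  have closed: "?c i X = X \<longleftrightarrow> (\<forall>s\<in>X. \<forall>u\<in>V. s(i := u) \<in> X)" if "X \<subseteq> ?S" "i < \<beta>" for i X
  proof
    assume eq: "?c i X = X"
    show "\<forall>s\<in>X. \<forall>u\<in>V. s(i := u) \<in> X"
    proof (intro ballI)
      fix s u assume su: "s \<in> X" "u \<in> V"
      then have s: "s \<in> ?S" using that by blast
      have "s(i := u, i := s i) \<in> X" using su by simp
      then have "s(i := u) \<in> ?c i X" using upd[OF s that(2) su(2)] mem[OF s that(2)] by blast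
      then show "s(i := u) \<in> X" by (simp only: eq)
    qed
  next
    assume cl: "\<forall>s\<in>X. \<forall>u\<in>V. s(i := u) \<in> X"
    show "?c i X = X"
    proof (intro set_eqI iffI)
      fix s assume "s \<in> ?c i X"
      then obtain u where "s \<in> ?S" "u \<in> V" "s(i := u) \<in> X" by auto
      then have "s(i := u, i := s i) \<in> X" using cl mem that(2) by blast
      then show "s \<in> X" by simp
    next
      fix s assume s: "s \<in> X"
      then have "s \<in> ?S" "s(i := s i) \<in> X" using that by auto
      then show "s \<in> ?c i X" using mem that(2) by blast
    qed
  qed
  define Q where "Q X \<longleftrightarrow> X \<subseteq> ?S \<and> (\<forall>i. \<alpha> \<le> i \<and> i < \<beta> \<longrightarrow> (\<forall>s\<in>X. \<forall>u\<in>V. s(i := u) \<in> X))" for X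
  have R: "X \<in> carrier ?R \<longleftrightarrow> Q X" for X
  proof -
    have "X \<in> carrier ?R \<longleftrightarrow> X \<subseteq> ?S \<and> (\<forall>i. \<alpha> \<le> i \<and> i < \<beta> \<longrightarrow> ?c i X = X)"
      by (simp add: neat_reduct_def full_set_alg_sel)
    also have "\<dots> \<longleftrightarrow> Q X"
      unfolding Q_def by (intro conj_cong refl iff_allI imp_cong closed) simp_all
    finally show ?thesis .
  qed
  have R': "join ?R = (\<union>)" "meet ?R = (\<inter>)" "compl ?R X = ?S - X" "zer ?R = {}" "one ?R = ?S"
    "cyl ?R i X = ?c i X" "diag ?R i j = {s \<in> ?S. s i = s j}" for X i j
    by (simp_all add: neat_reduct_def full_set_alg_sel)
  have QD: "X \<subseteq> ?S" "\<alpha> \<le> i \<Longrightarrow> i < \<beta> \<Longrightarrow> s \<in> X \<Longrightarrow> u \<in> V \<Longrightarrow> s(i := u) \<in> X" if "Q X" for X i s u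
    using that by (auto simp: Q_def)
  have QI: "Q X" if "X \<subseteq> ?S" "\<And>i s u. \<alpha> \<le> i \<Longrightarrow> i < \<beta> \<Longrightarrow> s \<in> X \<Longrightarrow> u \<in> V \<Longrightarrow> s(i := u) \<in> X" for X
    using that by (auto simp: Q_def)
  have QJ: "Q (X \<union> Y)" "Q (X \<inter> Y)" if "Q X" "Q Y" for X Y
    using QD[OF that(1)] QD[OF that(2)] by (auto intro!: QI)
  have QN: "Q (?S - X)" if "Q X" for X
  proof (rule QI)
    fix i s u assume *: "\<alpha> \<le> i" "i < \<beta>" "s \<in> ?S - X" "u \<in> V"
    have "s(i := u) \<notin> X"
    proof
      assume "s(i := u) \<in> X"
      from QD(2)[OF that *(1,2) this mem[of s i]] * show False by simp
    qed
    then show "s(i := u) \<in> ?S - X" using upd * by blast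
  qed blast
  have QE: "Q {}" "Q ?S" using upd by (auto intro!: QI)
  have QY: "Q (?c j X)" if j: "j < \<alpha>" and X: "Q X" for j X
  proof (rule QI)
    fix i s u assume *: "\<alpha> \<le> i" "i < \<beta>" "s \<in> ?c j X" "u \<in> V"
    obtain v where v: "s \<in> ?S" "v \<in> V" "s(j := v) \<in> X" using *(3) by auto
    have "s(j := v, i := u) \<in> X" by (rule QD(2)[OF X *(1,2) v(3) *(4)])
    moreover have "j \<noteq> i" using *(1) j by auto
    ultimately have "s(i := u, j := v) \<in> X" by (simp add: fun_upd_twist)
    then show "s(i := u) \<in> ?c j X" using upd[OF v(1) *(2,4)] v(2) by blast
  qed blast
  have QG: "Q {s \<in> ?S. s i = s j}" if "i < \<alpha>" "j < \<alpha>" for i j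
    using upd that by (auto intro!: QI)
  have "cyl_type \<alpha> ?R"
    unfolding cyl_type_def R' R Ball_def using QJ QN QE QY QG by simp
  moreover have "?f X \<in> carrier ?R" for X
    unfolding R using upd res_upd' by (auto intro!: QI)
  moreover have "?f {s \<in> ?T. \<exists>u\<in>V. s(i := u) \<in> X} = ?c i (?f X)" if "i < \<alpha>" for i X
    using res res_upd[OF that] upd lt[OF that] by auto
  moreover have "?f {s \<in> ?T. s i = s j} = {s \<in> ?S. s i = s j}" if "i < \<alpha>" "j < \<alpha>" for i j
    using res that by auto
  moreover have "?f (?T - X) = ?S - ?f X" "?f ?T = ?S" for X
    using res by auto
  ultimately show ?thesis
    unfolding cyl_hom_def R' full_set_alg_sel using cyl_type_full_set_alg[of \<alpha> V] by auto
qed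

section \<open>Encodings\<close>

definition pairing :: "'i::{wellorder,no_top} \<times> 'i \<Rightarrow> 'i" where
  "pairing = (SOME f. inj f)"

text \<open>An infinite type is equipollent with its square, so the description in
  \<open>pairing\<close> does pick an injection.\<close>

lemma pairing_eq_iff [simp]: "pairing x = pairing y \<longleftrightarrow> x = (y :: 'i::{wellorder,no_top} \<times> 'i)"
proof -
  have "\<exists>f. bij_betw f (UNIV \<times> UNIV :: ('i \<times> 'i) set) (UNIV :: 'i set)"
    unfolding card_of_ordIso by (rule card_of_Times_same_infinite) (rule infinite_ordinals)
  then obtain f :: "'i \<times> 'i \<Rightarrow> 'i" where "bij_betw f (UNIV \<times> UNIV) UNIV" by blast
  then have "inj f" by (simp add: bij_betw_def)
  then have "inj (pairing :: 'i \<times> 'i \<Rightarrow> 'i)" unfolding pairing_def by (rule someI[of inj])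
  then show ?thesis by (rule inj_eq)
qed

primrec enc_label :: "label \<Rightarrow> 'i::{wellorder,no_top}" where
  "enc_label Same = pairing (ord_nat 0, ord_nat 0)"
| "enc_label (Black j) = pairing (ord_nat 1, ord_nat j)"
| "enc_label Grey = pairing (ord_nat 2, ord_nat 0)"
| "enc_label (Colour c s) = pairing (ord_nat 3, pairing (ord_nat c, ord_nat s))"

lemma enc_label_eq_iff: "enc_label x = enc_label y \<longleftrightarrow> x = y"
  by (cases x; cases y) auto

text \<open>The graph of a network, coded as a set of indices. Elements of the network algebras thus
  get the type \<open>'i set set\<close> used in the theorem.\<close>

definition enc_net :: "'i::{wellorder,no_top} network \<Rightarrow> 'i set" where
  "enc_net N = {pairing (pairing (i, j), enc_label (N i j)) | i j. True}"

lemma inj_enc_net: "inj enc_net"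
proof (rule injI)
  fix N M :: "'a network"
  assume eq: "enc_net N = enc_net M"
  have "N i j = M i j" for i j
  proof -
    have "pairing (pairing (i, j), enc_label (N i j)) \<in> enc_net M"
      unfolding eq[symmetric] by (auto simp: enc_net_def)
    then show ?thesis by (auto simp: enc_net_def enc_label_eq_iff)
  qed
  then show "N = M" by blast
qed

text \<open>Terms in countably many variables are coded by single indices, so every countably
  generated algebra has a copy on the index type and hence on \<open>'i set set\<close>.\<close>

primrec enc_term :: "('i, nat) cterm \<Rightarrow> 'i::{wellorder,no_top}" where
  "enc_term (Var v) = pairing (ord_nat 0, ord_nat v)"
| "enc_term (Join s t) = pairing (ord_nat 1, pairing (enc_term s, enc_term t))"
| "enc_term (Meet s t) = pairing (ord_nat 2, pairing (enc_term s, enc_term t))"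
| "enc_term (Compl t) = pairing (ord_nat 3, enc_term t)"
| "enc_term Zer = pairing (ord_nat 4, ord_nat 0)"
| "enc_term One = pairing (ord_nat 5, ord_nat 0)"
| "enc_term (Cyl i t) = pairing (ord_nat 6, pairing (i, enc_term t))"
| "enc_term (Diag i j) = pairing (ord_nat 7, pairing (i, j))"

lemma enc_term_inject: "enc_term s = enc_term t \<Longrightarrow> s = t"
proof (induction s arbitrary: t)
  case (Var v) then show ?case by (cases t) auto
next
  case (Join s1 s2) then show ?case by (cases t) auto
next
  case (Meet s1 s2) then show ?case by (cases t) auto
next
  case (Compl s) then show ?case by (cases t) auto
next
  case Zer then show ?case by (cases t) auto
next
  case One then show ?case by (cases t) auto
next
  case (Cyl i s) then show ?case by (cases t) auto
next
  case (Diag i j) then show ?case by (cases t) auto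
qed

section \<open>Failing equations\<close>

text \<open>The base may come from a large type, but the failure involves only the countably many
  values of \<rho>. The subalgebra generated by them fails as well, its elements are named by terms,
  and the terms are coded in the required type.\<close>

lemma small_countermodel:
  fixes \<alpha> \<beta> :: "'i::{wellorder,no_top}" and V :: "'u set"
  assumes i: "i < \<alpha>" and ab: "\<alpha> \<le> \<beta>" and eq: "eq_inds eq \<subseteq> {..<\<alpha>}"
    and \<rho>: "range \<rho> \<subseteq> carrier (full_set_alg \<alpha> V)"
    and fail: "eval_term (full_set_alg \<alpha> V) \<rho> (fst eq) \<noteq> eval_term (full_set_alg \<alpha> V) \<rho> (snd eq)"
  shows "\<exists>A :: ('i, 'i set set) cyl_alg. A \<in> SNr_CA \<alpha> \<beta> \<and> \<not> satisfies A eq"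
proof -
  let ?B = "full_set_alg \<alpha> V"
  \<comment> \<open>A placeholder whose carrier, all of \<open>nat\<close>, indexes the generators
    for \<open>generated_part\<close>; its operations carry no meaning.\<close>
  let ?D = "\<lparr>carrier = UNIV, join = (\<lambda>_ _. 0), meet = (\<lambda>_ _. 0), compl = (\<lambda>_. 0), zer = 0, one = 0,
    cyl = (\<lambda>_ _. 0), diag = (\<lambda>_ _. 0)\<rparr> :: ('i, nat) cyl_alg"
  have ct: "cyl_type \<alpha> ?B" by (rule cyl_type_full_set_alg)
  have inds: "inds (fst eq) \<subseteq> {..<\<alpha>}" "inds (snd eq) \<subseteq> {..<\<alpha>}" using eq by (auto simp: eq_inds_def)
  have "\<forall>a\<in>carrier ?D. \<rho> a \<in> carrier ?B" using \<rho> by auto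
  from generated_part[OF full_set_alg_CA this] obtain G and g :: "('i \<Rightarrow> 'u) set \<Rightarrow> ('i, nat) cterm"
    where G: "range \<rho> \<subseteq> G" "G \<subseteq> carrier ?B" "cyl_type \<alpha> (?B\<lparr>carrier := G\<rparr>)" and g: "inj_on g G"
    by auto
  define e where "e x = {{enc_term (g x)}}" for x
  have e: "inj_on e G" using g by (auto simp: inj_on_def e_def dest: enc_term_inject)
  let ?A = "transport e G ?B"
  have car: "carrier ?A = e ` G" by (simp add: transport_def)
  have hom: "cyl_hom \<alpha> ?A ?B (the_inv_into G e)" by (rule transport_hom[OF ct G(3,2) e])
  have inv: "the_inv_into G e (e (\<rho> v)) = \<rho> v" for v
    using the_inv_into_f_f[OF e, of "\<rho> v"] G(1) by blast
  have rng: "range (\<lambda>v. e (\<rho> v)) \<subseteq> carrier ?A" unfolding car using G(1) by blast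
  have ev: "the_inv_into G e (eval_term ?A (\<lambda>v. e (\<rho> v)) t) = eval_term ?B \<rho> t" if "inds t \<subseteq> {..<\<alpha>}" for t
    using eval_term_hom[OF hom that rng] by (simp add: inv)
  have "\<not> satisfies ?A eq"
  proof
    assume "satisfies ?A eq"
    then have "eval_term ?A (\<lambda>v. e (\<rho> v)) (fst eq) = eval_term ?A (\<lambda>v. e (\<rho> v)) (snd eq)"
      using rng unfolding satisfies_def by blast
    then show False using ev[OF inds(1)] ev[OF inds(2)] fail by simp
  qed
  moreover have "?A \<in> SNr_CA \<alpha> \<beta>"
  proof -
    have "eval_term ?B \<rho> (fst eq) \<subseteq> {..<\<alpha>} \<rightarrow>\<^sub>E V" "eval_term ?B \<rho> (snd eq) \<subseteq> {..<\<alpha>} \<rightarrow>\<^sub>E V"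
    proof -
      have id: "cyl_hom \<alpha> ?B ?B (\<lambda>x. x)" using ct by (simp add: cyl_hom_def cyl_type_def)
      show "eval_term ?B \<rho> (fst eq) \<subseteq> {..<\<alpha>} \<rightarrow>\<^sub>E V" "eval_term ?B \<rho> (snd eq) \<subseteq> {..<\<alpha>} \<rightarrow>\<^sub>E V"
        using eval_term_hom[OF id inds(1) \<rho>] eval_term_hom[OF id inds(2) \<rho>] by (auto simp: full_set_alg_sel)
    qed
    \<comment> \<open>Two different sets of sequences cannot both be empty, so the base has a point.
      It is used to prolong \<alpha>-sequences to \<beta>-sequences, which makes the neat embedding
      injective.\<close>
    then obtain s where "s \<in> {..<\<alpha>} \<rightarrow>\<^sub>E V" using fail by blast
    then have v: "s i \<in> V" using i by (auto simp: PiE_iff)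
    let ?f = "\<lambda>X. {s \<in> {..<\<beta>} \<rightarrow>\<^sub>E V. restrict s {..<\<alpha>} \<in> X}"
    have f: "cyl_hom \<alpha> ?A (neat_reduct \<alpha> \<beta> (full_set_alg \<beta> V)) (\<lambda>x. ?f (the_inv_into G e x))"
      by (rule cyl_hom_comp[OF hom full_set_alg_neat_hom[OF ab]])
    have sub: "X \<subseteq> Y" if "X \<subseteq> {..<\<alpha>} \<rightarrow>\<^sub>E V" "?f X = ?f Y" for X Y
    proof
      fix t assume t: "t \<in> X"
      let ?t = "\<lambda>l\<in>{..<\<beta>}. if l < \<alpha> then t l else s i"
      have tS: "t \<in> {..<\<alpha>} \<rightarrow>\<^sub>E V" using that t by blast
      then have "?t \<in> {..<\<beta>} \<rightarrow>\<^sub>E V" using v by (auto simp: PiE_iff)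
      moreover have r: "restrict ?t {..<\<alpha>} = t"
        using tS ab by (auto simp: fun_eq_iff PiE_iff extensional_def)
      ultimately have "?t \<in> ?f X" using t by simp
      then show "t \<in> Y" unfolding that(2) using r by simp
    qed
    have "inj_on (\<lambda>x. ?f (the_inv_into G e x)) (carrier ?A)"
    proof (rule inj_onI)
      fix x y assume "x \<in> carrier ?A" "y \<in> carrier ?A" and eq: "?f (the_inv_into G e x) = ?f (the_inv_into G e y)"
      then obtain x' y' where xy: "x' \<in> G" "y' \<in> G" "x = e x'" "y = e y'" unfolding car by blast
      then have "?f x' = ?f y'" using eq by (simp add: the_inv_into_f_f[OF e])
      moreover have "x' \<subseteq> {..<\<alpha>} \<rightarrow>\<^sub>E V" "y' \<subseteq> {..<\<alpha>} \<rightarrow>\<^sub>E V" using xy G(2) by (auto simp: full_set_alg_sel)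
      ultimately show "x = y" using sub[of x' y'] sub[of y' x'] xy by auto
    qed
    from embedding_imp_iso_subalgebra[OF f this] obtain C where
      "subalgebra \<alpha> C (neat_reduct \<alpha> \<beta> (full_set_alg \<beta> V))" "isomorphic \<alpha> ?A C" by blast
    then show ?thesis by (rule SNr_CA_any_type[OF ab full_set_alg_CA])
  qed
  ultimately show ?thesis by blast
qed

lemma ultra_finite_ex:
  assumes "ultra U" "finite I" "eventually (\<lambda>x. \<exists>i\<in>I. P i x) U"
  shows "\<exists>i\<in>I. eventually (P i) U"
  using assms(2,3)
proof (induction I)
  case empty
  then show ?case using ultra_const[OF assms(1), of False] by simp
next
  case (insert i I)
  then show ?case using ultra_disj[OF assms(1), of "P i"] by auto
qed

text \<open>As \<open>E\<close> is finite, one of its equations fails in almost all of the algebras,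
  hence in the ultraproduct, hence in a full set algebra by representability; from there
  \<open>small_countermodel\<close> brings the failure back to the required type.\<close>

lemma common_countermodel:
  fixes \<alpha> :: "'i::{wellorder,no_top}" and e :: "'i network \<Rightarrow> 'w"
  assumes \<alpha>: "ord_nat 2 < \<alpha>" and k: "k \<ge> 1" and e: "inj e" and ab: "\<alpha> \<le> \<beta>"
    and E: "finite E" "\<And>eq. eq \<in> E \<Longrightarrow> eq_inds eq \<subseteq> {..<\<alpha>}"
    and fail: "\<And>r. \<exists>eq\<in>E. \<not> satisfies (net_alg e (nets \<alpha> k r 0)) eq"
  shows "\<exists>eq\<in>E. \<exists>A :: ('i, 'i set set) cyl_alg. A \<in> SNr_CA \<alpha> \<beta> \<and> \<not> satisfies A eq"
proof -
  let ?A = "\<lambda>r. net_alg e (nets \<alpha> k r 0)"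
  have ct: "\<And>r. cyl_type \<alpha> (?A r)" by (rule cyl_type_net_alg)
  obtain F :: "nat filter" where F: "nonprincipal_ultrafilter F" using nonprincipal_exists by blast
  let ?U = "ultraproduct F ?A"
  have "\<forall>\<^sub>F r in F. \<exists>eq\<in>E. \<not> satisfies (?A r) eq" using fail by simp
  from ultra_finite_ex[OF ultra_nonprincipal[OF F] E(1) this] obtain eq
    where eq: "eq \<in> E" "\<forall>\<^sub>F r in F. \<not> satisfies (?A r) eq" by blast
  have inds: "inds (fst eq) \<subseteq> {..<\<alpha>}" "inds (snd eq) \<subseteq> {..<\<alpha>}" using E(2)[OF eq(1)] by (auto simp: eq_inds_def)
  have "\<exists>\<rho>. range \<rho> \<subseteq> carrier (?A r) \<and>
      (\<not> satisfies (?A r) eq \<longrightarrow> eval_term (?A r) \<rho> (fst eq) \<noteq> eval_term (?A r) \<rho> (snd eq))" for r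
  proof (cases "satisfies (?A r) eq")
    case True
    then show ?thesis by (intro exI[of _ "\<lambda>_. {}"]) auto
  qed (auto simp: satisfies_def)
  then obtain \<rho> where \<rho>: "\<And>r. range (\<rho> r) \<subseteq> carrier (?A r)"
    "\<And>r. \<not> satisfies (?A r) eq \<Longrightarrow> eval_term (?A r) (\<rho> r) (fst eq) \<noteq> eval_term (?A r) (\<rho> r) (snd eq)"
    by metis
  define \<tau> where "\<tau> v r = \<rho> r v" for v r
  have \<tau>: "\<tau> v \<in> (\<Pi> r\<in>UNIV. carrier (?A r))" for v
  proof
    fix r show "\<tau> v r \<in> carrier (?A r)" unfolding \<tau>_def using \<rho>(1)[of r] by blast
  qed
  note los = eval_term_ultraproduct[where A="?A" and F=F, OF ct, of \<tau>, OF \<tau>, unfolded \<tau>_def]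
  define a where "a t = eval_term ?U (\<lambda>v. upc F ?A (\<lambda>r. \<rho> r v)) t" for t
  have a: "a t \<in> carrier ?U" "a t = upc F ?A (\<lambda>r. eval_term (?A r) (\<rho> r) t)" if "inds t \<subseteq> {..<\<alpha>}" for t
    using los[OF that] unfolding a_def carrier_ultraproduct by auto
  have "a (fst eq) \<noteq> a (snd eq)"
  proof
    assume "a (fst eq) = a (snd eq)"
    then have "\<forall>\<^sub>F r in F. eval_term (?A r) (\<rho> r) (fst eq) = eval_term (?A r) (\<rho> r) (snd eq)"
      using a(2)[OF inds(1)] a(2)[OF inds(2)]
        upc_eq_iff[OF conjunct1[OF los[OF inds(1)]] conjunct1[OF los[OF inds(2)]], of F] by simp
    with eq(2) have "\<forall>\<^sub>F r in F. False" by eventually_elim (use \<rho>(2) in blast)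
    then show False using ultra_const[OF ultra_nonprincipal[OF F]] by blast
  qed
  from RCA_hom[OF ultraproduct_net_alg_in_RCA[OF \<alpha> k e F] a(1)[OF inds(1)] a(1)[OF inds(2)] this]
  obtain V :: "('i, (nat \<Rightarrow> 'w set) set) wit set" and g
    where g: "cyl_hom \<alpha> ?U (full_set_alg \<alpha> V) g" "g (a (fst eq)) \<noteq> g (a (snd eq))" by blast
  have rng: "range (\<lambda>v. upc F ?A (\<lambda>r. \<rho> r v)) \<subseteq> carrier ?U"
    unfolding carrier_ultraproduct using \<tau> by (auto simp: \<tau>_def[abs_def])
  then have "range (\<lambda>v. g (upc F ?A (\<lambda>r. \<rho> r v))) \<subseteq> carrier (full_set_alg \<alpha> V)"
    using g(1) unfolding cyl_hom_def by blast
  moreover have "g (a t) = eval_term (full_set_alg \<alpha> V) (\<lambda>v. g (upc F ?A (\<lambda>r. \<rho> r v))) t" if "inds t \<subseteq> {..<\<alpha>}" for t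
    unfolding a_def using eval_term_hom[OF g(1) that rng] by blast
  ultimately show ?thesis
    using small_countermodel[OF ord_nats_less(1)[OF \<alpha>] ab E(2)[OF eq(1)], of "\<lambda>v. g (upc F ?A (\<lambda>r. \<rho> r v))" V]
      g(2) inds eq(1) by metis
qed

subsection \<open>Permutations of the indices\<close>

abbreviation rename :: "('j \<Rightarrow> 'i) \<Rightarrow> ('j, 'v) cterm \<times> ('j, 'v) cterm \<Rightarrow> ('i, 'v) cterm \<times> ('i, 'v) cterm" where
  "rename \<sigma> \<equiv> map_prod (map_cterm \<sigma> id) (map_cterm \<sigma> id)"

text \<open>Finitely supported permutations of the coordinates permute the networks. The induced
  bijection \<open>G\<close> of the algebra turns the operations at \<open>i\<close> into those at
  \<open>p i\<close>, so validity is invariant under renaming.\<close>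

lemma net_alg_rename:
  fixes \<alpha> :: "'i::{wellorder,no_top}"
  assumes e: "inj e" and p: "fv \<alpha> \<alpha> p" "inj_on p {..<\<alpha>}"
    and eq: "eq_inds eq \<subseteq> {..<\<alpha>}" and sat: "satisfies (net_alg e (nets \<alpha> k r 0)) eq"
  shows "satisfies (net_alg e (nets \<alpha> k r 0)) (rename p eq)"
proof -
  let ?W = "nets \<alpha> k r 0"
  let ?A = "net_alg e ?W"
  have in_cyl: "e N \<in> cyl ?A i X \<longleftrightarrow> (\<exists>M\<in>?W. e M \<in> X \<and> agree i N M)" if "N \<in> ?W" for N i X
    by (rule in_cyl_net_alg[OF inj_on_subset[OF e subset_UNIV] that])
  have in_diag: "e N \<in> diag ?A i j \<longleftrightarrow> N i j = Same" if "N \<in> ?W" for N i j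
    by (rule in_diag_net_alg[OF inj_on_subset[OF e subset_UNIV] that])
  have out: "N a b = Same" if "N \<in> ?W" "\<not> (a < \<alpha> \<and> b < \<alpha>)" for N a b
    using graphD(1)[OF netsD(1)[OF that(1)], of a b] that(2) by simp
  have plt: "p a < \<alpha>" if "a < \<alpha>" for a using p(1) that by (simp add: fv_def)
  define q where "q = the_inv_into {..<\<alpha>} p"
  have qp: "q (p a) = a" if "a < \<alpha>" for a unfolding q_def using the_inv_into_f_f[OF p(2)] that by simp
  have pq: "p (q a) = a" "q a < \<alpha>" if a: "a < \<alpha>" for a
  proof -
    obtain b where "b < \<alpha>" "a = p b" using surj_fv[OF p a] by auto
    then show "p (q a) = a" "q a < \<alpha>" using qp[of b] by auto
  qed
  have q: "fv \<alpha> \<alpha> q"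
  proof -
    have "{a. a < \<alpha> \<and> q a \<noteq> a} \<subseteq> {a. a < \<alpha> \<and> p a \<noteq> a}" using qp by force
    from finite_subset[OF this] p(1) pq(2) show ?thesis by (simp add: fv_def)
  qed
  define P where "P N = pull \<alpha> p N" for N
  define Q where "Q N = pull \<alpha> q N" for N
  have PW: "P N \<in> ?W" "Q N \<in> ?W" if "N \<in> ?W" for N
    using nets_pull[of N \<alpha> k r 0 0 p] nets_pull[of N \<alpha> k r 0 0 q] that p(1) q by (simp_all add: P_def Q_def)
  have PQ: "P (Q N) = N" "Q (P N) = N" if "N \<in> ?W" for N
    using out[OF that] pq qp plt by (auto simp: P_def Q_def pull_def fun_eq_iff)
  have agP: "agree i (P N) (P M)" if "agree (p i) N M" "i < \<alpha>" for i N M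
    using that inj_onD[OF p(2)] by (auto simp: agree_def P_def pull_def)
  have agQ: "agree (p i) (Q N) (Q M)" if "agree i N M" "i < \<alpha>" for i N M
  proof -
    have "q a \<noteq> i" if "a < \<alpha>" "a \<noteq> p i" for a using pq(1)[OF that(1)] that(2) by auto
    then show ?thesis using that(1) by (simp add: agree_def Q_def pull_def)
  qed
  define G where "G X = {e N | N. N \<in> ?W \<and> e (P N) \<in> X}" for X
  have inG: "e N \<in> G X \<longleftrightarrow> e (P N) \<in> X" if "N \<in> ?W" for N X using that e by (auto simp: G_def inj_eq)
  have GW: "G X \<subseteq> e ` ?W" for X by (auto simp: G_def)
  have G_cyl: "G (cyl ?A i X) = cyl ?A (p i) (G X)" if i: "i < \<alpha>" for i X
  proof (rule net_alg_eqI[OF GW cyl_net_alg_subset(1)])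
    fix N assume N: "N \<in> ?W"
    have "(\<exists>M\<in>?W. e M \<in> X \<and> agree i (P N) M) \<longleftrightarrow> (\<exists>M\<in>?W. e M \<in> G X \<and> agree (p i) N M)"
    proof
      assume "\<exists>M\<in>?W. e M \<in> X \<and> agree i (P N) M"
      then obtain M where M: "M \<in> ?W" "e M \<in> X" "agree i (P N) M" by blast
      have "agree (p i) N (Q M)" using agQ[OF M(3) i] PQ(2)[OF N] by simp
      moreover have "e (Q M) \<in> G X" using inG[OF PW(2)[OF M(1)]] PQ(1)[OF M(1)] M(2) by simp
      ultimately show "\<exists>M\<in>?W. e M \<in> G X \<and> agree (p i) N M" using PW(2)[OF M(1)] by blast
    next
      assume "\<exists>M\<in>?W. e M \<in> G X \<and> agree (p i) N M"
      then obtain M where M: "M \<in> ?W" "e M \<in> G X" "agree (p i) N M" by blast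
      then show "\<exists>M\<in>?W. e M \<in> X \<and> agree i (P N) M" using agP[OF M(3) i] inG[OF M(1)] PW(1)[OF M(1)] by blast
    qed
    then show "e N \<in> G (cyl ?A i X) \<longleftrightarrow> e N \<in> cyl ?A (p i) (G X)"
      by (simp only: inG[OF N] in_cyl[OF N] in_cyl[OF PW(1)[OF N]])
  qed
  have G_diag: "G (diag ?A i j) = diag ?A (p i) (p j)" if "i < \<alpha>" "j < \<alpha>" for i j
  proof (rule net_alg_eqI[OF GW cyl_net_alg_subset(2)])
    fix N assume N: "N \<in> ?W"
    have "P N i j = N (p i) (p j)" using that by (simp add: P_def pull_def)
    then show "e N \<in> G (diag ?A i j) \<longleftrightarrow> e N \<in> diag ?A (p i) (p j)"
      by (simp only: inG[OF N] in_diag[OF N] in_diag[OF PW(1)[OF N]])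
  qed
  have GI: "G X = Y" if "Y \<subseteq> e ` ?W" "\<And>N. N \<in> ?W \<Longrightarrow> e (P N) \<in> X \<longleftrightarrow> e N \<in> Y" for X Y
    by (rule net_alg_eqI[OF GW that(1)]) (simp only: inG that(2))
  have "G (X \<union> Y) = G X \<union> G Y" "G (X \<inter> Y) = G X \<inter> G Y" for X Y
    using GW[of X] GW[of Y] by (auto intro!: GI simp: inG)
  moreover have "G (e ` ?W - X) = e ` ?W - G X" for X
    by (rule GI) (auto simp: inG PW(1))
  moreover have "G {} = {}" "G (e ` ?W) = e ` ?W"
    by (rule GI; simp add: PW(1))+
  ultimately have G_bool: "G (X \<union> Y) = G X \<union> G Y" "G (X \<inter> Y) = G X \<inter> G Y" "G (e ` ?W - X) = e ` ?W - G X"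
    "G {} = {}" "G (e ` ?W) = e ` ?W" for X Y by simp_all
  have eval: "eval_term ?A (\<lambda>v. G (\<rho> v)) (map_cterm p id t) = G (eval_term ?A \<rho> t)"
    if "inds t \<subseteq> {..<\<alpha>}" for \<rho> :: "nat \<Rightarrow> _" and t
    using that by (induction t) (auto simp: G_bool G_cyl G_diag)
  show ?thesis
    unfolding satisfies_def
  proof (intro allI impI)
    fix \<rho> :: "nat \<Rightarrow> _" assume \<rho>: "range \<rho> \<subseteq> carrier ?A"
    define \<tau> where "\<tau> v = {e N | N. N \<in> ?W \<and> e (Q N) \<in> \<rho> v}" for v
    have "G (\<tau> v) = \<rho> v" for v
    proof (rule net_alg_eqI[OF GW])
      show "\<rho> v \<subseteq> e ` ?W" using \<rho> by auto
      fix N assume N: "N \<in> ?W"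
      have "e (P N) \<in> \<tau> v \<longleftrightarrow> e (Q (P N)) \<in> \<rho> v"
        using PW(1)[OF N] e by (auto simp: \<tau>_def inj_eq)
      then show "e N \<in> G (\<tau> v) \<longleftrightarrow> e N \<in> \<rho> v" by (simp only: inG[OF N] PQ(2)[OF N])
    qed
    then have \<rho>_eq: "\<rho> = (\<lambda>v. G (\<tau> v))" by auto
    have "range \<tau> \<subseteq> carrier ?A" by (auto simp: \<tau>_def)
    then have "eval_term ?A \<tau> (fst eq) = eval_term ?A \<tau> (snd eq)" using sat by (simp add: satisfies_def)
    then show "eval_term ?A \<rho> (fst (rename p eq)) = eval_term ?A \<rho> (snd (rename p eq))"
      unfolding \<rho>_eq using eval eq by (simp add: eq_inds_def)
  qed
qed

text \<open>The prescribed part maps \<open>T\<close> onto \<open>T'\<close>. The two differences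
  \<open>T' - T\<close> and \<open>T - T'\<close> have equally many elements, so sending the former
  onto the latter and fixing everything else closes it to a permutation.\<close>

lemma permutation_extending:
  fixes \<alpha> :: "'i::{wellorder,no_top}"
  assumes S: "finite S" and t: "inj_on t S" "t ` S \<subseteq> {..<\<alpha>}" and s: "inj_on s S" "s ` S \<subseteq> {..<\<alpha>}"
  shows "\<exists>p. fv \<alpha> \<alpha> p \<and> inj_on p {..<\<alpha>} \<and> (\<forall>x\<in>S. p (t x) = s x)"
proof -
  define T T' where TT': "T = t ` S" "T' = s ` S"
  have fin: "finite T" "finite T'" using S by (auto simp: TT')
  have "card T = card T'" using t(1) s(1) by (simp add: card_image TT')
  then have "card (T' - T) = card (T - T')"
    using fin by (simp add: card_Diff_subset_Int Int_commute)
  then obtain d where d: "bij_betw d (T' - T) (T - T')"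
    using fin finite_same_card_bij[of "T' - T" "T - T'"] by blast
  define p where "p x = (if x \<in> T then s (the_inv_into S t x) else if x \<in> T' then d x else x)" for x
  have pt: "p (t x) = s x" if "x \<in> S" for x
    using that the_inv_into_f_f[OF t(1) that] by (simp add: p_def TT')
  have p1: "p x \<in> T'" if "x \<in> T" for x using that pt by (auto simp: TT')
  have p2: "p x \<in> T - T'" if "x \<in> T' - T" for x
    using that bij_betwE[OF d] by (simp add: p_def)
  have p3: "p x = x" if "x \<notin> T" "x \<notin> T'" for x using that by (simp add: p_def)
  have i1: "x = y" if "x \<in> T" "y \<in> T" "p x = p y" for x y
  proof -
    note xy = that
    obtain a b where "a \<in> S" "b \<in> S" "x = t a" "y = t b" using xy(1,2) unfolding TT' by blast
    then show ?thesis using xy(3) pt inj_onD[OF s(1), of a b] by simp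
  qed
  have i2: "x = y" if "x \<in> T' - T" "y \<in> T' - T" "p x = p y" for x y
    using that inj_onD[OF bij_betw_imp_inj_on[OF d], of x y] by (simp add: p_def)
  have "inj p"
  proof (rule injI)
    fix x y assume eq: "p x = p y"
    have yc: "y \<in> T \<and> p y \<in> T' \<or> y \<in> T' - T \<and> p y \<in> T - T' \<or> y \<notin> T \<union> T' \<and> p y = y"
      using p1[of y] p2[of y] p3[of y] by blast
    consider "x \<in> T" | "x \<in> T' - T" | "x \<notin> T" "x \<notin> T'" by blast
    then show "x = y"
    proof cases
      case 1
      then have "y \<in> T" using yc p1[OF 1] unfolding eq by auto
      then show ?thesis by (rule i1[OF 1 _ eq])
    next
      case 2
      then have "y \<in> T' - T" using yc p2[OF 2] unfolding eq by auto
      then show ?thesis by (rule i2[OF 2 _ eq])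
    next
      case 3
      have "p y = x" using p3[OF 3] eq by simp
      then show ?thesis using yc 3 by auto
    qed
  qed
  moreover have "fv \<alpha> \<alpha> p"
  proof (rule fv_finite_change[OF fv_id[OF order_refl], of "T \<union> T'"])
    show "p x < \<alpha>" if "x < \<alpha>" for x
      using p1[of x] p2[of x] p3[of x] t(2)[folded TT'] s(2)[folded TT'] that by (cases "x \<in> T"; cases "x \<in> T'") auto
  qed (use fin p3 in auto)
  ultimately show ?thesis using pt inj_on_subset[of p UNIV] by blast
qed

lemma eq_inds_rename: "eq_inds (rename \<sigma> eq) = \<sigma> ` eq_inds eq"
  by (cases eq) (simp add: eq_inds_def cterm.set_map image_Un)

text \<open>Two instances of a scheme differ by a finitely supported permutation of the indices.
  Used contrapositively: if some instance fails, then so does every other one, in particular one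
  fixed in advance of \<open>r\<close>.\<close>

lemma scheme_instance_fails:
  fixes \<alpha> :: "'i::{wellorder,no_top}"
  assumes e: "inj e" and i: "i1 \<in> scheme_instances \<alpha> eq" "i2 \<in> scheme_instances \<alpha> eq"
    and sat: "satisfies (net_alg e (nets \<alpha> k r 0)) i1"
  shows "satisfies (net_alg e (nets \<alpha> k r 0)) i2"
proof -
  obtain t s where ts: "i1 = rename t eq" "inj_on t (eq_inds eq)" "t ` eq_inds eq \<subseteq> {..<\<alpha>}"
    "i2 = rename s eq" "inj_on s (eq_inds eq)" "s ` eq_inds eq \<subseteq> {..<\<alpha>}"
    using i unfolding scheme_instances_def by auto
  have "finite (inds t)" for t :: "(nat, nat) cterm" by (induction t) auto
  then have "finite (eq_inds eq)" by (simp add: eq_inds_def)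
  from permutation_extending[OF this ts(2,3,5,6)] obtain p where
    p: "fv \<alpha> \<alpha> p" "inj_on p {..<\<alpha>}" "\<And>x. x \<in> eq_inds eq \<Longrightarrow> p (t x) = s x" by blast
  have "map_cterm p id (map_cterm t id u) = map_cterm s id u" if "inds u \<subseteq> eq_inds eq" for u :: "(nat, nat) cterm"
    unfolding cterm.map_comp by (rule cterm.map_cong0) (use p(3) that in auto)
  then have "rename p i1 = i2" unfolding ts(1,4) by (cases eq) (simp add: eq_inds_def)
  moreover have "eq_inds i1 \<subseteq> {..<\<alpha>}"
    using ts(3) unfolding ts(1) eq_inds_rename .
  ultimately show ?thesis using net_alg_rename[OF e p(1,2) _ sat] by simp
qed

theorem theorem9p8:
  fixes \<alpha> :: "'i::{wellorder,no_top}" and k :: nat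
  assumes "ord_nat 2 < \<alpha>" and "k \<ge> 1"
  shows "(\<exists>A :: nat \<Rightarrow> ('i, 'i set set) cyl_alg.
            (\<forall>r. A r \<in> Nr_CA \<alpha> (ord_plus \<alpha> k) - SNr_CA \<alpha> (ord_plus \<alpha> (k + 1))) \<and>
            (\<forall>F. nonprincipal_ultrafilter F \<longrightarrow> ultraproduct F A \<in> RCA \<alpha>)) \<and>
         \<not> finite_schema_axiomatizable_over \<alpha>
              (SNr_CA \<alpha> (ord_plus \<alpha> (k + 1)) :: ('i, 'i set set) cyl_alg set)
              (SNr_CA \<alpha> (ord_plus \<alpha> k))"
proof
  define A :: "nat \<Rightarrow> ('i, 'i set set) cyl_alg" where "A r = net_alg enc_net (nets \<alpha> k r 0)" for r
  let ?V = "SNr_CA \<alpha> (ord_plus \<alpha> (k + 1)) :: ('i, 'i set set) cyl_alg set"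
  let ?W = "SNr_CA \<alpha> (ord_plus \<alpha> k) :: ('i, 'i set set) cyl_alg set"
  have Nr: "A r \<in> Nr_CA \<alpha> (ord_plus \<alpha> k)" for r
    unfolding A_def by (rule net_alg_in_Nr_CA[OF assms(1) inj_enc_net])
  have V: "A r \<notin> ?V" for r
    unfolding A_def by (rule net_alg_not_in_SNr_CA[OF assms(1) inj_enc_net])
  have "ultraproduct F A \<in> RCA \<alpha>" if "nonprincipal_ultrafilter F" for F
    unfolding A_def[abs_def] by (rule ultraproduct_net_alg_in_RCA[OF assms inj_enc_net that])
  with Nr V show "\<exists>A :: nat \<Rightarrow> ('i, 'i set set) cyl_alg.
            (\<forall>r. A r \<in> Nr_CA \<alpha> (ord_plus \<alpha> k) - SNr_CA \<alpha> (ord_plus \<alpha> (k + 1))) \<and>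
            (\<forall>F. nonprincipal_ultrafilter F \<longrightarrow> ultraproduct F A \<in> RCA \<alpha>)" by blast
  have W: "A r \<in> ?W" for r
  proof -
    obtain B :: "('i, ('i, 'i set set) cterm) cyl_alg" where
      B: "B \<in> CA (ord_plus \<alpha> k)" "isomorphic \<alpha> (A r) (neat_reduct \<alpha> (ord_plus \<alpha> k) B)"
      using Nr[of r] by (auto simp: Nr_CA_def)
    have "subalgebra \<alpha> (neat_reduct \<alpha> (ord_plus \<alpha> k) B) (neat_reduct \<alpha> (ord_plus \<alpha> k) B)"
      using B(2) by (auto simp: subalgebra_def isomorphic_def cyl_hom_def)
    from SNr_CA_any_type[OF ord_plus_ge B(1) this B(2)] show ?thesis .
  qed
  \<comment> \<open>In both cases an axiomatization would supply a finite set of equations with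
    indices below \<alpha> that hold throughout \<open>?V\<close>, while each \<open>A r\<close>
    violates one of them.\<close>
  have counter: False
    if E: "finite E" "\<And>eq. eq \<in> E \<Longrightarrow> eq_inds eq \<subseteq> {..<\<alpha>}" "\<And>r. \<exists>eq\<in>E. \<not> satisfies (A r) eq"
      and sat: "\<And>A eq. A \<in> ?V \<Longrightarrow> eq \<in> E \<Longrightarrow> satisfies A eq" for E
    using common_countermodel[OF assms inj_enc_net ord_plus_ge E(1,2), of "k + 1"] E(3)[unfolded A_def] sat by blast
  show "\<not> finite_schema_axiomatizable_over \<alpha> ?V ?W"
  proof
    assume ax: "finite_schema_axiomatizable_over \<alpha> ?V ?W"
    show False
    proof (cases "finite {..<\<alpha>}")
      case True
      then obtain E :: "'i equation set" where E: "finite E" "\<forall>eq\<in>E. eq_inds eq \<subseteq> {..<\<alpha>}"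
        "?V = {A \<in> ?W. \<forall>eq\<in>E. satisfies A eq}"
        using ax unfolding finite_schema_axiomatizable_over_def by auto
      show False
      proof (rule counter[OF E(1)])
        show "\<exists>eq\<in>E. \<not> satisfies (A r) eq" for r using V[of r] W[of r] unfolding E(3) by blast
      qed (use E(2) in blast, use E(3) in blast)
    next
      case False
      then obtain E :: "nat equation set" where E: "finite E"
        "?V = {A \<in> ?W. \<forall>eq\<in>E. \<forall>eq'\<in>scheme_instances \<alpha> eq. satisfies A eq'}"
        using ax unfolding finite_schema_axiomatizable_over_def by auto
      \<comment> \<open>One instance for each scheme, chosen before \<open>r\<close>. Restricting
        \<open>E'\<close> to schemes that have instances makes every chosen equation a genuine
        one.\<close>
      define inst where "inst eq = (SOME eq'. eq' \<in> scheme_instances \<alpha> eq)" for eq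
      define E' where "E' = inst ` {eq \<in> E. scheme_instances \<alpha> eq \<noteq> {}}"
      have inst: "inst eq \<in> scheme_instances \<alpha> eq" if "eq' \<in> scheme_instances \<alpha> eq" for eq eq'
        unfolding inst_def by (rule someI[of "\<lambda>x. x \<in> scheme_instances \<alpha> eq", OF that])
      show False
      proof (rule counter[of E'])
        show "finite E'" using E(1) by (simp add: E'_def)
        show "eq_inds eq \<subseteq> {..<\<alpha>}" if "eq \<in> E'" for eq
        proof -
          obtain eq0 x where "eq = inst eq0" "x \<in> scheme_instances \<alpha> eq0"
            using \<open>eq \<in> E'\<close> unfolding E'_def by auto
          then have "eq \<in> scheme_instances \<alpha> eq0" using inst by simp
          then obtain \<sigma> where "eq = rename \<sigma> eq0" "\<sigma> ` eq_inds eq0 \<subseteq> {..<\<alpha>}"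
            unfolding scheme_instances_def by auto
          then show ?thesis by (simp only: eq_inds_rename)
        qed
        show "\<exists>eq\<in>E'. \<not> satisfies (A r) eq" for r
        proof -
          obtain eq eq' where *: "eq \<in> E" "eq' \<in> scheme_instances \<alpha> eq" "\<not> satisfies (A r) eq'"
            using V[of r] W[of r] unfolding E(2) by blast
          then have "\<not> satisfies (A r) (inst eq)"
            using scheme_instance_fails[OF inj_enc_net inst[OF *(2)] *(2)] unfolding A_def by blast
          then show ?thesis using *(1,2) unfolding E'_def by blast
        qed
        show "satisfies A eq" if AV: "A \<in> ?V" and eq: "eq \<in> E'" for A eq
        proof -
          obtain eq0 x where *: "eq0 \<in> E" "eq = inst eq0" "x \<in> scheme_instances \<alpha> eq0"
            using eq unfolding E'_def by auto
          then have "eq \<in> scheme_instances \<alpha> eq0" using inst by simp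
          then show ?thesis using AV *(1) unfolding E(2) by blast
        qed
      qed
    qed
  qed
qed

end
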